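(* Fix an integer $n\ge1$ and numbers $0<\delta_1,\dots,\delta_n\le 1$. For each $i\in\{1,\dots,n\}$ let $X_i\in\{I(\delta_i),S(\delta_i/2)\}$, and let $X=X_1\boxtimes\dots\boxtimes X_n$. Then for all $\alpha\in[0,1]$ there is either a cuboid or an anti-cuboid contained within (i.e. belonging to) $\operatorname{Iso}_X(\alpha)$. In particular, if $\delta_1\le\dots\le\delta_n$, then $$\operatorname{iso}_X(\alpha)=\min_{t\in\{0,\dots,n\}}\min\bigl\{\hat c_{\delta_1,\dots,\delta_t}(\alpha),\ \hat a_{\delta_1,\dots,\delta_t}(\alpha)\bigr\}\qquad\text{for all }\alpha\in(0,1].$$
   Context: $\mathcal L$ is Lebesgue measure. For $\delta\in(0,1]$: the interval $I(\delta)$ is $[0,1]$ with Lebesgue measure and metric $d(x,y)=\frac1\delta|x-y|$; the circle $S(\delta)$ is $[0,1)$ with Lebesgue measure and metric $d(x,y)=\frac1\delta\min\{|x-y|,1-|x-y|\}$. The strong product $\boxtimes$ of such spaces is the Cartesian product of the ground sets with the product measure (one need not distinguish it from its completion) and the metric given by the maximum of the coordinate metrics. For a space $\Omega$ with metric $d$ and measure $\mu$: $N_\Omega[A]=\{\omega\in\Omega: d(\omega,a)<1\text{ for some }a\in A\}$; $\operatorname{iso}_\Omega(\alpha)=\inf\{\mu(N_\Omega[A]): A\text{ measurable},\ \mu(A)\ge\alpha\}$; $\operatorname{Iso}_\Omega(\alpha)$ is the set of measurable $A\subseteq\Omega$ with $\mu(A)\ge\alpha$ and $\mu(N_\Omega[A])=\operatorname{iso}_\Omega(\alpha)$.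 A cuboid is a set $\prod_{i=1}^n[0,x_i]$ and an anti-cuboid is a set $\bigcup_{i=1}^n\{a\in[0,1]^n:a_i<x_i\}$, with $x_1,\dots,x_n\in[0,1]$ (intersected with the ground set of $X$ when some factors are circles, whose ground set is $[0,1)$). For $t\ge1$ and $0<\delta_1\le\dots\le\delta_t\le1$, define functions on $[0,1]$ with values in $\mathbb R\cup\{+\infty\}$: $\hat c_{\delta_1,\dots,\delta_t}(x)=\bigl(x^{1/t}+(\prod_{i=1}^t\delta_i)^{1/t}\bigr)^t$ if $0\le x\le\prod_{i=1}^t\frac{\delta_i}{\delta_t}$, and $+\infty$ otherwise; $\hat a_{\delta_1,\dots,\delta_t}(x)=1-\bigl((1-x)^{1/t}-(\prod_{i=1}^t\delta_i)^{1/t}\bigr)^t$ if $0\le x\le1-\prod_{i=1}^t\delta_i$, and $+\infty$ otherwise. For $t=0$ both functions are identically $1$. *)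

theory Defs
  imports "HOL-Analysis.Analysis"
begin

record 'a mm_space =
  mm_measure :: "'a measure"
  mm_dist :: "'a \<Rightarrow> 'a \<Rightarrow> real"

text \<open>The ground set of a space is the carrier of its measure.\<close>

abbreviation ground :: "'a mm_space \<Rightarrow> 'a set" where
  "ground X \<equiv> space (mm_measure X)"

definition interval_space :: "real \<Rightarrow> real mm_space" where
  "interval_space \<delta> =
     \<lparr>mm_measure = lebesgue_on {0..1},
      mm_dist = (\<lambda>x y. 1 / \<delta> * \<bar>x - y\<bar>)\<rparr>"

definition circle_space :: "real \<Rightarrow> real mm_space" where
  "circle_space \<delta> =
     \<lparr>mm_measure = lebesgue_on {0..<1},
      mm_dist = (\<lambda>x y. 1 / \<delta> * min \<bar>x - y\<bar> (1 - \<bar>x - y\<bar>))\<rparr>"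

text \<open>
  The product measure is taken in completed form, so that the measurable sets of a product of
  intervals and circles are exactly the Lebesgue measurable ones. The index set is meant to be
  finite and nonempty (otherwise the maximum is unspecified).
\<close>

definition strong_product :: "'i set \<Rightarrow> ('i \<Rightarrow> 'a mm_space) \<Rightarrow> ('i \<Rightarrow> 'a) mm_space" where
  "strong_product I X =
     \<lparr>mm_measure = completion (\<Pi>\<^sub>M i\<in>I. mm_measure (X i)),
      mm_dist = (\<lambda>x y. MAX i\<in>I. mm_dist (X i) (x i) (y i))\<rparr>"

definition nbhd :: "'a mm_space \<Rightarrow> 'a set \<Rightarrow> 'a set" where
  "nbhd X A = {w \<in> ground X. \<exists>a\<in>A. mm_dist X w a < 1}"

text \<open>
  In the products considered here every neighbourhood is open, hence measurable, and the total
  mass is 1, so the real-valued measure loses nothing.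
\<close>

definition iso_min :: "'a mm_space \<Rightarrow> real \<Rightarrow> real" where
  "iso_min X \<alpha> =
     Inf {measure (mm_measure X) (nbhd X A) | A.
            A \<in> sets (mm_measure X) \<and> measure (mm_measure X) A \<ge> \<alpha>}"

definition Iso_sets :: "'a mm_space \<Rightarrow> real \<Rightarrow> 'a set set" where
  "Iso_sets X \<alpha> =
     {A \<in> sets (mm_measure X). measure (mm_measure X) A \<ge> \<alpha> \<and>
        measure (mm_measure X) (nbhd X A) = iso_min X \<alpha>}"

definition cuboid :: "nat \<Rightarrow> (nat \<Rightarrow> real) \<Rightarrow> (nat \<Rightarrow> real) set" where
  "cuboid n x = (\<Pi>\<^sub>E i\<in>{1..n}. {0..x i})"

definition anti_cuboid :: "nat \<Rightarrow> (nat \<Rightarrow> real) \<Rightarrow> (nat \<Rightarrow> real) set" where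
  "anti_cuboid n x = (\<Union>i\<in>{1..n}. {a \<in> (\<Pi>\<^sub>E j\<in>{1..n}. {0..1}). a i < x i})"

text \<open>
  \<open>c_hat \<delta> t\<close> and \<open>a_hat \<delta> t\<close> depend only on \<open>\<delta> 1, \<dots>, \<delta> t\<close>.
\<close>

definition c_hat :: "(nat \<Rightarrow> real) \<Rightarrow> nat \<Rightarrow> real \<Rightarrow> ereal" where
  "c_hat \<delta> t x =
     (if t = 0 then 1
      else if 0 \<le> x \<and> x \<le> (\<Prod>i=1..t. (\<delta> i / \<delta> t))
      then ereal ((root t x + root t (\<Prod>i=1..t. \<delta> i)) ^ t)
      else \<infinity>)"

definition a_hat :: "(nat \<Rightarrow> real) \<Rightarrow> nat \<Rightarrow> real \<Rightarrow> ereal" where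
  "a_hat \<delta> t x =
     (if t = 0 then 1
      else if 0 \<le> x \<and> x \<le> 1 - (\<Prod>i=1..t. \<delta> i)
      then ereal (1 - (root t (1 - x) - root t (\<Prod>i=1..t. \<delta> i)) ^ t)
      else \<infinity>)"

end

theory Submission
  imports Defs "HOL-Probability.Probability_Measure"
begin

text \<open>
  Why the theorem holds. In one coordinate, thickening a nonempty set increases its measure by at
  least \<open>\<delta> i\<close>, or raises it to \<open>1\<close>; this expansion is the property of intervals and circles
  behind the lower bound. The product is treated by induction on the number of coordinates. Slice a set \<open>A\<close>
  along coordinate \<open>i\<close>, let \<open>f z\<close> be the measure of the slice at \<open>z\<close>, and let \<open>\<phi>\<close> be the isoperimetric
  profile of the other coordinates. The slice at \<open>y\<close> of the neighbourhood of \<open>A\<close> has measure at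
  least \<open>\<phi> (f z)\<close> for every \<open>z\<close> near \<open>y\<close>, and the superlevel sets of \<open>f\<close> are thickened
  by \<open>\<delta> i\<close>. If \<open>\<phi>\<close> is concave, replacing \<open>\<phi>\<close> by the chord between two suitable levels \<open>m < L\<close> of \<open>f\<close> shows
  (\<open>expectation_ge_two_level\<close>) that a set with only two different slice sizes does no worse: it
  costs \<open>(x + \<delta> i) * \<phi> L + (1 - x - \<delta> i) * \<phi> m\<close>, where \<open>x\<close> is the width of the large slices.

  It remains to minimise this expression subject to \<open>x * L + (1 - x) * m = \<alpha>\<close>. For fixed \<open>x\<close> it is
  concave in \<open>(L, m)\<close>, so one of the extremes \<open>m = L\<close>, \<open>m = 0\<close>, \<open>L = 1\<close> is optimal. At
  \<open>m = L\<close> all slices have the same size, and the cost is the profile of the remaining coordinates.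
  The extreme \<open>m = 0\<close> is the product of an initial segment and an optimal set for the remaining
  coordinates, and \<open>L = 1\<close> is the dual construction on complements. If the optimal set is a cuboid in the first case
  or an anti-cuboid in the second, the result is again a cuboid or an anti-cuboid, and an
  arithmetic-geometric mean argument (\<open>radon_power\<close>) compares it with the claimed profile. The
  remaining, mixed case is a segment times an anti-cuboid, or the dual of it.

  A mixed configuration is never the best one. Suppose that the minimum of all extreme
  configurations lies below the profile; it is attained, because finitely many continuous functions
  on compact intervals are involved, and only a mixed configuration can attain it. Slice this
  configuration along a coordinate that belongs to its \<^emph>\<open>other\<close> part. There it has two levels
  \<open>0 < m < L < 1\<close>, so it lies strictly between the endpoints of a segment of constant measure, on which
  the cost is concave. One endpoint is \<open>m = L = \<alpha>\<close>, whose cost is at least the profile and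
  hence strictly above the minimum, the other endpoint is an extreme configuration and not
  below the minimum; so the mixed configuration is strictly above the minimum, a
  contradiction (\<open>mixed_cuboid_end\<close>, \<open>mixed_anti_end\<close>).

  Conversely the profile is attained: if a side \<open>s * \<delta> j\<close> of the optimal box does not fit into the unit
  interval, dropping the coordinate \<open>j\<close> does not increase the value (\<open>cuboid_val_drop\<close>, \<open>anti_val_drop\<close>), so some
  minimiser is realised by an actual cuboid or anti-cuboid.
\<close>

section \<open>A power inequality\<close>

text \<open>
  Radon's inequality for the two fractions with numerators \<open>1\<close>, \<open>\<sigma>\<close> and denominators \<open>1\<close>, \<open>s\<close>, an
  instance of the convexity of \<open>x \<mapsto> x ^ Suc k\<close>. It serves three times: as the tangent at \<open>s\<close> that makes the
  cuboid and anti-cuboid values concave, and as the arithmetic-geometric mean inequality for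
  adjoining a coordinate to a cuboid or to an anti-cuboid.
\<close>

lemma radon_power:
  fixes s \<sigma> :: real
  assumes "0 < s" "0 \<le> \<sigma>"
  shows "(1 + \<sigma>) ^ Suc k \<le> (1 + s) ^ k * (1 + \<sigma> ^ Suc k / s ^ k)"
proof -
  have cvx: "convex_on {0..} (\<lambda>x::real. x ^ Suc k)"
  proof (cases "even (Suc k)")
    case True
    then show ?thesis using convex_power_even convex_on_subset by blast
  next
    case False
    then show ?thesis using convex_power_odd by blast
  qed
  \<comment> \<open>\<open>(1 + \<sigma>) / (1 + s)\<close> is the mean of \<open>1\<close> and \<open>\<sigma> / s\<close> with weights \<open>1 - l\<close> and \<open>l\<close>.\<close>
  define l where "l = s / (1 + s)"
  have l: "0 \<le> l" "l \<le> 1" using assms by (auto simp: l_def field_simps)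
  have "((1 - l) *\<^sub>R 1 + l *\<^sub>R (\<sigma> / s)) ^ Suc k \<le> (1 - l) * 1 ^ Suc k + l * (\<sigma> / s) ^ Suc k"
    by (rule convex_onD[OF cvx]) (use assms l in auto)
  moreover have "(1 - l) *\<^sub>R 1 + l *\<^sub>R (\<sigma> / s) = (1 + \<sigma>) / (1 + s)"
    using assms by (simp add: l_def field_simps)
  moreover have "(1 - l) * 1 ^ Suc k + l * (\<sigma> / s) ^ Suc k = (1 + \<sigma> ^ Suc k / s ^ k) / (1 + s)"
  proof -
    have "1 - l = 1 / (1 + s)" using assms by (simp add: l_def field_simps)
    moreover have "l * (\<sigma> / s) ^ Suc k = (\<sigma> ^ Suc k / s ^ k) / (1 + s)"
      using assms by (simp add: l_def power_divide)
    ultimately show ?thesis by (simp add: add_divide_distrib)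
  qed
  ultimately have "(1 + \<sigma>) ^ Suc k / (1 + s) ^ Suc k \<le> (1 + \<sigma> ^ Suc k / s ^ k) / (1 + s)"
    by (simp only: power_divide)
  then have "(1 + \<sigma>) ^ Suc k \<le> (1 + \<sigma> ^ Suc k / s ^ k) / (1 + s) * (1 + s) ^ Suc k"
    using assms by (simp add: pos_divide_le_eq del: power_Suc)
  also have "\<dots> = (1 + s) ^ k * (1 + \<sigma> ^ Suc k / s ^ k)"
    using assms by simp
  finally show ?thesis .
qed

section \<open>Values of cuboids and anti-cuboids\<close>

text \<open>
  The smallest neighbourhood measure of a cuboid of measure \<open>x\<close> that is restricted in \<open>t\<close> coordinates with
  \<open>P\<close> the product of their \<open>\<delta>\<close>s, as if side lengths above \<open>1\<close> were allowed.
\<close>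

definition cuboid_val :: "nat \<Rightarrow> real \<Rightarrow> real \<Rightarrow> real" where
  "cuboid_val t P x = (root t x + root t P) ^ t"

text \<open>
  The same for anti-cuboids. Truncation at \<open>0\<close> replaces the value \<open>\<infinity>\<close> of \<open>a_hat\<close> by \<open>1\<close>, the measure of the
  whole space, and makes the function concave on all of \<open>[0, 1]\<close>.
\<close>

definition anti_val :: "nat \<Rightarrow> real \<Rightarrow> real \<Rightarrow> real" where
  "anti_val t P x = 1 - (max 0 (root t (1 - x) - root t P)) ^ t"

text \<open>
  The optimal cuboid has sides proportional to the \<open>\<delta>\<close>s, and the common factor \<open>s\<close> is a convenient
  parameter: in terms of it the roots disappear from both values.
\<close>

lemma scale_exists:
  assumes "0 < t" "0 < P" "0 \<le> x"
  obtains s :: real where "0 \<le> s" "x = s ^ t * P"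
proof
  show "0 \<le> root t (x / P)" using assms by (simp add: real_root_ge_zero)
  show "x = root t (x / P) ^ t * P" using assms by simp
qed

lemma scale_pos_exists:
  assumes "0 < t" "0 < P" "0 < x"
  obtains s :: real where "0 < s" "x = s ^ t * P"
proof
  show "0 < root t (x / P)" using assms by (simp add: real_root_gt_zero)
  show "x = root t (x / P) ^ t * P" using assms by simp
qed

lemma cuboid_val_scale:
  assumes "0 < t" "0 \<le> P" "0 \<le> s"
  shows "cuboid_val t P (s ^ t * P) = (1 + s) ^ t * P"
proof -
  have "root t (s ^ t * P) = s * root t P"
    using assms by (simp add: real_root_mult real_root_power_cancel)
  then have "cuboid_val t P (s ^ t * P) = ((1 + s) * root t P) ^ t"
    by (simp add: cuboid_val_def algebra_simps)
  then show ?thesis using assms by (simp add: power_mult_distrib)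
qed

lemma anti_val_scale:
  assumes "0 < t" "0 \<le> P" "0 \<le> s"
  shows "anti_val t P (1 - s ^ t * P) = 1 - max 0 (s - 1) ^ t * P"
proof -
  have "root t (s ^ t * P) = s * root t P"
    using assms by (simp add: real_root_mult real_root_power_cancel)
  then have "max 0 (root t (s ^ t * P) - root t P) = max 0 (s - 1) * root t P"
    using assms by (simp add: max_mult_distrib_right left_diff_distrib real_root_ge_zero)
  then have "anti_val t P (1 - s ^ t * P) = 1 - (max 0 (s - 1) * root t P) ^ t"
    by (simp add: anti_val_def)
  then show ?thesis using assms by (simp add: power_mult_distrib)
qed

lemma cuboid_val_0 [simp]: "cuboid_val 0 P x = 1"
  by (simp add: cuboid_val_def)

lemma cuboid_val_1 [simp]: "cuboid_val (Suc 0) P x = x + P"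
  by (simp add: cuboid_val_def)

lemma anti_val_1 [simp]: "anti_val (Suc 0) P x = min 1 (x + P)"
  by (simp add: anti_val_def min_def max_def)

lemma cuboid_val_nonneg: "0 \<le> x \<Longrightarrow> 0 \<le> P \<Longrightarrow> 0 \<le> cuboid_val t P x"
  by (simp add: cuboid_val_def real_root_ge_zero)

lemma anti_val_le_1: "anti_val t P x \<le> 1"
  by (simp add: anti_val_def)

lemma cuboid_val_mono: "0 \<le> x \<Longrightarrow> x \<le> y \<Longrightarrow> 0 \<le> P \<Longrightarrow> P \<le> Q \<Longrightarrow> cuboid_val t P x \<le> cuboid_val t Q y"
  unfolding cuboid_val_def
  by (cases "t = 0", simp, intro power_mono add_mono add_nonneg_nonneg real_root_ge_zero
      real_root_le_mono) auto

lemma anti_val_mono: "x \<le> y \<Longrightarrow> P \<le> Q \<Longrightarrow> anti_val t P x \<le> anti_val t Q y"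
proof (cases "t = 0")
  case False
  assume "x \<le> y" "P \<le> Q"
  then have "root t (1 - y) \<le> root t (1 - x)" "root t P \<le> root t Q" using False by auto
  then show ?thesis unfolding anti_val_def by (intro diff_left_mono power_mono) auto
qed (simp add: anti_val_def)

lemma anti_val_nonneg:
  assumes "0 < t" "0 \<le> x" "0 \<le> P" shows "0 \<le> anti_val t P x"
proof -
  have "0 \<le> root t P" using assms by (simp add: real_root_ge_zero)
  then have "max 0 (root t (1 - x) - root t P) \<le> max 0 (root t (1 - x))"
    by (intro max.mono) auto
  also have "\<dots> \<le> 1" using real_root_le_mono[of t "1 - x" 1] assms by simp
  finally show ?thesis unfolding anti_val_def by (simp add: power_le_one)
qed

lemma cuboid_val_tangent:
  assumes "0 < s" "0 < P" "0 \<le> x"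
  shows "cuboid_val (Suc k) P x \<le> (1 + s) ^ k * (P + x / s ^ k)"
proof -
  obtain r where r: "0 \<le> r" "x = r ^ Suc k * P"
    using scale_exists[of "Suc k" P x] assms by auto
  have "cuboid_val (Suc k) P x = (1 + r) ^ Suc k * P"
    using r assms cuboid_val_scale[of "Suc k" P r] by (simp del: power_Suc)
  also have "\<dots> \<le> ((1 + s) ^ k * (1 + r ^ Suc k / s ^ k)) * P"
    using radon_power[of s r k] assms r by (intro mult_right_mono) auto
  also have "\<dots> = (1 + s) ^ k * (P + x / s ^ k)"
    using r by (simp add: algebra_simps)
  finally show ?thesis .
qed

lemma concave_on_cuboid_val:
  assumes "0 < P" shows "concave_on {0..1} (cuboid_val t P)"
proof (cases t)
  case 0
  then have "cuboid_val t P = (\<lambda>x. 1)" by (simp add: fun_eq_iff)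
  then show ?thesis by (simp only: concave_on_const convex_real_interval)
next
  case (Suc k)
  show ?thesis
  proof (rule concave_on_linorderI)
    fix l x y :: real
    assume l: "0 < l" "l < 1" and xy: "x \<in> {0..1}" "y \<in> {0..1}" "x < y"
    define z where "z = (1 - l) * x + l * y"
    have z: "0 < z" unfolding z_def using l xy
      by (smt (verit) atLeastAtMost_iff mult_nonneg_nonneg mult_pos_pos)
    obtain s where s: "0 \<le> s" "z = s ^ Suc k * P"
      using scale_exists[of "Suc k" P z] assms z by auto
    have s0: "0 < s" using s z by (cases "s = 0") auto
    let ?f = "\<lambda>x. (1 + s) ^ k * (P + x / s ^ k)"
    have "(1 - l) * cuboid_val t P x + l * cuboid_val t P y \<le> (1 - l) * ?f x + l * ?f y"
      unfolding Suc using cuboid_val_tangent[OF s0 assms, of x k] cuboid_val_tangent[OF s0 assms, of y k] l xy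
      by (intro add_mono mult_left_mono) auto
    also have "\<dots> = ?f z" using s0 by (simp add: z_def field_simps)
    also have "\<dots> = cuboid_val t P z"
      using cuboid_val_scale[of "Suc k" P s] s assms s0 by (simp add: Suc field_simps)
    finally show "(1 - l) * cuboid_val t P x + l * cuboid_val t P y \<le> cuboid_val t P ((1 - l) *\<^sub>R x + l *\<^sub>R y)"
      by (simp add: z_def)
  qed simp
qed

lemma anti_val_tangent:
  assumes "1 < s" "0 < P" "x \<le> 1"
  shows "anti_val (Suc k) P x \<le> 1 - ((1 - x) / s ^ k - P) * (s - 1) ^ k"
proof -
  obtain r where r: "0 \<le> r" "1 - x = r ^ Suc k * P"
    using scale_exists[of "Suc k" P "1 - x"] assms by auto
  have eq: "anti_val (Suc k) P x = 1 - max 0 (r - 1) ^ Suc k * P"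
    using r assms anti_val_scale[of "Suc k" P r] by (simp del: power_Suc flip: r(2))
  have "(r ^ Suc k / s ^ k - 1) * (s - 1) ^ k \<le> max 0 (r - 1) ^ Suc k"
  proof (cases "r \<le> 1")
    case True
    have "r ^ Suc k \<le> 1" using True r by (intro power_le_one) auto
    also have "1 \<le> s ^ k" using assms by (intro one_le_power) auto
    finally have "r ^ Suc k / s ^ k \<le> 1" using assms by (simp add: divide_le_eq_1)
    then have "(r ^ Suc k / s ^ k - 1) * (s - 1) ^ k \<le> 0"
      using assms by (intro mult_nonpos_nonneg) auto
    then show ?thesis by (smt (verit) max.cobounded1 zero_le_power)
  next
    case False
    have "r ^ Suc k \<le> s ^ k * (1 + (r - 1) ^ Suc k / (s - 1) ^ k)"
      using radon_power[of "s - 1" "r - 1" k] assms False by (simp del: power_Suc)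
    then have "r ^ Suc k / s ^ k \<le> 1 + (r - 1) ^ Suc k / (s - 1) ^ k"
      using assms by (simp add: pos_divide_le_eq mult.commute del: power_Suc)
    then have "(r ^ Suc k / s ^ k - 1) \<le> (r - 1) ^ Suc k / (s - 1) ^ k" by simp
    then show ?thesis using False assms by (simp add: pos_le_divide_eq del: power_Suc)
  qed
  then have "(r ^ Suc k / s ^ k - 1) * (s - 1) ^ k * P \<le> max 0 (r - 1) ^ Suc k * P"
    using assms by (intro mult_right_mono) auto
  moreover have "((1 - x) / s ^ k - P) * (s - 1) ^ k = (r ^ Suc k / s ^ k - 1) * (s - 1) ^ k * P"
    unfolding r(2) by (simp add: left_diff_distrib)
  ultimately have "((1 - x) / s ^ k - P) * (s - 1) ^ k \<le> max 0 (r - 1) ^ Suc k * P"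
    by linarith
  then show ?thesis using eq by simp
qed

lemma concave_on_anti_val:
  assumes "0 < P" "0 < t" shows "concave_on {0..1} (anti_val t P)"
proof -
  obtain k where Suc: "t = Suc k" using assms(2) gr0_conv_Suc by blast
  show ?thesis
  proof (rule concave_on_linorderI)
    fix l x y :: real
    assume l: "0 < l" "l < 1" and xy: "x \<in> {0..1}" "y \<in> {0..1}" "x < y"
    define z where "z = (1 - l) * x + l * y"
    have z: "z \<le> 1" unfolding z_def using l xy
      by (intro convex_bound_le) auto
    obtain s where s: "0 \<le> s" "1 - z = s ^ Suc k * P"
      using scale_exists[of "Suc k" P "1 - z"] assms z by auto
    have zs: "anti_val t P z = 1 - max 0 (s - 1) ^ Suc k * P"
      using s assms anti_val_scale[of "Suc k" P s] by (simp del: power_Suc add: Suc flip: s(2))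
    have "(1 - l) * anti_val t P x + l * anti_val t P y \<le> anti_val t P z"
    proof (cases "1 < s")
      case False
      have "(1 - l) * anti_val t P x + l * anti_val t P y \<le> 1"
        using l by (intro convex_bound_le) (auto simp: anti_val_le_1)
      then show ?thesis using False zs by (simp add: max_def)
    next
      case True
      let ?f = "\<lambda>x. 1 - ((1 - x) / s ^ k - P) * (s - 1) ^ k"
      have "(1 - l) * anti_val t P x + l * anti_val t P y \<le> (1 - l) * ?f x + l * ?f y"
        unfolding Suc using anti_val_tangent[OF True assms(1), of x k] anti_val_tangent[OF True assms(1), of y k] l xy
        by (intro add_mono mult_left_mono) auto
      also have "\<dots> = ?f z" using True by (simp add: z_def field_simps)
      also have "\<dots> = anti_val t P z" unfolding zs s(2) using True
        by (simp add: field_simps)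
      finally show ?thesis .
    qed
    then show "(1 - l) * anti_val t P x + l * anti_val t P y \<le> anti_val t P ((1 - l) *\<^sub>R x + l *\<^sub>R y)"
      by (simp add: z_def)
  qed simp
qed

text \<open>
  Both sides are neighbourhood measures: the right one of a segment of length \<open>p\<close> times an optimal cuboid, the left one of
  the optimal cuboid of the same measure in all \<open>k + 1\<close> coordinates. With no coordinate the
  product \<open>P\<close> is empty, which is the reason for the last assumption.
\<close>

lemma cuboid_val_combine:
  assumes "0 < d" "0 < P" "0 \<le> p" "0 \<le> y" "y \<le> 1" "k = 0 \<Longrightarrow> P = 1"
  shows "cuboid_val (Suc k) (d * P) (p * y) \<le> (p + d) * cuboid_val k P y"
proof (cases k)
  case 0
  then show ?thesis using assms mult_left_le[of y p] by auto
next
  case (Suc l)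
  obtain s where s: "0 \<le> s" "y = s ^ k * P"
    using scale_exists[of k P y] assms Suc by auto
  have cy: "cuboid_val k P y = (1 + s) ^ k * P" using cuboid_val_scale[of k P s] s assms Suc by simp
  show ?thesis
  proof (cases "s = 0")
    case True
    then have "y = 0" "cuboid_val k P y = P" using s Suc cy by auto
    moreover have "cuboid_val (Suc k) (d * P) 0 = d * P"
      using cuboid_val_scale[of "Suc k" "d * P" 0] assms by simp
    ultimately show ?thesis using assms by (simp add: algebra_simps)
  next
    case False
    \<comment> \<open>\<open>r\<close> is the geometric mean of the scale \<open>p / d\<close> of the segment and of \<open>k\<close> copies of the scale \<open>s\<close>.\<close>
    obtain r where r: "0 \<le> r" "p / d * s ^ k = r ^ Suc k * 1"
      using scale_exists[of "Suc k" 1 "p / d * s ^ k"] assms s by auto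
    have "p * y = r ^ Suc k * (d * P)" using s(2) r(2) assms by (simp add: field_simps)
    then have "cuboid_val (Suc k) (d * P) (p * y) = (1 + r) ^ Suc k * (d * P)"
      using cuboid_val_scale[of "Suc k" "d * P" r] assms r by simp
    also have "\<dots> \<le> ((1 + s) ^ k * (1 + r ^ Suc k / s ^ k)) * (d * P)"
      using radon_power[of s r k] assms r s False by (intro mult_right_mono) auto
    also have "r ^ Suc k / s ^ k = p / d" using r(2) False by (simp add: field_simps)
    also have "((1 + s) ^ k * (1 + p / d)) * (d * P) = (p + d) * cuboid_val k P y"
      unfolding cy using assms by (simp add: field_simps)
    finally show ?thesis .
  qed
qed

text \<open>
  Passing to complements turns anti-cuboids into cuboids that shrink, so here \<open>q\<close> is the length of the
  complementary segment.
\<close>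

lemma anti_val_combine:
  assumes "0 < d" "0 < P" "0 \<le> q" "m \<le> 1" "0 < k"
  shows "anti_val (Suc k) (d * P) (1 - q * (1 - m)) \<le> 1 - (q - d) * (1 - anti_val k P m)"
proof -
  obtain s where s: "0 \<le> s" "1 - m = s ^ k * P"
    using scale_exists[of k P "1 - m"] assms by auto
  have cy: "anti_val k P m = 1 - max 0 (s - 1) ^ k * P"
    using anti_val_scale[of k P s] s(1) assms by (simp flip: s(2))
  show ?thesis
  proof (cases "1 < s \<and> d \<le> q")
    case False
    then have "(q - d) * (1 - anti_val k P m) \<le> 0"
    proof (cases "d \<le> q")
      case True
      with False have "max 0 (s - 1) = 0" by simp
      then have "1 - anti_val k P m = 0" using \<open>0 < k\<close> by (simp add: cy)
      then show ?thesis by simp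
    qed (use anti_val_le_1[of k P m] in \<open>auto simp: mult_le_0_iff\<close>)
    then show ?thesis using anti_val_le_1[of "Suc k" "d*P" "1 - q * (1 - m)"] by linarith
  next
    case True
    obtain r where r: "0 \<le> r" "q / d * s ^ k = r ^ Suc k * 1"
      using scale_exists[of "Suc k" 1 "q / d * s ^ k"] assms s by auto
    have "1 \<le> q / d * s ^ k"
      using True assms by (intro mult_ge1_I one_le_power) auto
    then have "1 \<le> r ^ Suc k" using r(2) by (simp del: power_Suc)
    then have r1: "1 \<le> r" using power_less_one_iff[of r "Suc k"] r(1) by (meson not_less zero_less_Suc)
    have "q * (1 - m) = q / d * s ^ k * (d * P)" using s(2) assms by simp
    also have "\<dots> = r ^ Suc k * (d * P)" using r(2) by simp
    finally have qm: "q * (1 - m) = r ^ Suc k * (d * P)" .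
    then have eq: "anti_val (Suc k) (d * P) (1 - q * (1 - m)) = 1 - (r - 1) ^ Suc k * (d * P)"
      unfolding qm using anti_val_scale[of "Suc k" "d * P" r] assms r1 by (simp del: power_Suc)
    have "r ^ Suc k \<le> s ^ k * (1 + (r - 1) ^ Suc k / (s - 1) ^ k)"
      using radon_power[of "s - 1" "r - 1" k] True r1 by (simp del: power_Suc)
    then have "r ^ Suc k / s ^ k \<le> 1 + (r - 1) ^ Suc k / (s - 1) ^ k"
      using True by (simp add: pos_divide_le_eq mult.commute del: power_Suc)
    moreover have "r ^ Suc k / s ^ k = q / d"
    proof -
      have "r ^ Suc k / s ^ k = q / d * s ^ k / s ^ k" using r(2) by simp
      then show ?thesis using True by simp
    qed
    ultimately have "(q / d - 1) * (s - 1) ^ k \<le> (r - 1) ^ Suc k"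
      using True by (simp add: pos_le_divide_eq[symmetric] del: power_Suc)
    then have "(q / d - 1) * (s - 1) ^ k * (d * P) \<le> (r - 1) ^ Suc k * (d * P)"
      using assms by (intro mult_right_mono) auto
    moreover have "(q - d) * (1 - anti_val k P m) = (q / d - 1) * (s - 1) ^ k * (d * P)"
    proof -
      have "max 0 (s - 1) = s - 1" using True by simp
      moreover have "q - d = d * (q / d - 1)" using assms by (simp add: field_simps)
      ultimately show ?thesis by (simp add: cy mult_ac)
    qed
    ultimately show ?thesis unfolding eq by linarith
  qed
qed

text \<open>
  If the side \<open>s * d\<close> does not fit into the unit interval, the remaining sides must be
  enlarged to a factor \<open>r\<close> when this coordinate is dropped and the measure is kept.
\<close>

lemma scale_drop_exists:
  fixes s d :: real
  assumes "0 < d" "0 < s" "1 \<le> s * d" "0 < k"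
  obtains r where "s \<le> r" "s ^ Suc k * d = r ^ k"
proof -
  obtain r where r: "0 \<le> r" "s ^ Suc k * d = r ^ k * 1"
    using scale_exists[of k 1 "s ^ Suc k * d"] assms by auto
  have "s ^ k * 1 \<le> s ^ k * (s * d)" using assms by (intro mult_left_mono) auto
  then have "s ^ k \<le> r ^ k" using r by (simp add: algebra_simps)
  then have "s \<le> r" using r assms power_less_imp_less_base[of r k s] power_strict_mono[of r s k]
    by (meson linorder_not_le)
  then show ?thesis using r that by simp
qed

text \<open>
  The neighbourhood measure divided by the measure is \<open>(1 + 1 / s) ^ Suc k\<close> before and
  \<open>(1 + 1 / r) ^ k\<close> after dropping the coordinate, and \<open>s \<le> r\<close>.
\<close>

lemma cuboid_val_drop:
  assumes "0 < d" "0 < P" "1 \<le> s * d" "0 < s" "k = 0 \<Longrightarrow> P = 1"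
  shows "cuboid_val k P (s ^ Suc k * (d * P)) \<le> cuboid_val (Suc k) (d * P) (s ^ Suc k * (d * P))"
proof (cases "k = 0")
  case True
  then show ?thesis using assms by simp
next
  case False
  then obtain r where r: "s \<le> r" "s ^ Suc k * d = r ^ k"
    using scale_drop_exists[of d s k] assms by auto
  have r0: "0 \<le> r" using r assms by linarith
  have eqx: "s ^ Suc k * (d * P) = r ^ k * P" using r(2) by (metis mult.assoc)
  then have lhs: "cuboid_val k P (s ^ Suc k * (d * P)) = (1 + r) ^ k * P"
    unfolding eqx using cuboid_val_scale[of k P r] False assms r0 by (simp del: power_Suc)
  have rhs: "cuboid_val (Suc k) (d * P) (s ^ Suc k * (d * P)) = (1 + s) ^ Suc k * (d * P)"
    using cuboid_val_scale[of "Suc k" "d * P" s] assms by simp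
  have "((1 + r) * s) ^ k \<le> ((1 + s) * r) ^ k"
    using r r0 assms by (intro power_mono) (auto simp: algebra_simps)
  also have "\<dots> = (1 + s) ^ k * (s * d) * s ^ k"
    by (simp add: power_mult_distrib mult_ac flip: r(2))
  finally have "(1 + r) ^ k * s ^ k \<le> (1 + s) ^ k * (s * d) * s ^ k" by (simp only: power_mult_distrib)
  then have "(1 + r) ^ k \<le> (1 + s) ^ k * (s * d)"
    using \<open>0 < s\<close> mult_le_cancel_right_pos zero_less_power by blast
  also have "\<dots> \<le> (1 + s) ^ k * ((1 + s) * d)" using assms by (intro mult_left_mono) auto
  finally have "(1 + r) ^ k * P \<le> (1 + s) ^ k * ((1 + s) * d) * P"
    using assms(2) by (intro mult_right_mono) auto
  then show ?thesis unfolding lhs rhs by (simp add: algebra_simps)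
qed

lemma anti_val_drop:
  assumes "0 < d" "0 < P" "1 \<le> s * d" "0 < s" "0 < k"
  shows "anti_val k P (1 - s ^ Suc k * (d * P)) \<le> anti_val (Suc k) (d * P) (1 - s ^ Suc k * (d * P))"
proof -
  have rhs: "anti_val (Suc k) (d * P) (1 - s ^ Suc k * (d * P)) = 1 - max 0 (s - 1) ^ Suc k * (d * P)"
    using anti_val_scale[of "Suc k" "d * P" s] assms by simp
  show ?thesis
  proof (cases "1 < s")
    case False
    then show ?thesis unfolding rhs using anti_val_le_1[of k P] by (simp add: max_def)
  next
    case True
    obtain r where r: "s \<le> r" "s ^ Suc k * d = r ^ k"
      using scale_drop_exists[of d s k] assms by auto
    have r0: "1 \<le> r" using r True by linarith
    have eqx: "s ^ Suc k * (d * P) = r ^ k * P" using r(2) by (metis mult.assoc)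
    then have lhs: "anti_val k P (1 - s ^ Suc k * (d * P)) = 1 - (r - 1) ^ k * P"
      unfolding eqx using anti_val_scale[of k P r] assms r0 by (simp del: power_Suc)
    have "(s - 1) ^ k * (s * d) * s ^ k = ((s - 1) * r) ^ k"
      by (simp add: power_mult_distrib mult_ac flip: r(2))
    also have "\<dots> \<le> ((r - 1) * s) ^ k"
      using r r0 True by (intro power_mono) (auto simp: algebra_simps)
    finally have "(s - 1) ^ k * (s * d) * s ^ k \<le> (r - 1) ^ k * s ^ k"
      by (simp only: power_mult_distrib)
    then have "(s - 1) ^ k * (s * d) \<le> (r - 1) ^ k"
      using \<open>0 < s\<close> mult_le_cancel_right_pos zero_less_power by blast
    moreover have "(s - 1) ^ k * ((s - 1) * d) \<le> (s - 1) ^ k * (s * d)"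
      using True assms by (intro mult_left_mono) auto
    ultimately have "(s - 1) ^ k * ((s - 1) * d) * P \<le> (r - 1) ^ k * P"
      using assms by (intro mult_right_mono) auto
    then show ?thesis unfolding lhs rhs using True by (simp add: algebra_simps)
  qed
qed

section \<open>The isoperimetric profile\<close>

locale side_lengths =
  fixes \<delta> :: "nat \<Rightarrow> real"
  assumes side_pos: "\<And>i. 0 < \<delta> i" and side_le_1: "\<And>i. \<delta> i \<le> 1"
begin

text \<open>
  All sets of coordinates compete, not only the initial ones, so that the profile makes sense without any
  order on the \<open>\<delta>\<close>s and can be used for every subset of the coordinates. The value \<open>0\<close> at \<open>0\<close> is a
  downward jump, which keeps the function concave on \<open>[0, 1]\<close> and makes \<open>m = 0\<close> an honest endpoint.
\<close>

definition profile :: "nat set \<Rightarrow> real \<Rightarrow> real" where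
  "profile J x = (if x \<le> 0 then 0
     else Min ((\<lambda>T. cuboid_val (card T) (prod \<delta> T) x) ` Pow J \<union>
               (\<lambda>T. anti_val (card T) (prod \<delta> T) x) ` (Pow J - {{}})))"

lemma prod_pos: "0 < prod \<delta> T"
  by (simp add: prod_pos side_pos)

lemma prod_remove: "finite T \<Longrightarrow> j \<in> T \<Longrightarrow> prod \<delta> T = \<delta> j * prod \<delta> (T - {j})"
  by (rule prod.remove)

lemma profile_le_cuboid_val:
  assumes "finite J" "T \<subseteq> J" "0 \<le> x"
  shows "profile J x \<le> cuboid_val (card T) (prod \<delta> T) x"
proof (cases "x = 0")
  case True
  then show ?thesis using prod_pos[of T] by (auto simp: profile_def intro!: cuboid_val_nonneg)
next
  case False
  then show ?thesis using assms by (auto simp: profile_def intro!: Min_le)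
qed

lemma profile_le_anti_val:
  assumes "finite J" "T \<subseteq> J" "T \<noteq> {}" "0 \<le> x"
  shows "profile J x \<le> anti_val (card T) (prod \<delta> T) x"
proof (cases "x = 0")
  case True
  have "0 < card T" using assms finite_subset card_gt_0_iff by blast
  then have "0 \<le> anti_val (card T) (prod \<delta> T) x"
    using assms less_imp_le[OF prod_pos] by (intro anti_val_nonneg) auto
  then show ?thesis using True by (simp add: profile_def)
next
  case False
  then show ?thesis using assms by (auto simp: profile_def intro!: Min_le)
qed

lemma profile_attained:
  assumes "finite J" "0 < x"
  obtains (cuboid_val) T where "T \<subseteq> J" "profile J x = cuboid_val (card T) (prod \<delta> T) x"
    | (anti_val) T where "T \<subseteq> J" "T \<noteq> {}" "profile J x = anti_val (card T) (prod \<delta> T) x"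
proof -
  let ?V = "(\<lambda>T. cuboid_val (card T) (prod \<delta> T) x) ` Pow J \<union>
    (\<lambda>T. anti_val (card T) (prod \<delta> T) x) ` (Pow J - {{}})"
  have "Min ?V \<in> ?V" using assms by (intro Min_in) auto
  then have "profile J x \<in> ?V" using assms by (simp add: profile_def)
  then show ?thesis using that by blast
qed

lemma profile_le_1: "finite J \<Longrightarrow> profile J x \<le> 1"
  using profile_le_cuboid_val[of J "{}" x] by (cases "x \<le> 0") (auto simp: profile_def)

lemma profile_0 [simp]: "x \<le> 0 \<Longrightarrow> profile J x = 0"
  by (simp add: profile_def)

lemma card_pos: "finite J \<Longrightarrow> T \<subseteq> J \<Longrightarrow> T \<noteq> {} \<Longrightarrow> 0 < card T"
  using finite_subset card_gt_0_iff by blast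

lemma profile_nonneg: assumes "finite J" shows "0 \<le> profile J x"
proof (cases "x \<le> 0")
  case False
  then have "0 < x" by simp
  with assms show ?thesis
  proof (cases rule: profile_attained[of J x])
    case (cuboid_val T)
    then show ?thesis using \<open>0 < x\<close> less_imp_le[OF prod_pos] by (simp add: cuboid_val_nonneg)
  next
    case (anti_val T)
    then show ?thesis using \<open>0 < x\<close> less_imp_le[OF prod_pos] card_pos[OF assms]
      by (simp add: anti_val_nonneg)
  qed
qed simp

lemma profile_mono:
  assumes "finite J" "x \<le> y" shows "profile J x \<le> profile J y"
proof (cases "x \<le> 0")
  case True
  then show ?thesis using assms by (simp add: profile_nonneg)
next
  case False
  then have "0 < y" using assms by simp
  with assms(1) show ?thesis
  proof (cases rule: profile_attained[of J y])
    case (cuboid_val T)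
    then show ?thesis
      using profile_le_cuboid_val[of J T x] cuboid_val_mono[of x y "prod \<delta> T" "prod \<delta> T" "card T"] assms False prod_pos[of T]
      by simp
  next
    case (anti_val T)
    then show ?thesis
      using profile_le_anti_val[of J T x] anti_val_mono[of x y "prod \<delta> T" "prod \<delta> T" "card T"] assms False
      by simp
  qed
qed

lemma profile_antimono:
  assumes "finite J" "K \<subseteq> J" shows "profile J x \<le> profile K x"
proof (cases "x \<le> 0")
  case False
  have "finite K" "0 < x" using assms finite_subset False by auto
  then show ?thesis
  proof (cases rule: profile_attained[of K x])
    case (cuboid_val T)
    then show ?thesis using profile_le_cuboid_val[of J T x] assms False by auto
  next
    case (anti_val T)
    then show ?thesis using profile_le_anti_val[of J T x] assms False by auto
  qed
qed simp

lemma profile_1: assumes "finite J" shows "profile J 1 = 1"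
proof -
  have "1 \<le> profile J 1"
    using assms zero_less_one
  proof (cases rule: profile_attained[of J 1])
    case (cuboid_val T)
    have "0 \<le> root (card T) (prod \<delta> T)" by (simp add: real_root_ge_zero less_imp_le[OF prod_pos])
    then show ?thesis using cuboid_val by (cases "card T = 0") (auto simp: cuboid_val_def)
  next
    case (anti_val T)
    have "0 \<le> root (card T) (prod \<delta> T)" by (simp add: real_root_ge_zero less_imp_le[OF prod_pos])
    then have "profile J 1 = 1 - 0 ^ card T" using anti_val(3) by (simp add: anti_val_def)
    moreover have "(0::real) ^ card T = 0" using card_pos[OF assms anti_val(1,2)] by (rule zero_power)
    ultimately show ?thesis by linarith
  qed
  then show ?thesis using profile_le_1[OF assms, of 1] by simp
qed

lemma concave_on_profile:
  assumes "finite J" shows "concave_on {0..1} (profile J)"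
proof (rule concave_on_linorderI)
  fix l x y :: real
  assume l: "0 < l" "l < 1" and xy: "x \<in> {0..1}" "y \<in> {0..1}" "x < y"
  define z where "z = (1 - l) * x + l * y"
  have z: "0 < z" unfolding z_def using l xy
    by (smt (verit) atLeastAtMost_iff mult_nonneg_nonneg mult_pos_pos)
  have key: "(1 - l) * profile J x + l * profile J y \<le> profile J z"
    if f: "concave_on {0..1} f" "\<And>x. x \<in> {0..1} \<Longrightarrow> profile J x \<le> f x" "profile J z = f z" for f
  proof -
    have "(1 - l) * profile J x + l * profile J y \<le> (1 - l) * f x + l * f y"
      using f(2) l xy by (intro add_mono mult_left_mono) auto
    also have "\<dots> \<le> f ((1 - l) *\<^sub>R x + l *\<^sub>R y)"
      using concave_onD[OF f(1), of l x y] l xy by simp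
    finally show ?thesis using f(3) by (simp add: z_def)
  qed
  from assms z have "(1 - l) * profile J x + l * profile J y \<le> profile J z"
  proof (cases rule: profile_attained[of J z])
    case (cuboid_val T)
    then show ?thesis
      using concave_on_cuboid_val[OF prod_pos[of T], of "card T"] profile_le_cuboid_val[OF assms, of T] by (intro key) auto
  next
    case (anti_val T)
    then show ?thesis
      using concave_on_anti_val[OF prod_pos[of T] card_pos[OF assms]] profile_le_anti_val[OF assms, of T]
      by (intro key) auto
  qed
  then show "(1 - l) * profile J x + l * profile J y \<le> profile J ((1 - l) *\<^sub>R x + l *\<^sub>R y)"
    by (simp add: z_def)
qed simp

section \<open>Two-level configurations\<close>

text \<open>
  \<open>V\<close> is a lower bound for all extreme two-level configurations of measure \<open>\<alpha>\<close>: the first line is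
  the case \<open>m = 0\<close> with large slices on a segment of length \<open>p\<close>, the second line the case \<open>L = 1\<close> with small
  slices of measure \<open>m\<close> on a segment of length \<open>(1 - \<alpha>) / (1 - m)\<close>.
\<close>

definition end_bound :: "nat set \<Rightarrow> real \<Rightarrow> real \<Rightarrow> bool" where
  "end_bound J \<alpha> V \<longleftrightarrow> (\<forall>i\<in>J.
     (\<forall>p. \<alpha> \<le> p \<and> p \<le> 1 \<longrightarrow> V \<le> (p + \<delta> i) * profile (J - {i}) (\<alpha> / p)) \<and>
     (\<forall>m. 0 \<le> m \<and> m \<le> \<alpha> \<longrightarrow> V \<le> 1 - ((1 - \<alpha>) / (1 - m) - \<delta> i) * (1 - profile (J - {i}) m)))"

lemma end_boundD1:
  "end_bound J \<alpha> V \<Longrightarrow> i \<in> J \<Longrightarrow> \<alpha> \<le> p \<Longrightarrow> p \<le> 1 \<Longrightarrow>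
    V \<le> (p + \<delta> i) * profile (J - {i}) (\<alpha> / p)"
  unfolding end_bound_def by blast

lemma end_boundD2:
  "end_bound J \<alpha> V \<Longrightarrow> i \<in> J \<Longrightarrow> 0 \<le> m \<Longrightarrow> m \<le> \<alpha> \<Longrightarrow>
    V \<le> 1 - ((1 - \<alpha>) / (1 - m) - \<delta> i) * (1 - profile (J - {i}) m)"
  unfolding end_bound_def by blast

text \<open>
  With \<open>x\<close> fixed, the pairs \<open>(M, m)\<close> of a given mean form a segment starting at the diagonal point \<open>(\<alpha>, \<alpha>)\<close>
  and ending where \<open>m = 0\<close> or \<open>M = 1\<close>, whichever is reached first. The cost is concave on this segment,
  hence at least the interpolation between its two ends. At the diagonal it is a
  profile in fewer coordinates; so in the interior of the segment, where the diagonal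
  has positive weight \<open>\<theta>\<close>, a strict gap below the profile is inherited.
\<close>

lemma two_level:
  assumes fin: "finite J" and j: "j \<in> J" and \<alpha>: "0 < \<alpha>" "\<alpha> < 1"
    and eb: "end_bound J \<alpha> V" and V: "V \<le> profile J \<alpha>"
    and x: "0 < x" "x + \<delta> j \<le> 1" and mM: "0 \<le> m" "m \<le> M" "M \<le> 1"
    and mean: "x * M + (1 - x) * m = \<alpha>"
  shows "V \<le> (x + \<delta> j) * profile (J - {j}) M + (1 - x - \<delta> j) * profile (J - {j}) m" (is "_ \<le> ?F M m")
    and "V < profile J \<alpha> \<Longrightarrow> 0 < m \<Longrightarrow> M < 1 \<Longrightarrow>
      V < (x + \<delta> j) * profile (J - {j}) M + (1 - x - \<delta> j) * profile (J - {j}) m"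
proof -
  let ?\<phi> = "profile (J - {j})"
  have fin': "finite (J - {j})" using fin by simp
  note cv = concave_on_profile[OF fin']
  have x1: "x < 1" using x side_pos[of j] by linarith
  have mid: "V \<le> ?\<phi> \<alpha>" "V < profile J \<alpha> \<Longrightarrow> V < ?\<phi> \<alpha>"
    using V profile_antimono[OF fin, of "J - {j}" \<alpha>] by auto
  have interp: "\<theta> * ?\<phi> \<alpha> + (1 - \<theta>) * ?F M' m' \<le> ?F M m"
    if "0 \<le> \<theta>" "\<theta> \<le> 1" "M = \<theta> * \<alpha> + (1 - \<theta>) * M'" "m = \<theta> * \<alpha> + (1 - \<theta>) * m'"
      "M' \<in> {0..1}" "m' \<in> {0..1}" for \<theta> M' m'
  proof -
    have M: "\<theta> * ?\<phi> \<alpha> + (1 - \<theta>) * ?\<phi> M' \<le> ?\<phi> M"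
      using concave_onD[OF cv, of "1 - \<theta>" \<alpha> M'] that \<alpha> by simp
    have m: "\<theta> * ?\<phi> \<alpha> + (1 - \<theta>) * ?\<phi> m' \<le> ?\<phi> m"
      using concave_onD[OF cv, of "1 - \<theta>" \<alpha> m'] that \<alpha> by simp
    have "\<theta> * ?\<phi> \<alpha> + (1 - \<theta>) * ?F M' m' =
       (x + \<delta> j) * (\<theta> * ?\<phi> \<alpha> + (1 - \<theta>) * ?\<phi> M') + (1 - x - \<delta> j) * (\<theta> * ?\<phi> \<alpha> + (1 - \<theta>) * ?\<phi> m')"
      by (simp add: algebra_simps)
    also have "\<dots> \<le> ?F M m"
      using M m x side_pos[of j] by (intro add_mono mult_left_mono) auto
    finally show ?thesis .
  qed
  have "\<exists>\<theta> E. 0 \<le> \<theta> \<and> \<theta> \<le> 1 \<and> V \<le> E \<and> (0 < m \<longrightarrow> M < 1 \<longrightarrow> 0 < \<theta>) \<and>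
      \<theta> * ?\<phi> \<alpha> + (1 - \<theta>) * E \<le> ?F M m"
  proof (cases "\<alpha> \<le> x")
    case True
    define \<theta> where "\<theta> = m / \<alpha>"
    have "m * x + m * (1 - x) \<le> M * x + m * (1 - x)"
      using mM x by (intro add_right_mono mult_right_mono) auto
    then have "m \<le> \<alpha>" using mean by (simp add: algebra_simps)
    then have \<theta>: "0 \<le> \<theta>" "\<theta> \<le> 1" "0 < m \<Longrightarrow> 0 < \<theta>" using mM \<alpha> by (auto simp: \<theta>_def)
    have \<theta>\<alpha>: "\<theta> * \<alpha> = m" using \<alpha> by (simp add: \<theta>_def)
    have "(1 - \<theta>) * (\<alpha> / x) = (\<alpha> - m) / x" using \<theta>\<alpha> by (simp add: left_diff_distrib)
    then have "x * (\<theta> * \<alpha> + (1 - \<theta>) * (\<alpha> / x)) = x * m + (\<alpha> - m)"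
      using x \<theta>\<alpha> by (simp add: distrib_left)
    also have "\<dots> = x * M" using mean by (simp add: algebra_simps)
    finally have "M = \<theta> * \<alpha> + (1 - \<theta>) * (\<alpha> / x)" using x by simp
    moreover have "m = \<theta> * \<alpha> + (1 - \<theta>) * 0" using \<alpha> by (simp add: \<theta>_def)
    ultimately have "\<theta> * ?\<phi> \<alpha> + (1 - \<theta>) * ?F (\<alpha> / x) 0 \<le> ?F M m"
      by (rule interp[OF \<theta>(1,2)]) (use \<alpha> x True in auto)
    moreover have "V \<le> ?F (\<alpha> / x) 0" using end_boundD1[OF eb j True] x1 by simp
    ultimately show ?thesis using \<theta> by blast
  next
    case False
    define \<theta> where "\<theta> = (1 - M) / (1 - \<alpha>)"
    define m' where "m' = (\<alpha> - x) / (1 - x)"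
    have "x * M + (1 - x) * m \<le> x * M + (1 - x) * M"
      using mM x1 by (intro add_left_mono mult_left_mono) auto
    then have "\<alpha> \<le> M" using mean by (simp add: algebra_simps)
    then have \<theta>: "0 \<le> \<theta>" "\<theta> \<le> 1" "M < 1 \<Longrightarrow> 0 < \<theta>" using mM \<alpha> by (auto simp: \<theta>_def)
    have m': "0 \<le> m'" "m' \<le> \<alpha>" "m' \<le> 1" "(1 - \<alpha>) / (1 - m') = 1 - x"
    proof -
      have "x * \<alpha> \<le> x * 1" using x \<alpha> by (intro mult_left_mono) auto
      then show "m' \<le> \<alpha>" using x1 by (simp add: m'_def pos_divide_le_eq algebra_simps)
      with \<alpha> show "m' \<le> 1" by simp
      show "0 \<le> m'" using False x1 by (simp add: m'_def)
      have "1 - m' = (1 - \<alpha>) / (1 - x)" using x1 by (simp add: m'_def diff_divide_distrib[symmetric] field_simps)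
      then show "(1 - \<alpha>) / (1 - m') = 1 - x" using \<alpha> by simp
    qed
    have "\<theta> * (1 - \<alpha>) = 1 - M" using \<alpha> by (simp add: \<theta>_def)
    then have "\<theta> - \<theta> * \<alpha> = 1 - M" by (simp add: right_diff_distrib)
    then have M: "M = \<theta> * \<alpha> + (1 - \<theta>) * 1" by simp
    have "(1 - x) * m = (1 - x) * (\<theta> * \<alpha>) + (1 - \<theta>) * ((1 - x) * m')"
    proof -
      have m'x: "(1 - x) * m' = \<alpha> - x" using x1 by (simp add: m'_def)
      have "(1 - x) * m = \<alpha> - x * M" using mean by linarith
      also have "\<dots> = \<alpha> - x * (\<theta> * \<alpha> + (1 - \<theta>))" using M by simp
      also have "\<dots> = (1 - x) * (\<theta> * \<alpha>) + (1 - \<theta>) * (\<alpha> - x)" by (simp add: algebra_simps)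
      finally show ?thesis unfolding m'x .
    qed
    then have "(1 - x) * m = (1 - x) * (\<theta> * \<alpha> + (1 - \<theta>) * m')" by (simp add: algebra_simps)
    then have "m = \<theta> * \<alpha> + (1 - \<theta>) * m'" using x1 by simp
    then have "\<theta> * ?\<phi> \<alpha> + (1 - \<theta>) * ?F 1 m' \<le> ?F M m"
      by (rule interp[OF \<theta>(1,2) M]) (use m' in auto)
    moreover have "V \<le> ?F 1 m'"
    proof -
      have "V \<le> 1 - ((1 - \<alpha>) / (1 - m') - \<delta> j) * (1 - ?\<phi> m')"
        using end_boundD2[OF eb j] m' by blast
      then show ?thesis unfolding m'(4) by (simp add: profile_1[OF fin'] algebra_simps)
    qed
    ultimately show ?thesis using \<theta> by blast
  qed
  then obtain \<theta> E where E: "0 \<le> \<theta>" "\<theta> \<le> 1" "V \<le> E" "0 < m \<Longrightarrow> M < 1 \<Longrightarrow> 0 < \<theta>"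
      "\<theta> * ?\<phi> \<alpha> + (1 - \<theta>) * E \<le> ?F M m" by blast
  have "(1 - \<theta>) * V \<le> (1 - \<theta>) * E" using E by (intro mult_left_mono) auto
  moreover have "\<theta> * V \<le> \<theta> * ?\<phi> \<alpha>" using E mid by (intro mult_left_mono) auto
  ultimately show "V \<le> ?F M m" using E by (simp add: algebra_simps)
  assume "V < profile J \<alpha>" "0 < m" "M < 1"
  then have "\<theta> * V < \<theta> * ?\<phi> \<alpha>" using E mid by (intro mult_strict_left_mono) auto
  with \<open>(1 - \<theta>) * V \<le> (1 - \<theta>) * E\<close> show "V < ?F M m" using E by (simp add: algebra_simps)
qed

text \<open>The two unmixed extremes, where the construction stays within cuboids or within anti-cuboids.\<close>

lemma profile_le_cuboid_end:
  assumes fin: "finite J" and i: "i \<in> J" and T: "T \<subseteq> J - {i}" and \<alpha>: "0 < \<alpha>"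
    and p: "\<alpha> \<le> p"
  shows "profile J \<alpha> \<le> (p + \<delta> i) * cuboid_val (card T) (prod \<delta> T) (\<alpha> / p)"
proof -
  have fT: "finite T" using fin T by (meson finite_Diff finite_subset)
  have iT: "i \<notin> T" using T by blast
  have "profile J \<alpha> \<le> cuboid_val (card (insert i T)) (prod \<delta> (insert i T)) \<alpha>"
    using fin i T \<alpha> by (intro profile_le_cuboid_val) auto
  also have "\<dots> = cuboid_val (Suc (card T)) (\<delta> i * prod \<delta> T) (p * (\<alpha> / p))"
    using fT iT \<alpha> p by simp
  also have "\<dots> \<le> (p + \<delta> i) * cuboid_val (card T) (prod \<delta> T) (\<alpha> / p)"
    using \<alpha> p fT by (intro cuboid_val_combine side_pos prod_pos) auto
  finally show ?thesis .
qed

lemma profile_le_anti_end: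
  assumes fin: "finite J" and i: "i \<in> J" and T: "T \<subseteq> J - {i}" "T \<noteq> {}"
    and q: "0 \<le> q" "m \<le> 1" "0 \<le> 1 - q * (1 - m)"
  shows "profile J (1 - q * (1 - m)) \<le> 1 - (q - \<delta> i) * (1 - anti_val (card T) (prod \<delta> T) m)"
proof -
  have fT: "finite T" using fin T by (meson finite_Diff finite_subset)
  have iT: "i \<notin> T" using T by blast
  have "profile J (1 - q * (1 - m)) \<le> anti_val (card (insert i T)) (prod \<delta> (insert i T)) (1 - q * (1 - m))"
    using fin i T q by (intro profile_le_anti_val) auto
  also have "\<dots> = anti_val (Suc (card T)) (\<delta> i * prod \<delta> T) (1 - q * (1 - m))"
    using fT iT by simp
  also have "\<dots> \<le> 1 - (q - \<delta> i) * (1 - anti_val (card T) (prod \<delta> T) m)"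
    using fT T q by (intro anti_val_combine side_pos prod_pos) (auto simp: card_gt_0_iff)
  finally show ?thesis .
qed

lemma profile_le_single:
  assumes "finite J" "i \<in> J" "0 \<le> x" shows "profile J x \<le> x + \<delta> i"
  using profile_le_cuboid_val[of J "{i}" x] assms by simp

lemma scaled_prod_less_1:
  assumes "finite T" "T \<noteq> {}" "0 < s" "\<And>k. k \<in> T \<Longrightarrow> s * \<delta> k < 1"
  shows "s ^ card T * prod \<delta> T < 1"
  using assms
proof (induction T rule: finite_ne_induct)
  case (insert a F)
  have F: "s ^ card F * prod \<delta> F < 1" using insert by auto
  have F0: "0 < s ^ card F * prod \<delta> F" using insert prod_pos by simp
  have "(s * \<delta> a) * (s ^ card F * prod \<delta> F) < 1 * 1"
    using insert.prems(2)[of a] F F0 by (intro mult_strict_mono) auto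
  then show ?case using insert by (simp add: algebra_simps)
qed simp

lemma scaled_prod_ge_1:
  assumes "finite T" "\<And>k. k \<in> T \<Longrightarrow> 1 \<le> s * \<delta> k"
  shows "1 \<le> s ^ card T * prod \<delta> T"
proof -
  have "1 \<le> (\<Prod>k\<in>T. s * \<delta> k)" using assms(2) by (rule prod_ge_1)
  then show ?thesis by (simp add: prod.distrib)
qed

text \<open>
  The mixed configuration is the segment \<open>[0, p]\<close> in coordinate \<open>i\<close> times an anti-cuboid in the coordinates \<open>T\<close>. Along
  a coordinate \<open>j \<in> T\<close> its slices are \<open>[0, p]\<close> times everything, of measure \<open>p\<close>, on a segment
  of length \<open>x\<close>, and \<open>[0, p]\<close> times a smaller anti-cuboid, of measure \<open>p * r\<close>, on the rest. Unless the bound is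
  immediate, both measures lie strictly between \<open>0\<close> and \<open>1\<close>, so \<open>two_level\<close> applies. The induction on \<open>card T\<close> discards the
  coordinates whose side does not fit, and the hypothesis on \<open>J - {j}\<close> bounds the profile of the smaller
  slice.
\<close>

lemma mixed_cuboid_end:
  assumes fin: "finite J" and i: "i \<in> J" and \<alpha>: "0 < \<alpha>" "\<alpha> < 1"
    and eb: "end_bound J \<alpha> V" and V: "V < profile J \<alpha>"
    and IH: "\<And>j \<beta>. j \<in> J \<Longrightarrow> 0 < \<beta> \<Longrightarrow> \<beta> < 1 \<Longrightarrow> end_bound (J - {j}) \<beta> (profile (J - {j}) \<beta>)"
    and p: "\<alpha> \<le> p" "p \<le> 1"
    and T: "T \<subseteq> J - {i}" "T \<noteq> {}"
  shows "V < (p + \<delta> i) * anti_val (card T) (prod \<delta> T) (\<alpha> / p)"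
  using T
proof (induction "card T" arbitrary: T rule: less_induct)
  case (less T)
  note T = less.prems
  have fT: "finite T" using fin T by (meson finite_Diff finite_subset)
  have cT: "0 < card T" using fT T by (simp add: card_gt_0_iff)
  define y where "y = \<alpha> / p"
  have p0: "0 < p" using p \<alpha> by linarith
  have y: "0 < y" "y \<le> 1" "p * y = \<alpha>" "\<alpha> \<le> y" using p p0 \<alpha> by (auto simp: y_def pos_le_divide_eq mult_left_le)
  have A0: "0 \<le> anti_val (card T) (prod \<delta> T) y"
    using cT y less_imp_le[OF prod_pos] by (intro anti_val_nonneg) auto
  have single: "V < p + \<delta> i" using V profile_le_single[OF fin i, of \<alpha>] \<alpha> p by linarith
  have pure: "V < (p + \<delta> i) * cuboid_val (card T) (prod \<delta> T) y"
    using V profile_le_cuboid_end[OF fin i T(1) \<alpha>(1) p(1)] by (simp add: y_def)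
  show ?case unfolding y_def[symmetric]
  proof (cases "1 \<le> p + \<delta> i")
    case True
    have "V < anti_val (card T) (prod \<delta> T) \<alpha>"
      using V profile_le_anti_val[OF fin _ T(2), of \<alpha>] T(1) \<alpha> by fastforce
    also have "\<dots> \<le> anti_val (card T) (prod \<delta> T) y" using y by (intro anti_val_mono) auto
    also have "\<dots> \<le> (p + \<delta> i) * anti_val (card T) (prod \<delta> T) y"
      using mult_right_mono[OF True A0] by simp
    finally show "V < (p + \<delta> i) * anti_val (card T) (prod \<delta> T) y" .
  next
    case False
    obtain s where s: "0 \<le> s" "1 - y = s ^ card T * prod \<delta> T"
      using scale_exists[OF cT prod_pos, of "1 - y" T] y by auto
    have y_eq: "y = 1 - s ^ card T * prod \<delta> T" using s by linarith
    have A: "anti_val (card T) (prod \<delta> T) y = 1 - max 0 (s - 1) ^ card T * prod \<delta> T"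
      unfolding y_eq using s(1) cT less_imp_le[OF prod_pos] by (intro anti_val_scale) auto
    consider (full) "s \<le> 1" | (one) "card T = 1" | (drop) j where "1 < s" "1 < card T" "j \<in> T" "1 \<le> s * \<delta> j"
      | (main) "1 < s" "1 < card T" "\<And>j. j \<in> T \<Longrightarrow> s * \<delta> j < 1"
    proof (cases "s \<le> 1 \<or> card T = 1")
      case True
      then show ?thesis using that by blast
    next
      case False
      then have "1 < s" "1 < card T" using cT by auto
      then show ?thesis using that(3,4) by (meson linorder_not_le)
    qed
    then show "V < (p + \<delta> i) * anti_val (card T) (prod \<delta> T) y"
    proof cases
      case full
      then have "max 0 (s - 1) = 0" by simp
      then have "anti_val (card T) (prod \<delta> T) y = 1" using cT by (simp add: A)
      then show ?thesis using single by simp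
    next
      case one
      then have "anti_val (card T) (prod \<delta> T) y = 1 \<or>
          anti_val (card T) (prod \<delta> T) y = cuboid_val (card T) (prod \<delta> T) y"
        by (auto simp: min_def)
      then show ?thesis using single pure by (metis mult.right_neutral)
    next
      case drop
      define k where "k = card (T - {j})"
      define P where "P = prod \<delta> (T - {j})"
      have T': "card T = Suc k" "prod \<delta> T = \<delta> j * P" "0 < P"
        unfolding k_def P_def by (fact card.remove[OF fT drop(3)] prod_remove[OF fT drop(3)] prod_pos)+
      have k: "0 < k" using drop T' by simp
      have "anti_val k P y \<le> anti_val (card T) (prod \<delta> T) y"
        unfolding y_eq T'(1,2) using drop k T' by (intro anti_val_drop side_pos) auto
      moreover have "T - {j} \<noteq> {}" using k unfolding k_def by (metis card.empty less_irrefl)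
      then have "V < (p + \<delta> i) * anti_val k P y"
        using less.hyps[of "T - {j}"] T T'(1) by (auto simp: k_def P_def y_def)
      moreover have "0 < p + \<delta> i" using p0 side_pos[of i] by linarith
      ultimately show ?thesis
        by (smt (verit) mult_le_cancel_left_pos)
    next
      case main
      obtain j where j: "j \<in> T" using T by blast
      define k where "k = card (T - {j})"
      define P where "P = prod \<delta> (T - {j})"
      have T': "card T = Suc k" "prod \<delta> T = \<delta> j * P" "0 < P"
        unfolding k_def P_def by (fact card.remove[OF fT j(1)] prod_remove[OF fT j(1)] prod_pos)+
      have k: "0 < k" using main T' by simp
      have ne: "T - {j} \<noteq> {}" using k unfolding k_def by (metis card.empty less_irrefl)
      have jJ: "j \<in> J" "i \<in> J - {j}" "T - {j} \<subseteq> J - {j} - {i}" using j T i by auto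
      define x where "x = 1 - s * \<delta> j"
      define r where "r = 1 - s ^ k * P"
      define R where "R = anti_val k P r"
      have x: "0 < x" "x + \<delta> j \<le> 1"
        using main(3)[OF j] mult_right_mono[of 1 s "\<delta> j"] main(1) side_pos[of j] by (auto simp: x_def)
      have r: "0 < r" "r < 1"
        using scaled_prod_less_1[of "T - {j}" s] fT ne main T' by (auto simp: r_def k_def P_def)
      have R: "1 - R = (s - 1) ^ k * P"
        unfolding R_def r_def using anti_val_scale[of k P s] k T' main by simp
      have mean: "x * p + (1 - x) * (p * r) = \<alpha>"
      proof -
        have "x * p + (1 - x) * (p * r) = p * (1 - s ^ card T * prod \<delta> T)"
          unfolding x_def r_def T' by (simp add: algebra_simps)
        then show ?thesis using y y_eq by simp
      qed
      have m: "0 < p * r" "p * r \<le> p" "p * r < 1" "p < 1"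
      proof -
        show "0 < p * r" using p0 r by simp
        have "p * r < p * 1" using p0 r by (intro mult_strict_left_mono) auto
        moreover show "p < 1" using False side_pos[of i] by linarith
        ultimately show "p * r \<le> p" "p * r < 1" by auto
      qed
      have "V < (x + \<delta> j) * profile (J - {j}) p + (1 - x - \<delta> j) * profile (J - {j}) (p * r)"
        by (rule two_level(2)[OF fin jJ(1) \<alpha> eb _ x]) (use m p mean V in auto)
      also have "\<dots> \<le> (x + \<delta> j) * (p + \<delta> i) + (1 - x - \<delta> j) * ((p + \<delta> i) * R)"
      proof (intro add_mono mult_left_mono)
        show "profile (J - {j}) p \<le> p + \<delta> i"
          using fin jJ p0 by (intro profile_le_single) auto
        have "profile (J - {j}) (p * r) \<le> (p + \<delta> i) * profile (J - {j} - {i}) (p * r / p)"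
          using IH[OF jJ(1) m(1,3)] jJ(2) m(2) p(2) by (rule end_boundD1)
        also have "\<dots> \<le> (p + \<delta> i) * R"
          unfolding R_def k_def P_def
          using profile_le_anti_val[of "J - {j} - {i}" "T - {j}" r] fin jJ ne r p0 less_imp_le[OF side_pos[of i]]
          by (intro mult_left_mono) auto
        finally show "profile (J - {j}) (p * r) \<le> (p + \<delta> i) * R" .
      qed (use x side_pos[of j] in auto)
      also have "\<dots> = (p + \<delta> i) * (1 - (1 - x - \<delta> j) * (1 - R))" by (simp add: algebra_simps)
      also have "(1 - x - \<delta> j) * (1 - R) = max 0 (s - 1) ^ card T * prod \<delta> T"
        unfolding R T' x_def using main by (simp add: algebra_simps)
      finally show ?thesis unfolding A .
    qed
  qed
qed

text \<open>
  Dually, the union of the segment \<open>[0, 1 - q]\<close> in coordinate \<open>i\<close> and a cuboid in the coordinates \<open>T\<close>. Along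
  \<open>j \<in> T\<close> the large slices are the union of the segment and a smaller cuboid, of measure
  \<open>M = 1 - q * (1 - r)\<close>, and the small slices are the segment alone. The truncations by \<open>max\<close> and \<open>min\<close> make the
  expression equal to \<open>1\<close> when \<open>q\<close> is below \<open>\<delta> i\<close> or the cuboid value exceeds \<open>1\<close>.
\<close>

lemma mixed_anti_end:
  assumes fin: "finite J" and i: "i \<in> J" and \<alpha>: "0 < \<alpha>" "\<alpha> < 1"
    and eb: "end_bound J \<alpha> V" and V: "V < profile J \<alpha>"
    and IH: "\<And>j \<beta>. j \<in> J \<Longrightarrow> 0 < \<beta> \<Longrightarrow> \<beta> < 1 \<Longrightarrow> end_bound (J - {j}) \<beta> (profile (J - {j}) \<beta>)"
    and m: "0 \<le> m" "m \<le> \<alpha>"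
    and T: "T \<subseteq> J - {i}"
  shows "V < 1 - max 0 ((1 - \<alpha>) / (1 - m) - \<delta> i) * (1 - min 1 (cuboid_val (card T) (prod \<delta> T) m))"
  using T
proof (induction "card T" arbitrary: T rule: less_induct)
  case (less T)
  note T = less.prems
  have fT: "finite T" using fin T by (meson finite_Diff finite_subset)
  define q where "q = (1 - \<alpha>) / (1 - m)"
  define C where "C = cuboid_val (card T) (prod \<delta> T) m"
  have q: "0 < q" "q \<le> 1" "q * (1 - m) = 1 - \<alpha>" using m \<alpha> by (auto simp: q_def)
  have V1: "V < 1" using V profile_le_1[OF fin, of \<alpha>] by linarith
  show ?case unfolding q_def[symmetric] C_def[symmetric]
  proof (cases "q \<le> \<delta> i \<or> 1 \<le> C")
    case True
    then show "V < 1 - max 0 (q - \<delta> i) * (1 - min 1 C)" using V1 by auto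
  next
    case False
    then have qi: "\<delta> i < q" and C1: "C < 1" by auto
    have eq: "1 - max 0 (q - \<delta> i) * (1 - min 1 C) = 1 - (q - \<delta> i) * (1 - C)" using qi C1 by simp
    have cT: "0 < card T" using C1 by (cases "card T = 0") (auto simp: C_def)
    have Tne: "T \<noteq> {}" using cT by auto
    obtain s where s: "0 \<le> s" "m = s ^ card T * prod \<delta> T"
      using scale_exists[OF cT prod_pos, of m T] m by auto
    have C: "C = (1 + s) ^ card T * prod \<delta> T"
      unfolding C_def s(2) using s(1) cT less_imp_le[OF prod_pos] by (intro cuboid_val_scale) auto
    have C0: "0 < C" using C s prod_pos by simp
    consider (zero) "m = 0" | (top) "m = \<alpha>" | (one) "card T = 1"
      | (drop) j where "0 < s" "1 < card T" "j \<in> T" "1 \<le> s * \<delta> j"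
      | (main) "0 < m" "m < \<alpha>" "0 < s" "1 < card T" "\<And>j. j \<in> T \<Longrightarrow> s * \<delta> j < 1"
    proof (cases "m = 0 \<or> m = \<alpha> \<or> card T = 1")
      case True
      then show ?thesis using that by blast
    next
      case False
      have "s \<noteq> 0" using False s cT by auto
      then have "0 < s" "1 < card T" "0 < m" "m < \<alpha>" using s(1) False cT m by auto
      then show ?thesis using that(4,5) by (meson linorder_not_le)
    qed
    then have "V < 1 - (q - \<delta> i) * (1 - C)"
    proof cases
      case zero
      have "V < \<alpha> + \<delta> i" using V profile_le_single[OF fin i, of \<alpha>] \<alpha> by linarith
      moreover have "q = 1 - \<alpha>" using zero by (simp add: q_def)
      moreover have "(q - \<delta> i) * (1 - C) \<le> (q - \<delta> i) * 1"
        using qi C0 by (intro mult_left_mono) auto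
      ultimately have "V < 1 - (q - \<delta> i) * 1" "1 - (q - \<delta> i) * 1 \<le> 1 - (q - \<delta> i) * (1 - C)"
        by auto
      then show ?thesis by (rule less_le_trans)
    next
      case top
      have "V < C" using V profile_le_cuboid_val[OF fin, of T \<alpha>] T \<alpha> top by (fastforce simp: C_def)
      moreover have "q = 1" using top \<alpha> by (simp add: q_def)
      moreover have "(q - \<delta> i) * (1 - C) \<le> 1 * (1 - C)"
        using q side_pos[of i] C1 by (intro mult_right_mono) auto
      ultimately have "V < 1 - 1 * (1 - C)" "1 - 1 * (1 - C) \<le> 1 - (q - \<delta> i) * (1 - C)" by auto
      then show ?thesis by (rule less_le_trans)
    next
      case one
      have "anti_val (card T) (prod \<delta> T) m = C" using one C1 by (auto simp: C_def min_def)
      then have "profile J (1 - q * (1 - m)) \<le> 1 - (q - \<delta> i) * (1 - C)"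
        using profile_le_anti_end[OF fin i T Tne, of q m] q m \<alpha> by simp
      then show ?thesis using V q by simp
    next
      case drop
      define k where "k = card (T - {j})"
      define P where "P = prod \<delta> (T - {j})"
      have T': "card T = Suc k" "prod \<delta> T = \<delta> j * P" "0 < P"
        unfolding k_def P_def by (fact card.remove[OF fT drop(3)] prod_remove[OF fT drop(3)] prod_pos)+
      have k: "0 < k" using drop T' by simp
      have CC: "cuboid_val k P m \<le> C"
        unfolding s(2) C_def T'(1,2) using drop k T' by (intro cuboid_val_drop side_pos) auto
      then have "V < 1 - (q - \<delta> i) * (1 - cuboid_val k P m)"
        using less.hyps[of "T - {j}"] T T'(1) qi C1 by (auto simp: k_def P_def q_def)
      moreover have "(q - \<delta> i) * (1 - C) \<le> (q - \<delta> i) * (1 - cuboid_val k P m)"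
        using qi CC by (intro mult_left_mono) auto
      ultimately show ?thesis by linarith
    next
      case main
      obtain j where j: "j \<in> T" "(1 + s) * \<delta> j < 1"
        using scaled_prod_ge_1[OF fT, of "1 + s"] C C1 by (meson linorder_not_le)
      define k where "k = card (T - {j})"
      define P where "P = prod \<delta> (T - {j})"
      have T': "card T = Suc k" "prod \<delta> T = \<delta> j * P" "0 < P"
        unfolding k_def P_def by (fact card.remove[OF fT j(1)] prod_remove[OF fT j(1)] prod_pos)+
      have k: "0 < k" using main T' by simp
      have ne: "T - {j} \<noteq> {}" using k unfolding k_def by (metis card.empty less_irrefl)
      have jJ: "j \<in> J" "i \<in> J - {j}" "T - {j} \<subseteq> J - {j} - {i}" using j T i by auto
      define x where "x = s * \<delta> j"
      define r where "r = s ^ k * P"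
      define R where "R = cuboid_val k P r"
      have x: "0 < x" "x + \<delta> j \<le> 1"
        using j(2) main side_pos[of j] by (auto simp: x_def algebra_simps)
      have r: "0 < r" "r < 1"
        using scaled_prod_less_1[of "T - {j}" s] fT ne main T' by (auto simp: r_def k_def P_def)
      have R: "R = (1 + s) ^ k * P"
        unfolding R_def r_def using cuboid_val_scale[of k P s] k T' main by simp
      have mr: "m = x * r" unfolding s(2) x_def r_def T' by simp
      define M where "M = 1 - q * (1 - r)"
      have mean: "x * M + (1 - x) * (1 - q) = \<alpha>"
      proof -
        have "x * M + (1 - x) * (1 - q) = 1 - q * (1 - m)" unfolding M_def mr by (simp add: algebra_simps)
        then show ?thesis using q by simp
      qed
      have q1: "q < 1" using main \<alpha> by (simp add: q_def)
      have "q * (1 - r) \<le> 1 * (1 - r)" using q r by (intro mult_right_mono) auto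
      then have rM: "r \<le> M" by (simp add: M_def)
      have M: "0 < M" "M < 1" "1 - q \<le> M" using rM r q by (auto simp: M_def)
      have Mr: "(1 - M) / (1 - r) = q" using r by (simp add: M_def)
      have "V < (x + \<delta> j) * profile (J - {j}) M + (1 - x - \<delta> j) * profile (J - {j}) (1 - q)"
        by (rule two_level(2)[OF fin jJ(1) \<alpha> eb _ x]) (use M q1 mean V in auto)
      also have "\<dots> \<le> (x + \<delta> j) * (1 - (q - \<delta> i) * (1 - R)) + (1 - x - \<delta> j) * (1 - q + \<delta> i)"
      proof (intro add_mono mult_left_mono)
        show "profile (J - {j}) (1 - q) \<le> 1 - q + \<delta> i"
          using fin jJ q1 by (intro profile_le_single) auto
        have "profile (J - {j}) M \<le> 1 - (q - \<delta> i) * (1 - profile (J - {j} - {i}) r)"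
          using end_boundD2[OF IH[OF jJ(1) M(1,2)] jJ(2) less_imp_le[OF r(1)] rM] Mr by simp
        also have "\<dots> \<le> 1 - (q - \<delta> i) * (1 - R)"
          unfolding R_def k_def P_def
          using profile_le_cuboid_val[of "J - {j} - {i}" "T - {j}" r] fin jJ r qi
          by (intro diff_left_mono mult_left_mono) auto
        finally show "profile (J - {j}) M \<le> 1 - (q - \<delta> i) * (1 - R)" .
      qed (use x side_pos[of j] in auto)
      also have "\<dots> = 1 - (q - \<delta> i) * (1 - (x + \<delta> j) * R)" by (simp add: algebra_simps)
      also have "(x + \<delta> j) * R = C" unfolding R C T' x_def by (simp add: algebra_simps)
      finally show ?thesis .
    qed
    then show "V < 1 - max 0 (q - \<delta> i) * (1 - min 1 C)" unfolding eq .
  qed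
qed

text \<open>
  Every extreme configuration is unmixed, and then bounded by the profile directly, or belongs
  to the compact set \<open>K\<close> of mixed values. If the minimum of \<open>K\<close> were below the
  profile, it would be a lower bound for all extreme configurations, contradicting the strict bounds for mixed ones.
\<close>

lemma end_bound_profile_step:
  assumes fin: "finite J" and \<alpha>: "0 < \<alpha>" "\<alpha> < 1"
    and IH: "\<And>j \<beta>. j \<in> J \<Longrightarrow> 0 < \<beta> \<Longrightarrow> \<beta> < 1 \<Longrightarrow> end_bound (J - {j}) \<beta> (profile (J - {j}) \<beta>)"
  shows "end_bound J \<alpha> (profile J \<alpha>)"
proof (cases "J = {}")
  case True
  then show ?thesis by (simp add: end_bound_def)
next
  case False
  define G where "G = (\<lambda>i T p. (p + \<delta> i) * anti_val (card T) (prod \<delta> T) (\<alpha> / p))"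
  define H where "H = (\<lambda>i T m. 1 - max 0 ((1 - \<alpha>) / (1 - m) - \<delta> i) * (1 - min 1 (cuboid_val (card T) (prod \<delta> T) m)))"
  define K where "K = (\<Union>i\<in>J. \<Union>T\<in>Pow (J - {i}) - {{}}. G i T ` {\<alpha>..1}) \<union>
    (\<Union>i\<in>J. \<Union>T\<in>Pow (J - {i}). H i T ` {0..\<alpha>})"
  have "compact K"
    unfolding K_def G_def H_def anti_val_def cuboid_val_def using fin \<alpha>
    by (intro compact_Un compact_UN compact_continuous_image continuous_intros) auto
  moreover have "K \<noteq> {}" using False \<alpha> by (auto simp: K_def)
  ultimately obtain V where V: "V \<in> K" "\<And>v. v \<in> K \<Longrightarrow> V \<le> v"
    using compact_attains_inf by metis
  have bound: "end_bound J \<alpha> W" if W: "W \<le> V" "W \<le> profile J \<alpha>" for W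
    unfolding end_bound_def
  proof (intro ballI conjI allI impI)
    fix i p assume i: "i \<in> J" and "\<alpha> \<le> p \<and> p \<le> 1"
    then have p: "\<alpha> \<le> p" "p \<le> 1" by auto
    have "0 < \<alpha> / p" using p \<alpha> by simp
    with fin have "finite (J - {i})" "0 < \<alpha> / p" by auto
    then show "W \<le> (p + \<delta> i) * profile (J - {i}) (\<alpha> / p)"
    proof (cases rule: profile_attained[of "J - {i}" "\<alpha> / p"])
      case (cuboid_val T)
      then show ?thesis using profile_le_cuboid_end[OF fin i cuboid_val(1) \<alpha>(1) p(1)] W by simp
    next
      case (anti_val T)
      have "G i T p \<in> K" unfolding K_def
        by (rule UnI1, rule UN_I[OF i], rule UN_I[of T]) (use anti_val p in auto)
      then have "V \<le> G i T p" by (rule V(2))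
      then show ?thesis using W(1) anti_val(3) by (simp add: G_def)
    qed
  next
    fix i m assume i: "i \<in> J" and m: "0 \<le> m \<and> m \<le> \<alpha>"
    define q where "q = (1 - \<alpha>) / (1 - m)"
    have q: "0 < q" "q * (1 - m) = 1 - \<alpha>" using m \<alpha> by (auto simp: q_def)
    show "W \<le> 1 - ((1 - \<alpha>) / (1 - m) - \<delta> i) * (1 - profile (J - {i}) m)"
    proof (cases "m = 0")
      case True
      then show ?thesis using profile_le_single[OF fin i, of \<alpha>] \<alpha> W by simp
    next
      case False
      then have "finite (J - {i})" "0 < m" using m fin by auto
      then have "W \<le> 1 - (q - \<delta> i) * (1 - profile (J - {i}) m)"
      proof (cases rule: profile_attained[of "J - {i}" m])
        case (cuboid_val T)
        have "H i T m \<in> K" unfolding K_def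
          by (rule UnI2, rule UN_I[OF i], rule UN_I[of T]) (use cuboid_val m in auto)
        then have "W \<le> H i T m" using V(2) W(1) order_trans by blast
        also have "min 1 (cuboid_val (card T) (prod \<delta> T) m) = profile (J - {i}) m"
          using cuboid_val profile_le_1[of "J - {i}" m] fin by simp
        then have "H i T m = 1 - max 0 (q - \<delta> i) * (1 - profile (J - {i}) m)"
          by (simp add: H_def q_def)
        also have "\<dots> \<le> 1 - (q - \<delta> i) * (1 - profile (J - {i}) m)"
          using profile_le_1[of "J - {i}" m] fin by (intro diff_left_mono mult_right_mono) auto
        finally show ?thesis .
      next
        case (anti_val T)
        then show ?thesis
          using profile_le_anti_end[OF fin i anti_val(1,2), of q m] q \<alpha> m W by simp
      qed
      then show ?thesis by (simp add: q_def)
    qed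
  qed
  have "profile J \<alpha> \<le> V"
  proof (rule ccontr)
    assume "\<not> profile J \<alpha> \<le> V"
    then have less: "V < profile J \<alpha>" by simp
    have eb: "end_bound J \<alpha> V" using bound less by simp
    from V(1) consider (G) i T p where "i \<in> J" "T \<subseteq> J - {i}" "T \<noteq> {}" "p \<in> {\<alpha>..1}" "V = G i T p"
      | (H) i T m where "i \<in> J" "T \<subseteq> J - {i}" "m \<in> {0..\<alpha>}" "V = H i T m"
      unfolding K_def by blast
    then show False
    proof cases
      case G
      then show False using mixed_cuboid_end[OF fin G(1) \<alpha> eb less IH _ _ G(2,3), of p] by (simp add: G_def)
    next
      case H
      then show False using mixed_anti_end[OF fin H(1) \<alpha> eb less IH _ _ H(2), of m] by (simp add: H_def)
    qed
  qed
  then show ?thesis using bound by simp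
qed

lemma end_bound_profile:
  assumes "finite J" "0 < \<alpha>" "\<alpha> < 1"
  shows "end_bound J \<alpha> (profile J \<alpha>)"
  using assms
proof (induction "card J" arbitrary: J \<alpha> rule: less_induct)
  case less
  show ?case
  proof (rule end_bound_profile_step)
    fix j \<beta> assume "j \<in> J" "0 < \<beta>" "\<beta> < (1::real)"
    then show "end_bound (J - {j}) \<beta> (profile (J - {j}) \<beta>)"
      using less.prems(1) card_Diff1_less[of J j] by (intro less.hyps) auto
  qed (use less in auto)
qed

text \<open>
  The outcome of the optimisation. The cases \<open>x = 0\<close> and \<open>M = m\<close> are degenerate: there is only one level, and
  the profile of fewer coordinates is larger.
\<close>

lemma profile_le_two_level:
  assumes "finite J" "j \<in> J" "0 < \<alpha>" "0 \<le> x" "x + \<delta> j \<le> 1" "0 \<le> m" "m \<le> M" "M \<le> 1"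
    and mean: "x * M + (1 - x) * m = \<alpha>"
  shows "profile J \<alpha> \<le> (x + \<delta> j) * profile (J - {j}) M + (1 - x - \<delta> j) * profile (J - {j}) m"
proof -
  have fin: "finite (J - {j})" using assms by simp
  have x1: "x < 1" using assms side_pos[of j] by linarith
  have "x * M + (1 - x) * m \<le> x * M + (1 - x) * M"
    using assms x1 by (intro add_left_mono mult_left_mono) auto
  then have \<alpha>M: "\<alpha> \<le> M" using mean by (simp add: algebra_simps)
  consider "x = 0" | "M = m" | "0 < x" "m < M" using assms by linarith
  then show ?thesis
  proof cases
    case 1
    have "profile J \<alpha> \<le> profile (J - {j}) m" using profile_antimono[of J "J - {j}" \<alpha>] assms 1 by simp
    moreover have "\<delta> j * profile (J - {j}) m \<le> \<delta> j * profile (J - {j}) M"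
      using profile_mono[OF fin \<open>m \<le> M\<close>] less_imp_le[OF side_pos] by (intro mult_left_mono) auto
    ultimately show ?thesis using 1 by (simp add: algebra_simps)
  next
    case 2
    have "\<alpha> = m" using mean 2 by (simp add: algebra_simps)
    then have "profile J \<alpha> \<le> profile (J - {j}) m" using profile_antimono[of J "J - {j}" \<alpha>] assms by simp
    also have "\<dots> = (x + \<delta> j) * profile (J - {j}) M + (1 - x - \<delta> j) * profile (J - {j}) m"
      using 2 by (simp add: algebra_simps)
    finally show ?thesis .
  next
    case 3
    have "(1 - x) * m < (1 - x) * M" using 3 x1 by (intro mult_strict_left_mono) auto
    then have "\<alpha> < M" using mean by (simp add: algebra_simps)
    then have "\<alpha> < 1" using assms by linarith
    then show ?thesis
      using two_level(1)[OF assms(1,2,3) _ end_bound_profile order_refl 3(1) assms(5-8) mean] assms by simp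
  qed
qed

end

section \<open>Functions on one expanding factor\<close>

lemma nn_integral_layer_cake:
  fixes f :: "'a \<Rightarrow> real"
  assumes "sigma_finite_measure M" and [measurable]: "f \<in> borel_measurable M"
  shows "(\<integral>\<^sup>+ x. ennreal (f x) \<partial>M) =
    (\<integral>\<^sup>+ s. indicator {0..} s * emeasure M {x \<in> space M. s < f x} \<partial>lborel)"
proof -
  interpret M: sigma_finite_measure M by fact
  interpret P: pair_sigma_finite lborel M by standard
  have slice: "ennreal (f x) = (\<integral>\<^sup>+ s. indicator {0..} s * indicator {s. s < f x} s \<partial>lborel)" for x
  proof -
    have "(\<integral>\<^sup>+ s. indicator {0..} s * indicator {s. s < f x} s \<partial>lborel) =
        (\<integral>\<^sup>+ s. indicator {0..<f x} s \<partial>lborel)"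
      by (intro nn_integral_cong) (auto simp: indicator_def)
    also have "\<dots> = ennreal (f x)" by (cases "0 \<le> f x") (auto simp: ennreal_neg)
    finally show ?thesis by simp
  qed
  have "(\<integral>\<^sup>+ x. ennreal (f x) \<partial>M) =
      (\<integral>\<^sup>+ x. (\<integral>\<^sup>+ s. indicator {0..} s * indicator {s. s < f x} s \<partial>lborel) \<partial>M)"
    using slice by simp
  also have "\<dots> = (\<integral>\<^sup>+ s. (\<integral>\<^sup>+ x. indicator {0..} s * indicator {s. s < f x} s \<partial>M) \<partial>lborel)"
    by (rule P.Fubini') measurable
  also have "\<dots> = (\<integral>\<^sup>+ s. indicator {0..} s * emeasure M {x \<in> space M. s < f x} \<partial>lborel)"
  proof (rule nn_integral_cong)
    fix s :: real
    have "(\<integral>\<^sup>+ x. indicator {0..} s * indicator {s. s < f x} s \<partial>M) =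
        indicator {0..} s * (\<integral>\<^sup>+ x. indicator {x \<in> space M. s < f x} x \<partial>M)"
      by (subst nn_integral_cmult[symmetric]) (auto intro!: nn_integral_cong simp: indicator_def)
    then show "(\<integral>\<^sup>+ x. indicator {0..} s * indicator {s. s < f x} s \<partial>M) =
        indicator {0..} s * emeasure M {x \<in> space M. s < f x}" by simp
  qed
  finally show ?thesis .
qed

context prob_space
begin

text \<open>
  If every superlevel set of \<open>u\<close> exceeds that of \<open>k\<close> by \<open>d\<close> up to level \<open>K\<close>, then integrating over the levels
  gains the area \<open>d * K\<close>.
\<close>

lemma layer_cake_gap:
  fixes k u :: "'a \<Rightarrow> real"
  assumes [measurable]: "k \<in> borel_measurable M" "u \<in> borel_measurable M"
    and k: "\<And>x. x \<in> space M \<Longrightarrow> 0 \<le> k x" "\<And>x. x \<in> space M \<Longrightarrow> k x \<le> K"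
    and u: "\<And>x. x \<in> space M \<Longrightarrow> 0 \<le> u x" "\<And>x. x \<in> space M \<Longrightarrow> u x \<le> B"
    and K: "0 \<le> K" and d: "0 \<le> d"
    and gap: "\<And>s. 0 \<le> s \<Longrightarrow> s < K \<Longrightarrow>
      prob {x \<in> space M. s < k x} + d \<le> prob {x \<in> space M. s < u x}"
  shows "expectation k + d * K \<le> expectation u"
proof -
  have ik: "integrable M k" by (rule integrable_const_bound[of _ K]) (use k in auto)
  have iu: "integrable M u" by (rule integrable_const_bound[of _ B]) (use u in auto)
  have sf: "sigma_finite_measure M" by unfold_locales
  have [measurable]: "(\<lambda>s. emeasure M {x \<in> space M. s < k x}) \<in> borel_measurable borel"
  proof -
    have "{(s, x). x \<in> space M \<and> s < k x} \<in> sets (borel \<Otimes>\<^sub>M M)"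
    proof -
      have "{w \<in> space (borel \<Otimes>\<^sub>M M). fst w < k (snd w)} \<in> sets (borel \<Otimes>\<^sub>M M)" by measurable
      also have "{w \<in> space (borel \<Otimes>\<^sub>M M). fst w < k (snd w)} = {(s, x). x \<in> space M \<and> s < k x}"
        by (auto simp: space_pair_measure)
      finally show ?thesis .
    qed
    from measurable_emeasure_Pair[OF this] show ?thesis by (simp add: vimage_def)
  qed
  have dK: "ennreal (d * K) = (\<integral>\<^sup>+ s. ennreal d * indicator {0..<K} s \<partial>lborel)"
    using K d by (subst nn_integral_cmult_indicator) (auto simp: ennreal_mult)
  have "ennreal (expectation k + d * K) = (\<integral>\<^sup>+ x. ennreal (k x) \<partial>M) + ennreal (d * K)"
    using nn_integral_eq_integral[OF ik] k K d by (simp add: ennreal_plus integral_nonneg_AE)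
  also have "\<dots> = (\<integral>\<^sup>+ s. indicator {0..} s * emeasure M {x \<in> space M. s < k x} +
      ennreal d * indicator {0..<K} s \<partial>lborel)"
    unfolding dK nn_integral_layer_cake[OF sf assms(1)] by (rule nn_integral_add[symmetric]) auto
  also have "\<dots> \<le> (\<integral>\<^sup>+ s. indicator {0..} s * emeasure M {x \<in> space M. s < u x} \<partial>lborel)"
  proof (rule nn_integral_mono)
    fix s :: real
    consider "s < 0" | "0 \<le> s" "s < K" | "K \<le> s" "0 \<le> s" by linarith
    then show "indicator {0..} s * emeasure M {x \<in> space M. s < k x} + ennreal d * indicator {0..<K} s
        \<le> indicator {0..} s * emeasure M {x \<in> space M. s < u x}"
    proof cases
      case 2
      then have "ennreal (prob {x \<in> space M. s < k x} + d) \<le> ennreal (prob {x \<in> space M. s < u x})"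
        using gap by (intro ennreal_leI) auto
      then show ?thesis using 2 d by (simp add: emeasure_eq_measure ennreal_plus)
    next
      case 3
      then have "{x \<in> space M. s < k x} = {}" using k(2) by fastforce
      then have "emeasure M {x \<in> space M. s < k x} = 0" by (simp only: emeasure_empty)
      then show ?thesis using 3 by simp
    qed simp
  qed
  also have "\<dots> = ennreal (expectation u)"
    using nn_integral_eq_integral[OF iu] u nn_integral_layer_cake[OF sf assms(2)] by simp
  finally show ?thesis
    using u by (subst (asm) ennreal_le_iff) (auto intro!: integral_nonneg_AE)
qed

text \<open>
  \<open>m\<close> is the infimum of the levels whose strict superlevel set has measure at most \<open>c\<close>; both
  inequalities at \<open>m\<close> itself follow by continuity of the measure from above and from below.
\<close>

lemma upper_quantile_exists:
  fixes f :: "'a \<Rightarrow> real"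
  assumes [measurable]: "f \<in> borel_measurable M"
    and f: "\<And>x. x \<in> space M \<Longrightarrow> f x \<in> {0..1}" and c: "0 \<le> c" "c \<le> 1"
  obtains m where "0 \<le> m" "prob {x \<in> space M. m < f x} \<le> c" "c \<le> prob {x \<in> space M. m \<le> f x}"
proof -
  define S where "S = {v. 0 \<le> v \<and> prob {x \<in> space M. v < f x} \<le> c}"
  have "{x \<in> space M. 1 < f x} = {}" using f by fastforce
  then have "prob {x \<in> space M. 1 < f x} = 0" by (simp only: measure_empty)
  then have "prob {x \<in> space M. 1 < f x} \<le> c" using c by linarith
  then have S1: "1 \<in> S" unfolding S_def by (intro CollectI conjI) auto
  have bdd: "bdd_below S" by (rule bdd_belowI[of _ 0]) (simp add: S_def)
  define m where "m = Inf S"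
  have m0: "0 \<le> m" unfolding m_def
  proof (rule cInf_greatest)
    show "S \<noteq> {}" using S1 by blast
  qed (simp add: S_def)
  have up: "prob {x \<in> space M. v < f x} \<le> c" if v: "m < v" for v
  proof -
    obtain w where w: "w \<in> S" "w < v"
      using v cInf_less_iff[of S v] S1 bdd unfolding m_def by blast
    then have "prob {x \<in> space M. v < f x} \<le> prob {x \<in> space M. w < f x}"
      by (intro finite_measure_mono) auto
    then show ?thesis using w by (simp add: S_def)
  qed
  have low: "c \<le> prob {x \<in> space M. v < f x}" if "v < m" for v
  proof (cases "v < 0")
    case True
    then have "{x \<in> space M. v < f x} = space M" using f by fastforce
    then show ?thesis using c by (simp add: prob_space)
  next
    case False
    then have "v \<notin> S" using that cInf_lower[OF _ bdd, of v] by (auto simp: m_def)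
    then show ?thesis using False by (simp add: S_def)
  qed
  have "prob {x \<in> space M. m < f x} \<le> c"
  proof (rule LIMSEQ_le_const2)
    have "(\<lambda>n. prob {x \<in> space M. m + 1 / real (Suc n) < f x}) \<longlonglongrightarrow>
        prob (\<Union>n. {x \<in> space M. m + 1 / real (Suc n) < f x})"
    proof (rule finite_Lim_measure_incseq)
      show "incseq (\<lambda>n. {x \<in> space M. m + 1 / real (Suc n) < f x})"
      proof (rule incseq_SucI)
        fix n
        have "1 / real (Suc (Suc n)) \<le> 1 / real (Suc n)" by (simp add: frac_le)
        then show "{x \<in> space M. m + 1 / real (Suc n) < f x} \<subseteq> {x \<in> space M. m + 1 / real (Suc (Suc n)) < f x}"
          by auto
      qed
    qed auto
    also have "(\<Union>n. {x \<in> space M. m + 1 / real (Suc n) < f x}) = {x \<in> space M. m < f x}"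
    proof (intro equalityI subsetI)
      fix x assume "x \<in> (\<Union>n. {x \<in> space M. m + 1 / real (Suc n) < f x})"
      then obtain n where n: "x \<in> space M" "m + 1 / real (Suc n) < f x" by blast
      moreover have "0 < 1 / real (Suc n)" by simp
      ultimately have "m < f x" by linarith
      then show "x \<in> {x \<in> space M. m < f x}" using n by blast
    next
      fix x assume x: "x \<in> {x \<in> space M. m < f x}"
      then obtain n where "1 / real (Suc n) < f x - m" using nat_approx_posE[of "f x - m"] by auto
      then show "x \<in> (\<Union>n. {x \<in> space M. m + 1 / real (Suc n) < f x})" using x
        by (intro UN_I[of n]) auto
    qed
    finally show "(\<lambda>n. prob {x \<in> space M. m + 1 / real (Suc n) < f x}) \<longlonglongrightarrow> prob {x \<in> space M. m < f x}" .
    show "\<exists>N. \<forall>n\<ge>N. prob {x \<in> space M. m + 1 / real (Suc n) < f x} \<le> c"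
      by (intro exI allI impI up) simp
  qed
  moreover have "c \<le> prob {x \<in> space M. m \<le> f x}"
  proof (rule LIMSEQ_le_const)
    have "(\<lambda>n. prob {x \<in> space M. m - 1 / real (Suc n) < f x}) \<longlonglongrightarrow>
        prob (\<Inter>n. {x \<in> space M. m - 1 / real (Suc n) < f x})"
    proof (rule finite_Lim_measure_decseq)
      show "decseq (\<lambda>n. {x \<in> space M. m - 1 / real (Suc n) < f x})"
      proof (rule decseq_SucI)
        fix n
        have "1 / real (Suc (Suc n)) \<le> 1 / real (Suc n)" by (simp add: frac_le)
        then show "{x \<in> space M. m - 1 / real (Suc (Suc n)) < f x} \<subseteq> {x \<in> space M. m - 1 / real (Suc n) < f x}"
          by auto
      qed
    qed auto
    also have "(\<Inter>n. {x \<in> space M. m - 1 / real (Suc n) < f x}) = {x \<in> space M. m \<le> f x}"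
    proof (intro equalityI subsetI)
      fix x assume x: "x \<in> (\<Inter>n. {x \<in> space M. m - 1 / real (Suc n) < f x})"
      have "m \<le> f x"
      proof (rule ccontr)
        assume "\<not> m \<le> f x"
        then obtain n where "1 / real (Suc n) < m - f x" using nat_approx_posE[of "m - f x"] by auto
        moreover have "m - 1 / real (Suc n) < f x" using x by blast
        ultimately show False by linarith
      qed
      then show "x \<in> {x \<in> space M. m \<le> f x}" using x by blast
    next
      fix x assume x: "x \<in> {x \<in> space M. m \<le> f x}"
      have "m - 1 / real (Suc n) < f x" for n
      proof -
        have "0 < 1 / real (Suc n)" by simp
        moreover have "m \<le> f x" using x by blast
        ultimately show ?thesis by linarith
      qed
      then show "x \<in> (\<Inter>n. {x \<in> space M. m - 1 / real (Suc n) < f x})" using x by blast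
    qed
    finally show "(\<lambda>n. prob {x \<in> space M. m - 1 / real (Suc n) < f x}) \<longlonglongrightarrow> prob {x \<in> space M. m \<le> f x}" .
    show "\<exists>N. \<forall>n\<ge>N. c \<le> prob {x \<in> space M. m - 1 / real (Suc n) < f x}"
      by (intro exI allI impI low) simp
  qed
  ultimately show ?thesis using that m0 by blast
qed

text \<open>
  The reduction to two levels. Take \<open>L\<close> the supremum of \<open>f\<close> and \<open>m\<close> the level whose superlevel set has measure
  \<open>1 - d\<close>. The set where \<open>f \<ge> m\<close> expands to the whole space up to a null set, so \<open>h \<ge> \<phi> m\<close> almost everywhere. Above
  \<open>m\<close> the function \<open>\<phi> \<circ> f\<close> dominates its chord \<open>k\<close>, whose superlevel sets have measure at most \<open>1 - d\<close>
  and therefore gain a full \<open>d\<close>; \<open>layer_cake_gap\<close> then gives the cost of the two-level function with values \<open>L\<close>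
  and \<open>m\<close> and the same mean. The first alternative covers the cases in which a single level suffices. The
  case \<open>d = 1\<close> is separate, since then the set where \<open>f \<ge> m\<close> may be empty.
\<close>

lemma expectation_ge_two_level:
  fixes f h \<phi> :: "_ \<Rightarrow> real"
  assumes d: "0 < d" "d \<le> 1"
    and expand: "\<And>B D. B \<in> events \<Longrightarrow> D \<in> events \<Longrightarrow> B \<noteq> {} \<Longrightarrow>
      (\<And>y z. y \<in> space M \<Longrightarrow> z \<in> B \<Longrightarrow> near y z \<Longrightarrow> y \<in> D) \<Longrightarrow> min 1 (prob B + d) \<le> prob D"
    and cv: "concave_on {0..1} \<phi>" and mono: "\<And>x y. x \<le> y \<Longrightarrow> \<phi> x \<le> \<phi> y"
    and [measurable]: "f \<in> borel_measurable M" "h \<in> borel_measurable M"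
    and f: "\<And>z. z \<in> space M \<Longrightarrow> f z \<in> {0..1}" and h: "\<And>y. y \<in> space M \<Longrightarrow> h y \<in> {0..1}"
    and fh: "\<And>y z. y \<in> space M \<Longrightarrow> z \<in> space M \<Longrightarrow> near y z \<Longrightarrow> \<phi> (f z) \<le> h y"
  shows "\<phi> (expectation f) \<le> expectation h \<or>
    (\<exists>x m L. 0 \<le> x \<and> x + d \<le> 1 \<and> 0 \<le> m \<and> m \<le> L \<and> L \<le> 1 \<and> x * L + (1 - x) * m = expectation f \<and>
      (x + d) * \<phi> L + (1 - x - d) * \<phi> m \<le> expectation h)"
proof -
  define \<alpha> where "\<alpha> = expectation f"
  have intf: "integrable M f" by (rule integrable_const_bound[of _ 1]) (use f in auto)
  have inth: "integrable M h" by (rule integrable_const_bound[of _ 1]) (use h in auto)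
  have base: "\<phi> v \<le> expectation h"
    if "{z \<in> space M. v \<le> f z} \<noteq> {}" "1 \<le> prob {z \<in> space M. v \<le> f z} + d" for v
  proof -
    have "min 1 (prob {z \<in> space M. v \<le> f z} + d) \<le> prob {y \<in> space M. \<phi> v \<le> h y}"
      by (rule expand[OF _ _ that(1)]) (use order_trans[OF mono fh] in auto)
    then have "prob {y \<in> space M. \<phi> v \<le> h y} = 1" using that(2) prob_le_1 by (simp add: antisym)
    then have "AE y in M. \<phi> v \<le> h y" using AE_prob_1 by fastforce
    then show ?thesis by (rule integral_ge_const[OF inth])
  qed
  show ?thesis
  proof (cases "d = 1")
    case True
    have "{z \<in> space M. \<alpha> \<le> f z} \<noteq> {}"
    proof
      assume "{z \<in> space M. \<alpha> \<le> f z} = {}"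
      then have "AE z in M. f z < \<alpha>" by (intro AE_I2) fastforce
      then have "expectation f < \<alpha>" by (rule expectation_less[OF intf])
      then show False by (simp add: \<alpha>_def)
    qed
    then have "\<phi> \<alpha> \<le> expectation h" using True by (intro base) auto
    then show ?thesis by (simp add: \<alpha>_def)
  next
    case False
    then have d1: "0 < 1 - d" using d by simp
    obtain m where m: "0 \<le> m" "prob {z \<in> space M. m < f z} \<le> 1 - d" "1 - d \<le> prob {z \<in> space M. m \<le> f z}"
      by (rule upper_quantile_exists[of f "1 - d"]) (use f d in auto)
    have ne: "{z \<in> space M. m \<le> f z} \<noteq> {}" using m(3) d1 by (metis measure_empty not_less)
    have hm: "\<phi> m \<le> expectation h" using m by (intro base ne) auto
    define L where "L = Sup (f ` space M)"
    have bdd: "bdd_above (f ` space M)" using f by (intro bdd_aboveI[of _ 1]) auto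
    have nes: "f ` space M \<noteq> {}" using not_empty by simp
    have fL: "f z \<le> L" if "z \<in> space M" for z using that bdd unfolding L_def by (intro cSup_upper) auto
    have L1: "L \<le> 1" unfolding L_def using f by (intro cSup_least nes) auto
    show ?thesis
    proof (cases "\<alpha> \<le> m")
      case True
      then show ?thesis using hm mono[of \<alpha> m] by (simp add: \<alpha>_def)
    next
      case False
      have "\<alpha> \<le> L" unfolding \<alpha>_def using fL by (intro integral_le_const[OF intf] AE_I2) auto
      then have mL: "m < L" using False by simp
      define \<sigma> where "\<sigma> = (\<phi> L - \<phi> m) / (L - m)"
      define K where "K = \<phi> L - \<phi> m"
      have \<sigma>K: "\<sigma> * (L - m) = K" using mL by (simp add: \<sigma>_def K_def)
      have \<sigma>0: "0 \<le> \<sigma>" using mL mono[of m L] by (simp add: \<sigma>_def)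
      have K0: "0 \<le> K" using mL mono[of m L] by (simp add: K_def)
      define k where "k = (\<lambda>z. \<sigma> * max 0 (f z - m))"
      define u where "u = (\<lambda>y. max 0 (h y - \<phi> m))"
      have [measurable]: "k \<in> borel_measurable M" "u \<in> borel_measurable M" unfolding k_def u_def by auto
      have chord: "\<phi> m + k z \<le> \<phi> (f z)" if z: "z \<in> space M" "m \<le> f z" for z
      proof -
        define t where "t = (f z - m) / (L - m)"
        have t: "0 \<le> t" "t \<le> 1" using z fL mL by (auto simp: t_def)
        have "f z = (1 - t) *\<^sub>R m + t *\<^sub>R L"
        proof -
          have "t * (L - m) = f z - m" using mL by (simp add: t_def)
          then show ?thesis by (simp add: algebra_simps)
        qed
        then have "(1 - t) * \<phi> m + t * \<phi> L \<le> \<phi> (f z)"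
          using concave_onD[OF cv t, of m L] m mL L1 by simp
        moreover have "k z = t * K" using z by (simp add: k_def \<sigma>_def K_def t_def)
        ultimately show ?thesis by (simp add: K_def algebra_simps)
      qed
      have intk: "integrable M k" and intu: "integrable M u"
        unfolding k_def u_def using intf inth by auto
      have kK: "k z \<le> K" if "z \<in> space M" for z
        unfolding k_def \<sigma>K[symmetric] using fL[OF that] mL \<sigma>0 by (intro mult_left_mono) auto
      have uB: "u y \<le> max 0 (1 - \<phi> m)" if "y \<in> space M" for y
        unfolding u_def using h[OF that] by (intro max.mono) auto
      have "expectation k + d * K \<le> expectation u"
      proof (rule layer_cake_gap[where B = "max 0 (1 - \<phi> m)"])
        fix s assume s: "0 \<le> s" "s < K"
        then have \<sigma>: "0 < \<sigma>" using \<sigma>0 \<sigma>K by (cases "\<sigma> = 0") auto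
        have sub: "{z \<in> space M. s < k z} \<subseteq> {z \<in> space M. m < f z}"
        proof
          fix z assume z: "z \<in> {z \<in> space M. s < k z}"
          have "m < f z"
          proof (rule ccontr)
            assume "\<not> m < f z"
            then have "k z = 0" by (simp add: k_def)
            then show False using z s by simp
          qed
          then show "z \<in> {z \<in> space M. m < f z}" using z by blast
        qed
        have "m + s / \<sigma> < L" using s \<sigma> \<sigma>K by (simp add: field_simps)
        then obtain z where z: "z \<in> space M" "m + s / \<sigma> < f z"
          using less_cSup_iff[OF nes bdd, of "m + s / \<sigma>"] unfolding L_def by auto
        have "s / \<sigma> < max 0 (f z - m)" using z by auto
        then have "s < k z" using \<sigma> by (simp add: k_def pos_divide_less_eq mult.commute)
        then have nz: "{z \<in> space M. s < k z} \<noteq> {}" using z by blast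
        have "min 1 (prob {z \<in> space M. s < k z} + d) \<le> prob {y \<in> space M. s < u y}"
        proof (rule expand[OF _ _ nz])
          fix y z assume yz: "y \<in> space M" "z \<in> {z \<in> space M. s < k z}" "near y z"
          then have "m < f z" using sub by blast
          then have "\<phi> m + k z \<le> h y" using chord[of z] fh[of y z] yz by fastforce
          then show "y \<in> {y \<in> space M. s < u y}" using yz by (auto simp: u_def)
        qed auto
        moreover have "prob {z \<in> space M. s < k z} \<le> prob {z \<in> space M. m < f z}"
          by (rule finite_measure_mono[OF sub]) auto
        ultimately show "prob {z \<in> space M. s < k z} + d \<le> prob {y \<in> space M. s < u y}" using m(2) by linarith
      qed (use kK uB K0 d \<sigma>0 in \<open>auto simp: k_def u_def\<close>)
      moreover have "expectation u = expectation h - \<phi> m"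
      proof -
        have "AE y in M. \<phi> m \<le> h y"
        proof -
          have "min 1 (prob {z \<in> space M. m \<le> f z} + d) \<le> prob {y \<in> space M. \<phi> m \<le> h y}"
            by (rule expand[OF _ _ ne]) (use order_trans[OF mono fh] in auto)
          then have "prob {y \<in> space M. \<phi> m \<le> h y} = 1" using m(3) prob_le_1 by (simp add: antisym)
          then show ?thesis using AE_prob_1 by fastforce
        qed
        then have "expectation u = expectation (\<lambda>y. h y - \<phi> m)"
          by (intro integral_cong_AE) (auto simp: u_def)
        then show ?thesis using inth by (simp add: prob_space)
      qed
      moreover have "\<sigma> * (\<alpha> - m) \<le> expectation k"
      proof -
        have "\<sigma> * (\<alpha> - m) = expectation (\<lambda>z. \<sigma> * (f z - m))"
          using intf by (simp add: \<alpha>_def prob_space)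
        also have "\<dots> \<le> expectation k"
          using intf intk \<sigma>0 by (intro integral_mono) (auto simp: k_def intro!: mult_left_mono)
        finally show ?thesis .
      qed
      ultimately have main: "\<phi> m + \<sigma> * (\<alpha> - m) + d * K \<le> expectation h" by linarith
      define x where "x = (\<alpha> - m) / (L - m)"
      have xL: "x * (L - m) = \<alpha> - m" using mL by (simp add: x_def)
      have x0: "0 \<le> x" using mL False by (simp add: x_def)
      have "\<alpha> \<le> expectation (\<lambda>z. m + (L - m) * indicator {z \<in> space M. m < f z} z)"
        unfolding \<alpha>_def
      proof (rule integral_mono[OF intf])
        show "integrable M (\<lambda>z. m + (L - m) * indicator {z \<in> space M. m < f z} z)"
          by (intro Bochner_Integration.integrable_add integrable_mult_right integrable_real_indicator)
            (auto simp: emeasure_eq_measure)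
        show "f z \<le> m + (L - m) * indicator {z \<in> space M. m < f z} z" if "z \<in> space M" for z
          using fL[OF that] that by (auto simp: indicator_def)
      qed
      also have "\<dots> = m + (L - m) * prob {z \<in> space M. m < f z}"
      proof -
        have "expectation (\<lambda>z. m + (L - m) * indicator {z \<in> space M. m < f z} z) =
            expectation (\<lambda>z. m) + expectation (\<lambda>z. (L - m) * indicator {z \<in> space M. m < f z} z)"
          by (intro Bochner_Integration.integral_add integrable_mult_right integrable_real_indicator)
            (auto simp: emeasure_eq_measure)
        also have "expectation (\<lambda>z. (L - m) * indicator {z \<in> space M. m < f z} z) =
            (L - m) * prob {z \<in> space M. m < f z}"
        proof -
          have "{z \<in> space M. m < f z} \<inter> space M = {z \<in> space M. m < f z}" by blast
          then show ?thesis by simp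
        qed
        finally show ?thesis by (simp add: prob_space)
      qed
      also have "\<dots> \<le> m + (L - m) * (1 - d)" using m(2) mL by (intro add_left_mono mult_left_mono) auto
      finally have "(L - m) * x \<le> (L - m) * (1 - d)" using xL by (simp add: mult.commute)
      then have xd: "x + d \<le> 1" using mL by simp
      have "x * K = \<sigma> * (\<alpha> - m)" unfolding \<sigma>K[symmetric] xL[symmetric] by simp
      then have "(x + d) * \<phi> L + (1 - x - d) * \<phi> m = \<phi> m + \<sigma> * (\<alpha> - m) + d * K"
        unfolding K_def by (simp add: algebra_simps)
      then have "(x + d) * \<phi> L + (1 - x - d) * \<phi> m \<le> expectation h" using main by simp
      moreover have "x * L + (1 - x) * m = \<alpha>" using xL by (simp add: algebra_simps)
      ultimately show ?thesis using x0 xd m mL L1 unfolding \<alpha>_def by (intro disjI2 exI[of _ x] exI[of _ m] exI[of _ L]) auto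
    qed
  qed
qed

end

section \<open>Products of expanding factors\<close>

text \<open>
  The set \<open>D\<close> stands for any measurable superset of the neighbourhood of \<open>B\<close>, so that the
  measurability of neighbourhoods is no issue in the induction.
\<close>

locale expanding_factors = side_lengths +
  fixes M :: "nat \<Rightarrow> 'a measure" and near :: "nat \<Rightarrow> 'a \<Rightarrow> 'a \<Rightarrow> bool"
  assumes factor_prob: "\<And>i. prob_space (M i)"
    and factor_expand: "\<And>i B D. B \<in> sets (M i) \<Longrightarrow> D \<in> sets (M i) \<Longrightarrow> B \<noteq> {} \<Longrightarrow>
      (\<And>y z. y \<in> space (M i) \<Longrightarrow> z \<in> B \<Longrightarrow> near i y z \<Longrightarrow> y \<in> D) \<Longrightarrow>
      min 1 (measure (M i) B + \<delta> i) \<le> measure (M i) D"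
begin

lemma measure_PiM_insert_slices:
  assumes "finite I" "i \<notin> I" and [measurable]: "A \<in> sets (PiM (insert i I) M)"
  defines "slice \<equiv> \<lambda>z. measure (PiM I M) {x \<in> space (PiM I M). x(i := z) \<in> A}"
  shows "slice \<in> borel_measurable (M i)"
    and "measure (PiM (insert i I) M) A = (\<integral>z. slice z \<partial>M i)"
    and "\<And>z. z \<in> space (M i) \<Longrightarrow> {x \<in> space (PiM I M). x(i := z) \<in> A} \<in> sets (PiM I M)"
    and "\<And>z. slice z \<in> {0..1}"
proof -
  interpret product_prob_space M UNIV by (rule product_prob_spaceI[OF factor_prob])
  interpret PI: finite_product_prob_space M I by standard fact
  interpret PJ: finite_product_prob_space M "insert i I" by standard (simp add: assms)
  have [measurable]: "(\<lambda>x. x(i := z)) \<in> PiM I M \<rightarrow>\<^sub>M PiM (insert i I) M" if "z \<in> space (M i)" for z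
    by (rule measurable_fun_upd[where J = I]) (use that in auto)
  show sl: "{x \<in> space (PiM I M). x(i := z) \<in> A} \<in> sets (PiM I M)" if "z \<in> space (M i)" for z
    using that by measurable
  have em: "emeasure (PiM I M) {x \<in> space (PiM I M). x(i := z) \<in> A} =
      (\<integral>\<^sup>+ x. indicator A (x(i := z)) \<partial>PiM I M)" if "z \<in> space (M i)" for z
    by (subst nn_integral_indicator[OF sl[OF that], symmetric]) (auto intro!: nn_integral_cong simp: indicator_def)
  have "(\<lambda>z. \<integral>\<^sup>+ x. indicator A (x(i := z)) \<partial>PiM I M) \<in> borel_measurable (M i)"
  proof -
    have [measurable]: "(\<lambda>w. (snd w)(i := fst w)) \<in> (M i \<Otimes>\<^sub>M PiM I M) \<rightarrow>\<^sub>M PiM (insert i I) M"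
      by (rule measurable_fun_upd[where J = I]) auto
    have "(\<lambda>(z, x). indicator A (x(i := z))) \<in> borel_measurable (M i \<Otimes>\<^sub>M PiM I M)"
      unfolding split_beta' by measurable
    then show ?thesis by (intro PI.borel_measurable_nn_integral) auto
  qed
  then have ems: "(\<lambda>z. emeasure (PiM I M) {x \<in> space (PiM I M). x(i := z) \<in> A}) \<in> borel_measurable (M i)"
    by (subst measurable_cong[OF em]) auto
  then show sm: "slice \<in> borel_measurable (M i)"
    unfolding slice_def measure_def by measurable
  show s01: "slice z \<in> {0..1}" for z by (simp add: slice_def)
  have "ennreal (measure (PiM (insert i I) M) A) = (\<integral>\<^sup>+ x. indicator A x \<partial>PiM (insert i I) M)"
    by (simp add: PJ.emeasure_eq_measure)
  also have "\<dots> = (\<integral>\<^sup>+ z. (\<integral>\<^sup>+ x. indicator A (x(i := z)) \<partial>PiM I M) \<partial>M i)"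
    by (rule product_nn_integral_insert_rev) (use assms in auto)
  also have "\<dots> = (\<integral>\<^sup>+ z. ennreal (slice z) \<partial>M i)"
    by (intro nn_integral_cong) (simp add: em[symmetric] slice_def PI.emeasure_eq_measure)
  also have "\<dots> = ennreal (\<integral>z. slice z \<partial>M i)"
  proof (rule nn_integral_eq_integral)
    show "integrable (M i) slice"
      by (rule M.integrable_const_bound[of _ 1]) (use s01 sm in auto)
  qed (use s01 in auto)
  finally show "measure (PiM (insert i I) M) A = (\<integral>z. slice z \<partial>M i)"
    using s01 by (subst (asm) ennreal_inj) (auto intro!: integral_nonneg_AE)
qed

text \<open>
  The induction on the coordinates. The slices of \<open>A\<close> and \<open>D\<close> satisfy the hypothesis of the lemma for the
  remaining coordinates whenever their positions are near.
\<close>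

theorem profile_le_measure_expansion:
  assumes "finite I" "A \<in> sets (PiM I M)" "D \<in> sets (PiM I M)"
    and "\<And>w a. w \<in> space (PiM I M) \<Longrightarrow> a \<in> A \<Longrightarrow> (\<And>i. i \<in> I \<Longrightarrow> near i (w i) (a i)) \<Longrightarrow> w \<in> D"
  shows "profile I (measure (PiM I M) A) \<le> measure (PiM I M) D"
  using assms
proof (induction I arbitrary: A D rule: finite_induct)
  case empty
  interpret product_prob_space M UNIV by (rule product_prob_spaceI[OF factor_prob])
  interpret PE: finite_product_prob_space M "{}" by standard simp
  show ?case
  proof (cases "A = {}")
    case False
    then have "A = space (PiM {} M)"
      using sets.sets_into_space[OF empty(1)] by (auto simp: space_PiM)
    then have "D = space (PiM {} M)"
      using empty(3) sets.sets_into_space[OF empty(2)] by auto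
    then show ?thesis using profile_le_1[of "{}"] by (simp add: PE.prob_space)
  qed (simp add: measure_nonneg)
next
  case (insert i I)
  interpret product_prob_space M UNIV by (rule product_prob_spaceI[OF factor_prob])
  let ?N = "PiM I M"
  define f where "f = (\<lambda>z. measure ?N {x \<in> space ?N. x(i := z) \<in> A})"
  define h where "h = (\<lambda>z. measure ?N {x \<in> space ?N. x(i := z) \<in> D})"
  note fA = measure_PiM_insert_slices[OF insert(1,2,4), folded f_def]
  note hD = measure_PiM_insert_slices[OF insert(1,2,5), folded h_def]
  have f01: "f z \<in> {0..1}" and h01: "h z \<in> {0..1}" for z
    using measure_PiM_insert_slices(4)[OF insert(1,2,4), of z]
      measure_PiM_insert_slices(4)[OF insert(1,2,5), of z] by (simp_all add: f_def h_def)
  have upd: "x(i := y) \<in> space (PiM (insert i I) M)" if "x \<in> space ?N" "y \<in> space (M i)" for x y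
    using that insert(2) by (auto simp: space_PiM PiE_def extensional_def Pi_def)
  have fh: "profile I (f z) \<le> h y" if yz: "y \<in> space (M i)" "z \<in> space (M i)" "near i y z" for y z
    unfolding f_def h_def
  proof (rule insert.IH)
    fix w a assume wa: "w \<in> space ?N" "a \<in> {x \<in> space ?N. x(i := z) \<in> A}"
      "\<And>j. j \<in> I \<Longrightarrow> near j (w j) (a j)"
    have "w(i := y) \<in> D"
    proof (rule insert.prems(3))
      show "w(i := y) \<in> space (PiM (insert i I) M)" using wa yz upd by blast
      show "a(i := z) \<in> A" using wa by blast
      show "near j ((w(i := y)) j) ((a(i := z)) j)" if "j \<in> insert i I" for j
        using that wa yz insert(2) by auto
    qed
    then show "w \<in> {x \<in> space ?N. x(i := y) \<in> D}" using wa by blast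
  qed (use fA(3) hD(3) yz in auto)
  have two: "profile I (M.expectation i f) \<le> M.expectation i h \<or>
    (\<exists>x m L. 0 \<le> x \<and> x + \<delta> i \<le> 1 \<and> 0 \<le> m \<and> m \<le> L \<and> L \<le> 1 \<and> x * L + (1 - x) * m = M.expectation i f \<and>
      (x + \<delta> i) * profile I L + (1 - x - \<delta> i) * profile I m \<le> M.expectation i h)"
    by (rule M.expectation_ge_two_level[where near = "near i", OF side_pos side_le_1 factor_expand
          concave_on_profile[OF insert(1)] profile_mono[OF insert(1)] fA(1) hD(1) f01 h01 fh])
  have fin: "finite (insert i I)" using insert by simp
  have rem: "insert i I - {i} = I" using insert by simp
  have "profile (insert i I) (M.expectation i f) \<le> M.expectation i h"
  proof (cases "M.expectation i f \<le> 0")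
    case True
    then show ?thesis using h01 by (auto intro!: integral_nonneg_AE)
  next
    case False
    from two show ?thesis
    proof (elim disjE exE conjE)
      assume "profile I (M.expectation i f) \<le> M.expectation i h"
      then show ?thesis using profile_antimono[OF fin subset_insertI, of "M.expectation i f"] by linarith
    next
      fix x m L assume "0 \<le> x" "x + \<delta> i \<le> 1" "0 \<le> m" "m \<le> L" "L \<le> 1"
        "x * L + (1 - x) * m = M.expectation i f"
        "(x + \<delta> i) * profile I L + (1 - x - \<delta> i) * profile I m \<le> M.expectation i h"
      then show ?thesis
        using profile_le_two_level[OF fin insertI1, of "M.expectation i f" x m L] False unfolding rem by linarith
    qed
  qed
  then show ?case using fA(2) hD(2) by simp
qed

end

section \<open>Intervals and circles\<close>

lemma lmeasurable_Ico: "{a..<b::real} \<in> lmeasurable"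
  by (rule fmeasurableI2[of "{a..b}"]) auto

lemma measure_lebesgue_Ico: "a \<le> b \<Longrightarrow> measure lebesgue {a..<b::real} = b - a"
  by (simp add: measure_def)

lemma measure_disjoint_Un:
  "A \<in> lmeasurable \<Longrightarrow> B \<in> lmeasurable \<Longrightarrow> A \<inter> B = {} \<Longrightarrow>
    measure lebesgue (A \<union> B) = measure lebesgue A + measure lebesgue (B :: real set)"
  by (simp add: measure_Un3)

lemma measure_add_gap:
  fixes u v :: real
  assumes B: "B \<in> lmeasurable" and D: "D \<in> lmeasurable" and "B \<subseteq> D" "{u<..<v} \<subseteq> D" "{u<..<v} \<inter> B = {}" "u \<le> v"
  shows "measure lebesgue B + (v - u) \<le> measure lebesgue D"
proof -
  have "measure lebesgue (B \<union> {u<..<v}) = measure lebesgue B + measure lebesgue {u<..<v}"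
    using assms by (intro measure_disjoint_Un) auto
  moreover have "measure lebesgue (B \<union> {u<..<v}) \<le> measure lebesgue D"
    using assms by (intro measure_mono_fmeasurable) (auto intro: fmeasurableD)
  ultimately show ?thesis using assms by simp
qed

text \<open>
  The gap lies immediately to the right of the supremum of \<open>C\<close>. The point \<open>w\<close> is a barrier that separates \<open>C\<close>
  from the rest of \<open>B\<close> and leaves room for the gap.
\<close>

lemma expand_right:
  fixes B D :: "real set"
  assumes B: "B \<in> lmeasurable" and D: "D \<in> lmeasurable" and "B \<subseteq> D" and C: "C \<subseteq> B" "C \<noteq> {}" and h: "0 \<le> h"
    and w: "\<And>z. z \<in> C \<Longrightarrow> z + h \<le> w" "\<And>z. z \<in> B - C \<Longrightarrow> w \<le> z"
    and near: "\<And>y z. z \<in> C \<Longrightarrow> z < y \<Longrightarrow> y < z + h \<Longrightarrow> y < w \<Longrightarrow> y \<in> D"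
  shows "measure lebesgue B + h \<le> measure lebesgue D"
proof -
  define b where "b = Sup C"
  have bdd: "bdd_above C" using w(1) h by (intro bdd_aboveI[of _ w]) fastforce
  have ub: "z \<le> b" if "z \<in> C" for z using that bdd unfolding b_def by (rule cSup_upper)
  have bw: "b + h \<le> w" using cSup_least[OF C(2), of "w - h"] w(1) unfolding b_def by fastforce
  have "measure lebesgue B + ((b + h) - b) \<le> measure lebesgue D"
  proof (rule measure_add_gap[OF B D \<open>B \<subseteq> D\<close>])
    show "{b<..<b + h} \<subseteq> D"
    proof
      fix y assume y: "y \<in> {b<..<b + h}"
      then obtain z where z: "z \<in> C" "y - h < z" using less_cSup_iff[OF C(2) bdd, of "y - h"] unfolding b_def by auto
      then show "y \<in> D" using near[of z y] ub[of z] y bw by auto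
    qed
    show "{b<..<b + h} \<inter> B = {}"
    proof (rule ccontr)
      assume "{b<..<b + h} \<inter> B \<noteq> {}"
      then obtain y where y: "b < y" "y < b + h" "y \<in> B" by auto
      then show False using ub[of y] w(2)[of y] bw by (cases "y \<in> C") auto
    qed
  qed (use h in auto)
  then show ?thesis by simp
qed

lemma expand_left:
  fixes B D :: "real set"
  assumes B: "B \<in> lmeasurable" and D: "D \<in> lmeasurable" and "B \<subseteq> D" and C: "C \<subseteq> B" "C \<noteq> {}" and h: "0 \<le> h"
    and w: "\<And>z. z \<in> C \<Longrightarrow> w \<le> z - h" "\<And>z. z \<in> B - C \<Longrightarrow> z \<le> w"
    and near: "\<And>y z. z \<in> C \<Longrightarrow> y < z \<Longrightarrow> z - h < y \<Longrightarrow> w < y \<Longrightarrow> y \<in> D"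
  shows "measure lebesgue B + h \<le> measure lebesgue D"
proof -
  define b where "b = Inf C"
  have bdd: "bdd_below C" using w(1) h by (intro bdd_belowI[of _ w]) fastforce
  have lb: "b \<le> z" if "z \<in> C" for z using that bdd unfolding b_def by (rule cInf_lower)
  have bw: "w \<le> b - h" using cInf_greatest[OF C(2), of "w + h"] w(1) unfolding b_def by fastforce
  have "measure lebesgue B + (b - (b - h)) \<le> measure lebesgue D"
  proof (rule measure_add_gap[OF B D \<open>B \<subseteq> D\<close>])
    show "{b - h<..<b} \<subseteq> D"
    proof
      fix y assume y: "y \<in> {b - h<..<b}"
      then obtain z where z: "z \<in> C" "z < y + h" using cInf_less_iff[OF C(2) bdd, of "y + h"] unfolding b_def by auto
      then show "y \<in> D" using near[of z y] lb[of z] y bw by auto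
    qed
    show "{b - h<..<b} \<inter> B = {}"
    proof (rule ccontr)
      assume "{b - h<..<b} \<inter> B \<noteq> {}"
      then obtain y where y: "b - h < y" "y < b" "y \<in> B" by auto
      then show False using lb[of y] w(2)[of y] bw by (cases "y \<in> C") auto
    qed
  qed (use h in auto)
  then show ?thesis by simp
qed

text \<open>
  The right gap is removed from \<open>D\<close> before the left gap is found, so that the two gains do not overlap.
\<close>

lemma expand_both_sides:
  fixes B D :: "real set"
  assumes B: "B \<in> lmeasurable" and D: "D \<in> lmeasurable" and ne: "B \<noteq> {}" and h: "0 < h"
    and range: "B \<subseteq> {a + h..c - h}"
    and near: "\<And>y z. z \<in> B \<Longrightarrow> \<bar>y - z\<bar> < h \<Longrightarrow> a < y \<Longrightarrow> y < c \<Longrightarrow> y \<in> D"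
  shows "measure lebesgue B + 2 * h \<le> measure lebesgue D"
proof -
  have sub: "B \<subseteq> D"
  proof
    fix z assume z: "z \<in> B"
    then show "z \<in> D" using near[OF z, of z] h range by fastforce
  qed
  define b where "b = Sup B"
  have bdd: "bdd_above B" using range by (intro bdd_aboveI[of _ "c - h"]) auto
  have ub: "z \<le> b" if "z \<in> B" for z using that bdd unfolding b_def by (rule cSup_upper)
  have bc: "b + h \<le> c" using cSup_least[OF ne, of "c - h"] range unfolding b_def by fastforce
  obtain z0 where z0: "z0 \<in> B" using ne by blast
  have z0ab: "a + h \<le> z0" "z0 \<le> c - h" using z0 range by auto
  let ?D = "D - {b<..<b + h}"
  have mD: "?D \<in> lmeasurable" using D by (intro fmeasurable.Diff) auto
  have "measure lebesgue B + h \<le> measure lebesgue ?D"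
  proof (rule expand_left[where C = B and w = a])
    show "B \<subseteq> ?D" using sub ub by fastforce
    show "y \<in> ?D" if "z \<in> B" "y < z" "z - h < y" "a < y" for y z
    proof -
      have "z \<le> c - h" using range that(1) by auto
      then have "y \<in> D" using near[of z y] that h by auto
      then show ?thesis using ub[OF that(1)] that by auto
    qed
    show "a \<le> z - h" if "z \<in> B" for z using range that by fastforce
  qed (use B mD ne h in auto)
  moreover have "measure lebesgue ?D + ((b + h) - b) \<le> measure lebesgue D"
  proof (rule measure_add_gap[OF mD D])
    show "{b<..<b + h} \<subseteq> D"
    proof
      fix y assume y: "y \<in> {b<..<b + h}"
      then obtain z where z: "z \<in> B" "y - h < z" using less_cSup_iff[OF ne bdd, of "y - h"] unfolding b_def by auto
      have "z0 \<le> b" using ub[OF z0] .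
      then show "y \<in> D" using near[of z y] ub[OF z(1)] z y bc z0ab h by auto
    qed
  qed (use h in auto)
  ultimately show ?thesis by simp
qed

text \<open>
  What the proof needs to know about a factor. The lower bound rests on \<open>expand\<close>; \<open>segment\<close> and
  \<open>segment_expand\<close> serve to compute the neighbourhoods of cuboids and anti-cuboids, and the last two
  properties make neighbourhoods measurable.
\<close>

locale unit_factor =
  fixes Y :: "real mm_space" and d :: real
  assumes prob: "prob_space (mm_measure Y)"
    and ground_cases: "ground Y = {0..1} \<or> ground Y = {0..<1}"
    and expand: "\<And>B D. B \<in> sets (mm_measure Y) \<Longrightarrow> D \<in> sets (mm_measure Y) \<Longrightarrow> B \<noteq> {} \<Longrightarrow>
      (\<And>y z. y \<in> ground Y \<Longrightarrow> z \<in> B \<Longrightarrow> mm_dist Y y z < 1 \<Longrightarrow> y \<in> D) \<Longrightarrow>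
      min 1 (measure (mm_measure Y) B + d) \<le> measure (mm_measure Y) D"
    and segment: "\<And>x. x \<in> {0..1} \<Longrightarrow> {0..x} \<inter> ground Y \<in> sets (mm_measure Y) \<and>
      measure (mm_measure Y) ({0..x} \<inter> ground Y) = x \<and> {0..<x} \<inter> ground Y \<in> sets (mm_measure Y) \<and>
      measure (mm_measure Y) ({0..<x} \<inter> ground Y) = x"
    and segment_expand: "\<And>x. 0 \<le> x \<Longrightarrow> \<exists>E\<in>sets (mm_measure Y). measure (mm_measure Y) E \<le> x + d \<and>
      (\<forall>y\<in>ground Y. \<forall>z\<in>ground Y. z \<le> x \<longrightarrow> mm_dist Y y z < 1 \<longrightarrow> y \<in> E)"
    and dist_cont: "\<And>z. continuous_on UNIV (\<lambda>y. mm_dist Y y z)"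
    and near_meas: "\<And>z. {y \<in> ground Y. mm_dist Y y z < 1} \<in> sets (mm_measure Y)"

lemma lebesgue_on_unit:
  assumes "S = {0..1::real} \<or> S = {0..<1}"
  shows "prob_space (lebesgue_on S)"
    and "A \<in> sets (lebesgue_on S) \<longleftrightarrow> A \<subseteq> S \<and> A \<in> lmeasurable"
    and "A \<subseteq> S \<Longrightarrow> measure (lebesgue_on S) A = measure lebesgue A"
    and "x \<in> {0..1} \<Longrightarrow> {0..x} \<inter> S \<in> sets (lebesgue_on S) \<and>
      measure (lebesgue_on S) ({0..x} \<inter> S) = x \<and> {0..<x} \<inter> S \<in> sets (lebesgue_on S) \<and>
      measure (lebesgue_on S) ({0..<x} \<inter> S) = x"
    and "continuous_on UNIV f \<Longrightarrow> {y \<in> S. f y < (1::real)} \<in> sets (lebesgue_on S)"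
proof -
  have S: "S \<in> sets lebesgue" "S \<in> lmeasurable" using assms by (auto simp: lmeasurable_Ico)
  show "prob_space (lebesgue_on S)"
  proof (rule prob_spaceI)
    have "emeasure lebesgue S = 1" using assms by auto
    then show "emeasure (lebesgue_on S) (space (lebesgue_on S)) = 1"
      using S by (simp add: emeasure_restrict_space space_restrict_space)
  qed
  have sets: "A \<in> sets (lebesgue_on S) \<longleftrightarrow> A \<subseteq> S \<and> A \<in> lmeasurable" for A
    using S by (subst sets_restrict_space_iff) (auto intro: fmeasurableI2 fmeasurableD)
  have meas: "measure (lebesgue_on S) A = measure lebesgue A" if "A \<subseteq> S" for A
    using S that by (intro measure_restrict_space) auto
  show "A \<in> sets (lebesgue_on S) \<longleftrightarrow> A \<subseteq> S \<and> A \<in> lmeasurable" by (rule sets)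
  show "measure (lebesgue_on S) A = measure lebesgue A" if "A \<subseteq> S" by (rule meas[OF that])
  show "{0..x} \<inter> S \<in> sets (lebesgue_on S) \<and>
      measure (lebesgue_on S) ({0..x} \<inter> S) = x \<and> {0..<x} \<inter> S \<in> sets (lebesgue_on S) \<and>
      measure (lebesgue_on S) ({0..<x} \<inter> S) = x" if x: "x \<in> {0..1}"
  proof -
    have "{0..x} \<inter> S = {0..x} \<or> {0..x} \<inter> S = {0..<x}"
      using assms x by (cases "x = 1") auto
    then have "measure lebesgue ({0..x} \<inter> S) = x" "{0..x} \<inter> S \<in> lmeasurable"
      using x by (auto simp: lmeasurable_Ico measure_lebesgue_Ico)
    moreover have "{0..<x} \<inter> S = {0..<x}" "{0..<x} \<subseteq> S" using assms x by auto
    ultimately show ?thesis using x by (simp add: sets meas lmeasurable_Ico measure_lebesgue_Ico)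
  qed
  show "{y \<in> S. f y < 1} \<in> sets (lebesgue_on S)" if f: "continuous_on UNIV f"
  proof -
    have "open {y. f y < 1}" using f by (intro open_Collect_less continuous_intros)
    then have "S \<inter> {y. f y < 1} \<in> sets lebesgue" using S by auto
    then have m: "S \<inter> {y. f y < 1} \<in> lmeasurable" by (rule fmeasurableI2[OF S(2), rotated]) auto
    have eq: "{y \<in> S. f y < 1} = S \<inter> {y. f y < 1}" by auto
    show "{y \<in> S. f y < 1} \<in> sets (lebesgue_on S)" unfolding eq sets using m by blast
  qed
qed

text \<open>
  If some point \<open>w\<close> stays outside the neighbourhood of \<open>B\<close>, then \<open>B\<close> keeps distance \<open>d\<close> from it. The part of \<open>B\<close> on
  one side of \<open>w\<close> is nonempty, and there is room for a gap of length \<open>d\<close> between this part and \<open>w\<close>.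
\<close>

lemma unit_factor_interval:
  assumes d: "0 < d" "d \<le> 1"
  shows "unit_factor (interval_space d) d"
proof -
  have near: "mm_dist (interval_space d) y z < 1 \<longleftrightarrow> \<bar>y - z\<bar> < d" for y z
    using d by (simp add: interval_space_def pos_divide_less_eq)
  have [simp]: "mm_measure (interval_space d) = lebesgue_on {0..1}"
    by (simp add: interval_space_def)
  show ?thesis
  proof (rule unit_factor.intro)
    show "prob_space (mm_measure (interval_space d))" using lebesgue_on_unit(1) by simp
    show "ground (interval_space d) = {0..1} \<or> ground (interval_space d) = {0..<1}" by simp
    show cont: "continuous_on UNIV (\<lambda>y. mm_dist (interval_space d) y z)" for z
      unfolding interval_space_def using d by (auto intro!: continuous_intros)
    show "{y \<in> ground (interval_space d). mm_dist (interval_space d) y z < 1} \<in> sets (mm_measure (interval_space d))" for z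
      using lebesgue_on_unit(5)[OF _ cont, of "{0..1}" z] by simp
    show "\<exists>E\<in>sets (mm_measure (interval_space d)). measure (mm_measure (interval_space d)) E \<le> x + d \<and>
      (\<forall>y\<in>ground (interval_space d). \<forall>z\<in>ground (interval_space d). z \<le> x \<longrightarrow> mm_dist (interval_space d) y z < 1 \<longrightarrow> y \<in> E)"
      if x: "0 \<le> x" for x
    proof (intro bexI conjI ballI impI)
      show E: "{0..1} \<inter> {0..<x + d} \<in> sets (mm_measure (interval_space d))"
        by (simp add: lebesgue_on_unit(2) fmeasurable.Int lmeasurable_Ico)
      have "measure lebesgue ({0..1} \<inter> {0..<x + d}) \<le> measure lebesgue {0..<x + d}"
        by (intro measure_mono_fmeasurable) (auto simp: lmeasurable_Ico)
      then show "measure (mm_measure (interval_space d)) ({0..1} \<inter> {0..<x + d}) \<le> x + d"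
        using x d by (simp add: lebesgue_on_unit(3) measure_lebesgue_Ico)
      fix y z assume "y \<in> ground (interval_space d)" "z \<in> ground (interval_space d)" "z \<le> x"
        "mm_dist (interval_space d) y z < 1"
      then show "y \<in> {0..1} \<inter> {0..<x + d}" unfolding near by auto
    qed
    fix B D
    assume B: "B \<in> sets (mm_measure (interval_space d))" and D: "D \<in> sets (mm_measure (interval_space d))"
      and ne: "B \<noteq> {}"
      and BD: "\<And>y z. y \<in> ground (interval_space d) \<Longrightarrow> z \<in> B \<Longrightarrow> mm_dist (interval_space d) y z < 1 \<Longrightarrow> y \<in> D"
    have B': "B \<subseteq> {0..1}" "B \<in> lmeasurable" and D': "D \<subseteq> {0..1}" "D \<in> lmeasurable"
      using B D by (auto simp: lebesgue_on_unit(2))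
    have BD': "y \<in> D" if "0 \<le> y" "y \<le> 1" "z \<in> B" "\<bar>y - z\<bar> < d" for y z
      using BD[of y z] that by (simp add: near)
    have sub: "B \<subseteq> D"
    proof
      fix z assume "z \<in> B"
      then show "z \<in> D" using BD'[of z z] d B' by fastforce
    qed
    have "min 1 (measure lebesgue B + d) \<le> measure lebesgue D"
    proof (cases "D = {0..1}")
      case False
      then obtain w where w: "w \<in> {0..1}" "w \<notin> D" using D' by blast
      have far: "d \<le> \<bar>w - z\<bar>" if "z \<in> B" for z using BD'[of w z] w that by fastforce
      define C where "C = B \<inter> {..w}"
      show ?thesis
      proof (cases "C = {}")
        case False
        have "measure lebesgue B + d \<le> measure lebesgue D"
        proof (rule expand_right[OF B'(2) D'(2) sub _ False, where w = w])
          show "z + d \<le> w" if "z \<in> C" for z using far[of z] that by (auto simp: C_def)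
          show "y \<in> D" if "z \<in> C" "z < y" "y < z + d" "y < w" for y z
            using BD'[of y z] that B' w by (fastforce simp: C_def)
        qed (use d in \<open>auto simp: C_def\<close>)
        then show ?thesis by simp
      next
        case True
        have gt: "w < z" if "z \<in> B" for z using True that by (auto simp: C_def)
        have "measure lebesgue B + d \<le> measure lebesgue D"
        proof (rule expand_left[OF B'(2) D'(2) sub _ ne, where w = w])
          show "w \<le> z - d" if "z \<in> B" for z using far[of z] gt[of z] that by auto
          show "y \<in> D" if "z \<in> B" "y < z" "z - d < y" "w < y" for y z
            using BD'[of y z] that B' w by fastforce
        qed (use d in auto)
        then show ?thesis by simp
      qed
    qed auto
    then show "min 1 (measure (mm_measure (interval_space d)) B + d) \<le> measure (mm_measure (interval_space d)) D"
      using B' D' by (simp add: lebesgue_on_unit(3))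
  qed (use lebesgue_on_unit(4)[of "{0..1}"] in simp)
qed

text \<open>
  Cut the circle open at a point \<open>w\<close> outside the neighbourhood of \<open>B\<close>: the map \<open>U\<close> sends the circle to
  the segment from \<open>w\<close> to \<open>w + 1\<close> on the line. The image of \<open>B\<close> keeps distance \<open>h\<close> from both ends and
  expands by \<open>h\<close> on both sides, in total by \<open>2 * h = d\<close>.
\<close>

lemma unit_factor_circle:
  assumes d: "0 < d" "d \<le> 1"
  shows "unit_factor (circle_space (d / 2)) d"
proof -
  define h where "h = d / 2"
  have h: "0 < h" "h \<le> 1 / 2" "d = 2 * h" using d by (auto simp: h_def)
  have near: "mm_dist (circle_space h) y z < 1 \<longleftrightarrow> \<bar>y - z\<bar> < h \<or> 1 - h < \<bar>y - z\<bar>" for y z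
    using h by (auto simp: circle_space_def pos_divide_less_eq min_less_iff_disj)
  have [simp]: "mm_measure (circle_space h) = lebesgue_on {0..<1}"
    by (simp add: circle_space_def)
  have "unit_factor (circle_space h) d"
  proof (rule unit_factor.intro)
    show "prob_space (mm_measure (circle_space h))" using lebesgue_on_unit(1) by simp
    show "ground (circle_space h) = {0..1} \<or> ground (circle_space h) = {0..<1}" by simp
    show cont: "continuous_on UNIV (\<lambda>y. mm_dist (circle_space h) y z)" for z
      unfolding circle_space_def using h by (auto intro!: continuous_intros)
    show "{y \<in> ground (circle_space h). mm_dist (circle_space h) y z < 1} \<in> sets (mm_measure (circle_space h))" for z
      using lebesgue_on_unit(5)[OF _ cont, of "{0..<1}" z] by simp
    show "\<exists>E\<in>sets (mm_measure (circle_space h)). measure (mm_measure (circle_space h)) E \<le> x + d \<and>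
      (\<forall>y\<in>ground (circle_space h). \<forall>z\<in>ground (circle_space h). z \<le> x \<longrightarrow> mm_dist (circle_space h) y z < 1 \<longrightarrow> y \<in> E)"
      if x: "0 \<le> x" for x
    proof (intro bexI conjI ballI impI)
      let ?E = "{0..<1} \<inter> ({0..<x + h} \<union> {1 - h<..<1})"
      show E: "?E \<in> sets (mm_measure (circle_space h))"
        by (simp add: lebesgue_on_unit(2) fmeasurable.Int fmeasurable.Un lmeasurable_Ico)
      have "measure lebesgue ?E \<le> measure lebesgue ({0..<x + h} \<union> {1 - h<..<1})"
        by (intro measure_mono_fmeasurable) (auto intro!: fmeasurable.Un lmeasurable_Ico)
      also have "\<dots> \<le> measure lebesgue {0..<x + h} + measure lebesgue {1 - h<..<1}"
        by (intro measure_Un_le) auto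
      also have "\<dots> = x + 2 * h" using x h by (simp add: measure_lebesgue_Ico measure_def)
      finally show "measure (mm_measure (circle_space h)) ?E \<le> x + d"
        using h by (simp add: lebesgue_on_unit(3))
      fix y z assume "y \<in> ground (circle_space h)" "z \<in> ground (circle_space h)" "z \<le> x"
        "mm_dist (circle_space h) y z < 1"
      then show "y \<in> ?E" unfolding near using x h by auto
    qed
    fix B D
    assume B: "B \<in> sets (mm_measure (circle_space h))" and D: "D \<in> sets (mm_measure (circle_space h))"
      and ne: "B \<noteq> {}"
      and BD: "\<And>y z. y \<in> ground (circle_space h) \<Longrightarrow> z \<in> B \<Longrightarrow> mm_dist (circle_space h) y z < 1 \<Longrightarrow> y \<in> D"
    have B': "B \<subseteq> {0..<1}" "B \<in> lmeasurable" and D': "D \<subseteq> {0..<1}" "D \<in> lmeasurable"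
      using B D by (auto simp: lebesgue_on_unit(2))
    have BD': "y \<in> D" if "0 \<le> y" "y < 1" "z \<in> B" "\<bar>y - z\<bar> < h \<or> 1 - h < \<bar>y - z\<bar>" for y z
      using BD[of y z] that by (simp add: near)
    have "min 1 (measure lebesgue B + d) \<le> measure lebesgue D"
    proof (cases "D = {0..<1}")
      case False
      then obtain w where w: "0 \<le> w" "w < 1" "w \<notin> D" using D' by fastforce
      have far: "h \<le> \<bar>w - z\<bar> \<and> \<bar>w - z\<bar> \<le> 1 - h" if "z \<in> B" for z using BD'[of w z] w that by fastforce
      \<comment> \<open>The part of the circle before \<open>w\<close> is moved up by a full turn.\<close>
      define U where "U = (\<lambda>S. (S \<inter> {w..<1}) \<union> (+) 1 ` (S \<inter> {0..<w}))"
      have U: "U S \<in> lmeasurable \<and> measure lebesgue (U S) = measure lebesgue S"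
        if S: "S \<in> lmeasurable" "S \<subseteq> {0..<1}" for S
      proof -
        have m: "S \<inter> {w..<1} \<in> lmeasurable" "S \<inter> {0..<w} \<in> lmeasurable" using S by (auto intro!: fmeasurable.Int lmeasurable_Ico)
        then have t: "(+) 1 ` (S \<inter> {0..<w}) \<in> lmeasurable" by (rule_tac measurable_translation)
        have "measure lebesgue (U S) = measure lebesgue (S \<inter> {w..<1}) + measure lebesgue ((+) 1 ` (S \<inter> {0..<w}))"
          unfolding U_def by (intro measure_disjoint_Un[OF m(1) t]) auto
        also have "\<dots> = measure lebesgue (S \<inter> {w..<1}) + measure lebesgue (S \<inter> {0..<w})"
          by (simp only: measure_translation)
        also have "\<dots> = measure lebesgue ((S \<inter> {w..<1}) \<union> (S \<inter> {0..<w}))"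
          by (intro measure_disjoint_Un[OF m, symmetric]) auto
        also have "(S \<inter> {w..<1}) \<union> (S \<inter> {0..<w}) = S" using S(2) w by auto
        finally show ?thesis unfolding U_def using m t by (auto intro: fmeasurable.Un)
      qed
      have "measure lebesgue (U B) + 2 * h \<le> measure lebesgue (U D)"
      proof (rule expand_both_sides[where a = w and c = "w + 1"])
        show "U B \<in> lmeasurable" "U D \<in> lmeasurable" using U B' D' by auto
        show "U B \<noteq> {}"
        proof -
          obtain z where "z \<in> B" using ne by blast
          then have "z \<in> U B \<or> 1 + z \<in> U B" using B' by (cases "z < w") (auto simp: U_def)
          then show ?thesis by blast
        qed
        show "U B \<subseteq> {w + h..w + 1 - h}"
        proof
          fix v assume "v \<in> U B"
          then consider "v \<in> B" "w \<le> v" "v < 1" | z where "v = 1 + z" "z \<in> B" "0 \<le> z" "z < w"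
            by (auto simp: U_def)
          then show "v \<in> {w + h..w + 1 - h}"
          proof cases
            case 1
            then show ?thesis using far[of v] by auto
          next
            case 2
            then show ?thesis using far[of z] by auto
          qed
        qed
        fix y v assume v: "v \<in> U B" and y: "\<bar>y - v\<bar> < h" "w < y" "y < w + 1"
        from v consider "v \<in> B" "w \<le> v" "v < 1" | z where "v = 1 + z" "z \<in> B" "0 \<le> z" "z < w"
          by (auto simp: U_def)
        then obtain z where z: "z \<in> B" "v = z \<or> v = 1 + z" "0 \<le> z" "z < 1" using w by cases auto
        show "y \<in> U D"
        proof (cases "y < 1")
          case True
          have "\<bar>y - z\<bar> < h \<or> 1 - h < \<bar>y - z\<bar>" using z(2) y(1) by linarith
          then have "y \<in> D" using BD'[of y z] z(1) y True w by simp
          then show ?thesis using True y by (simp add: U_def)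
        next
          case False
          have "\<bar>y - 1 - z\<bar> < h \<or> 1 - h < \<bar>y - 1 - z\<bar>" using z(2) y(1) by linarith
          then have "y - 1 \<in> D" using BD'[of "y - 1" z] z(1) y False w by simp
          then have "1 + (y - 1) \<in> (+) 1 ` (D \<inter> {0..<w})" using False y by (intro imageI) auto
          then show ?thesis by (simp add: U_def)
        qed
      qed (rule h)
      then show ?thesis using U B' D' h by simp
    qed auto
    then show "min 1 (measure (mm_measure (circle_space h)) B + d) \<le> measure (mm_measure (circle_space h)) D"
      using B' D' by (simp add: lebesgue_on_unit(3))
  qed (use lebesgue_on_unit(4)[of "{0..<1}"] in simp)
  then show ?thesis by (simp add: h_def)
qed

section \<open>Realising and evaluating the profile\<close>

context side_lengths
begin

text \<open>
  Coordinates whose side does not fit are dropped until every side \<open>s * \<delta> j\<close> is below \<open>1\<close> and the value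
  belongs to an actual cuboid.
\<close>

lemma cuboid_val_reduce:
  assumes "finite T" "0 < x" "x \<le> 1"
  shows "\<exists>T'\<subseteq>T. cuboid_val (card T') (prod \<delta> T') x \<le> cuboid_val (card T) (prod \<delta> T) x \<and>
    (T' = {} \<or> (\<exists>s\<ge>0. x = s ^ card T' * prod \<delta> T' \<and> (\<forall>j\<in>T'. s * \<delta> j < 1)))"
  using assms(1)
proof (induction "card T" arbitrary: T rule: less_induct)
  case (less T)
  show ?case
  proof (cases "T = {}")
    case False
    then have cT: "0 < card T" using less.prems by (simp add: card_gt_0_iff)
    obtain s where s: "0 < s" "x = s ^ card T * prod \<delta> T"
      using scale_pos_exists[OF cT prod_pos, of x T] assms by auto
    note s0 = s(1)
    show ?thesis
    proof (cases "\<exists>j\<in>T. 1 \<le> s * \<delta> j")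
      case True
      then obtain j where j: "j \<in> T" "1 \<le> s * \<delta> j" by blast
      have T': "card T = Suc (card (T - {j}))" "prod \<delta> T = \<delta> j * prod \<delta> (T - {j})"
        by (fact card.remove[OF less.prems j(1)] prod_remove[OF less.prems j(1)])+
      have k0: "prod \<delta> (T - {j}) = 1" if "card (T - {j}) = 0"
        using that less.prems by (metis card_eq_0_iff finite_Diff prod.empty)
      have le: "cuboid_val (card (T - {j})) (prod \<delta> (T - {j})) x \<le> cuboid_val (card T) (prod \<delta> T) x"
        unfolding s(2) T' by (rule cuboid_val_drop[OF side_pos prod_pos j(2) s0 k0])
      obtain T' where U: "T' \<subseteq> T - {j}"
        "cuboid_val (card T') (prod \<delta> T') x \<le> cuboid_val (card (T - {j})) (prod \<delta> (T - {j})) x"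
        "T' = {} \<or> (\<exists>s\<ge>0. x = s ^ card T' * prod \<delta> T' \<and> (\<forall>j\<in>T'. s * \<delta> j < 1))"
        using less.hyps[of "T - {j}"] T'(1) less.prems by auto
      have "T' \<subseteq> T" using U(1) by blast
      then show ?thesis using order_trans[OF U(2) le] U(3) by blast
    next
      case False
      then have "\<forall>j\<in>T. s * \<delta> j < 1" by (meson linorder_not_le)
      then show ?thesis using s(2) less_imp_le[OF s0] by blast
    qed
  qed blast
qed

lemma anti_val_reduce:
  assumes "finite T" "T \<noteq> {}" "0 < x" "x \<le> 1"
  shows "\<exists>T'\<subseteq>T. T' \<noteq> {} \<and> anti_val (card T') (prod \<delta> T') x \<le> anti_val (card T) (prod \<delta> T) x \<and>
    (\<exists>s\<ge>0. 1 - x = s ^ card T' * prod \<delta> T' \<and> (\<forall>j\<in>T'. s * \<delta> j < 1))"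
  using assms(1,2)
proof (induction "card T" arbitrary: T rule: less_induct)
  case (less T)
  have cT: "0 < card T" using less.prems by (simp add: card_gt_0_iff)
  obtain s where s: "0 \<le> s" "1 - x = s ^ card T * prod \<delta> T"
    using scale_exists[OF cT prod_pos, of "1 - x" T] assms by auto
  have x: "x = 1 - s ^ card T * prod \<delta> T" using s by linarith
  show ?case
  proof (cases "\<exists>j\<in>T. 1 \<le> s * \<delta> j")
    case True
    then obtain j where j: "j \<in> T" "1 \<le> s * \<delta> j" by blast
    have s0: "0 < s" using s j by (cases "s = 0") auto
    have T': "card T = Suc (card (T - {j}))" "prod \<delta> T = \<delta> j * prod \<delta> (T - {j})"
      by (fact card.remove[OF less.prems(1) j(1)] prod_remove[OF less.prems(1) j(1)])+
    have ne: "T - {j} \<noteq> {}"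
    proof
      assume e: "T - {j} = {}"
      then have "1 - x = s * \<delta> j" using s(2) unfolding T' e by simp
      then show False using j(2) assms by linarith
    qed
    have le: "anti_val (card (T - {j})) (prod \<delta> (T - {j})) x \<le> anti_val (card T) (prod \<delta> T) x"
    proof -
      have "0 < card (T - {j})" using ne less.prems by (metis card_gt_0_iff finite_Diff)
      then show ?thesis unfolding x T' by (rule anti_val_drop[OF side_pos prod_pos j(2) s0])
    qed
    obtain T' where U: "T' \<subseteq> T - {j}" "T' \<noteq> {}"
      "anti_val (card T') (prod \<delta> T') x \<le> anti_val (card (T - {j})) (prod \<delta> (T - {j})) x"
      "\<exists>s\<ge>0. 1 - x = s ^ card T' * prod \<delta> T' \<and> (\<forall>j\<in>T'. s * \<delta> j < 1)"
      using less.hyps[of "T - {j}"] T'(1) less.prems ne by auto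
    have "T' \<subseteq> T" using U(1) by blast
    then show ?thesis using order_trans[OF U(3) le] U(2,4) by blast
  next
    case False
    then have "\<forall>j\<in>T. s * \<delta> j < 1" by (meson linorder_not_le)
    then show ?thesis using s less.prems by blast
  qed
qed

lemma prod_initial_le:
  assumes mono: "mono_on {1..n} \<delta>" and T: "T \<subseteq> {1..n}"
  shows "prod \<delta> {1..card T} \<le> prod \<delta> T"
  using T
proof (induction "card T" arbitrary: T)
  case 0
  then have "T = {}" using finite_subset by fastforce
  then show ?case by simp
next
  case (Suc k)
  have fT: "finite T" using Suc.prems finite_subset by blast
  have ne: "T \<noteq> {}" using Suc.hyps(2) by auto
  define m where "m = Max T"
  have m: "m \<in> T" using fT ne by (simp add: m_def)
  have T': "card (T - {m}) = k" using Suc.hyps(2) m fT by simp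
  have "T \<subseteq> {1..m}" using Suc.prems fT by (auto simp: m_def)
  then have "Suc k \<le> m" using card_mono[of "{1..m}" T] Suc.hyps(2) by simp
  then have "\<delta> (Suc k) \<le> \<delta> m" using m Suc.prems by (intro mono_onD[OF mono]) auto
  moreover have "prod \<delta> {1..k} \<le> prod \<delta> (T - {m})"
    using Suc.hyps(1)[of "T - {m}"] T' Suc.prems by auto
  ultimately have "\<delta> (Suc k) * prod \<delta> {1..k} \<le> \<delta> m * prod \<delta> (T - {m})"
    using less_imp_le[OF side_pos] less_imp_le[OF prod_pos] by (intro mult_mono) auto
  moreover have "prod \<delta> {1..card T} = \<delta> (Suc k) * prod \<delta> {1..k}"
    unfolding Suc.hyps(2)[symmetric] by (simp add: mult.commute)
  ultimately show ?case using prod_remove[OF fT m] by simp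
qed

text \<open>
  For sorted \<open>\<delta>\<close>s the best \<open>t\<close> coordinates are the first \<open>t\<close> ones. The only delicate point is the domain of \<open>c_hat\<close>,
  which says that the longest side of the optimal cuboid is at most \<open>1\<close>: for the least \<open>t\<close> that attains the
  profile this holds, because otherwise coordinate \<open>t\<close> could be dropped. Outside the domain of
  \<open>a_hat\<close> the anti-cuboid value is \<open>1\<close> and \<open>c_hat \<delta> 0\<close> replaces it.
\<close>

lemma profile_eq_Min_hats:
  assumes mono: "mono_on {1..n} \<delta>" and x: "0 < x" "x \<le> 1"
  shows "ereal (profile {1..n} x) = (MIN t\<in>{0..n}. min (c_hat \<delta> t x) (a_hat \<delta> t x))"
proof (rule Min_eqI[symmetric])
  let ?J = "{1..n}"
  have fin: "finite ?J" by simp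
  show "finite ((\<lambda>t. min (c_hat \<delta> t x) (a_hat \<delta> t x)) ` {0..n})" by simp
  have le: "ereal (profile ?J x) \<le> c_hat \<delta> t x" "ereal (profile ?J x) \<le> a_hat \<delta> t x" if t: "t \<le> n" for t
  proof -
    have sub: "{1..t} \<subseteq> ?J" using t by auto
    show "ereal (profile ?J x) \<le> c_hat \<delta> t x"
      using profile_le_cuboid_val[OF fin sub, of x] profile_le_1[OF fin, of x] x by (auto simp: c_hat_def cuboid_val_def)
    show "ereal (profile ?J x) \<le> a_hat \<delta> t x"
    proof (cases "t = 0 \<or> \<not> x \<le> 1 - prod \<delta> {1..t}")
      case True
      then show ?thesis using profile_le_1[OF fin, of x] by (auto simp: a_hat_def)
    next
      case False
      then have "root t (prod \<delta> {1..t}) \<le> root t (1 - x)" by (intro real_root_le_mono) auto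
      moreover have "profile ?J x \<le> anti_val t (prod \<delta> {1..t}) x"
        using profile_le_anti_val[OF fin sub, of x] False x by auto
      ultimately show ?thesis using False x by (simp add: a_hat_def anti_val_def)
    qed
  qed
  show "\<And>y. y \<in> (\<lambda>t. min (c_hat \<delta> t x) (a_hat \<delta> t x)) ` {0..n} \<Longrightarrow> ereal (profile ?J x) \<le> y"
    using le by auto
  have "\<exists>t\<le>n. c_hat \<delta> t x \<le> ereal (profile ?J x) \<or> a_hat \<delta> t x \<le> ereal (profile ?J x)"
    using fin x(1)
  proof (cases rule: profile_attained[of ?J x])
    case (cuboid_val T0)
    define Q where "Q = (\<lambda>t. \<exists>T\<subseteq>?J. card T = t \<and> profile ?J x = cuboid_val t (prod \<delta> T) x)"
    define t where "t = (LEAST t. Q t)"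
    have "Q (card T0)" using cuboid_val by (auto simp: Q_def)
    then have "Q t" unfolding t_def by (rule LeastI)
    then obtain T where T: "T \<subseteq> ?J" "card T = t" "profile ?J x = cuboid_val t (prod \<delta> T) x" by (auto simp: Q_def)
    have tn: "t \<le> n" using card_mono[OF fin T(1)] T(2) by simp
    have small: "\<not> Q k" if "k < t" for k using that not_less_Least unfolding t_def by blast
    have "cuboid_val t (prod \<delta> {1..t}) x \<le> cuboid_val t (prod \<delta> T) x"
      using prod_initial_le[OF mono T(1)] T(2) x less_imp_le[OF prod_pos] by (intro cuboid_val_mono) auto
    moreover have "profile ?J x \<le> cuboid_val t (prod \<delta> {1..t}) x"
      using profile_le_cuboid_val[OF fin, of "{1..t}" x] tn x by auto
    ultimately have eq: "profile ?J x = cuboid_val t (prod \<delta> {1..t}) x" using T by simp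
    have "c_hat \<delta> t x = ereal (profile ?J x)"
    proof (cases "t = 0")
      case True
      then show ?thesis using eq by (simp add: c_hat_def)
    next
      case False
      then have t0: "0 < t" by simp
      obtain k where k: "t = Suc k" using False not0_implies_Suc by blast
      obtain s where s: "0 < s" "x = s ^ t * prod \<delta> {1..t}"
        using scale_pos_exists[OF t0 prod_pos, of x "{1..t}"] x by auto
      note s0 = s(1)
      have P: "prod \<delta> {1..t} = \<delta> t * prod \<delta> {1..k}" unfolding k by (simp add: mult.commute)
      have "s * \<delta> t < 1"
      proof (rule ccontr)
        assume "\<not> s * \<delta> t < 1"
        then have "cuboid_val k (prod \<delta> {1..k}) x \<le> cuboid_val t (prod \<delta> {1..t}) x"
          unfolding s(2) P unfolding k using s0 by (intro cuboid_val_drop side_pos prod_pos) auto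
        moreover have "profile ?J x \<le> cuboid_val k (prod \<delta> {1..k}) x"
          using profile_le_cuboid_val[OF fin, of "{1..k}" x] tn k x by auto
        ultimately have "profile ?J x = cuboid_val k (prod \<delta> {1..k}) x" using eq by simp
        then have "Q k" unfolding Q_def using tn k by (intro exI[of _ "{1..k}"]) auto
        then show False using small k by simp
      qed
      then have "(s * \<delta> t) ^ t \<le> 1" using s side_pos[of t] by (intro power_le_one) auto
      then have "s ^ t * \<delta> t ^ t * prod \<delta> {1..t} \<le> 1 * prod \<delta> {1..t}"
        using less_imp_le[OF prod_pos] by (intro mult_right_mono) (auto simp: power_mult_distrib)
      then have "x * \<delta> t ^ t \<le> prod \<delta> {1..t}" unfolding s(2) by (simp add: mult_ac)
      then have "x \<le> (\<Prod>i=1..t. \<delta> i / \<delta> t)"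
        using side_pos[of t] by (simp add: prod_dividef pos_le_divide_eq)
      then show ?thesis using t0 x eq by (simp add: c_hat_def cuboid_val_def)
    qed
    then show ?thesis using tn by auto
  next
    case (anti_val T)
    define t where "t = card T"
    have tn: "t \<le> n" using card_mono[OF fin anti_val(1)] by (simp add: t_def)
    have t0: "0 < t" using card_pos[OF fin anti_val(1,2)] by (simp add: t_def)
    have le': "anti_val t (prod \<delta> {1..t}) x \<le> profile ?J x"
      unfolding anti_val(3) t_def using prod_initial_le[OF mono anti_val(1)] by (intro anti_val_mono) auto
    show ?thesis
    proof (cases "x \<le> 1 - prod \<delta> {1..t}")
      case True
      then have "root t (prod \<delta> {1..t}) \<le> root t (1 - x)" using t0 by (intro real_root_le_mono) auto
      then have "a_hat \<delta> t x = ereal (anti_val t (prod \<delta> {1..t}) x)"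
        using True t0 x by (simp add: a_hat_def anti_val_def)
      then show ?thesis using tn le' by auto
    next
      case False
      then have "root t (1 - x) \<le> root t (prod \<delta> {1..t})" using t0 by (intro real_root_le_mono) auto
      then have "max 0 (root t (1 - x) - root t (prod \<delta> {1..t})) = 0" by simp
      then have "anti_val t (prod \<delta> {1..t}) x = 1" using t0 by (simp add: anti_val_def)
      then have "c_hat \<delta> 0 x \<le> ereal (profile ?J x)" using le' by (simp add: c_hat_def one_ereal_def)
      then show ?thesis by blast
    qed
  qed
  then obtain t where t: "t \<le> n" "c_hat \<delta> t x \<le> ereal (profile ?J x) \<or> a_hat \<delta> t x \<le> ereal (profile ?J x)" by blast
  then have "min (c_hat \<delta> t x) (a_hat \<delta> t x) = ereal (profile ?J x)"
    using le[OF t(1)] by (auto simp: min_def intro: antisym)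
  then show "ereal (profile ?J x) \<in> (\<lambda>t. min (c_hat \<delta> t x) (a_hat \<delta> t x)) ` {0..n}"
    using t(1) by (intro image_eqI[of _ _ t]) auto
qed

end

section \<open>Strong products of intervals and circles\<close>

locale unit_factor_product = side_lengths +
  fixes Y :: "nat \<Rightarrow> real mm_space"
  assumes factor: "\<And>i. unit_factor (Y i) (\<delta> i)"

sublocale unit_factor_product \<subseteq> expanding_factors \<delta> "\<lambda>i. mm_measure (Y i)" "\<lambda>i y z. mm_dist (Y i) y z < 1"
proof (intro expanding_factors.intro expanding_factors_axioms.intro side_lengths_axioms)
  fix i
  show "prob_space (mm_measure (Y i))" by (rule unit_factor.prob[OF factor])
  fix B D
  assume "B \<in> sets (mm_measure (Y i))" "D \<in> sets (mm_measure (Y i))" "B \<noteq> {}"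
    "\<And>y z. y \<in> ground (Y i) \<Longrightarrow> z \<in> B \<Longrightarrow> mm_dist (Y i) y z < 1 \<Longrightarrow> y \<in> D"
  then show "min 1 (measure (mm_measure (Y i)) B + \<delta> i) \<le> measure (mm_measure (Y i)) D"
    by (rule unit_factor.expand[OF factor])
qed

context unit_factor_product
begin

abbreviation prodM :: "nat set \<Rightarrow> (nat \<Rightarrow> real) measure" where
  "prodM I \<equiv> PiM I (\<lambda>i. mm_measure (Y i))"

lemma strong_product_simps [simp]:
  "mm_measure (strong_product I Y) = completion (prodM I)"
  "ground (strong_product I Y) = space (prodM I)"
  by (simp_all add: strong_product_def)

lemma nbhd_strong_product:
  assumes "finite I" "I \<noteq> {}"
  shows "nbhd (strong_product I Y) A =
    {w \<in> space (prodM I). \<exists>a\<in>A. \<forall>i\<in>I. mm_dist (Y i) (w i) (a i) < 1}"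
  using assms by (auto simp: nbhd_def strong_product_def)

text \<open>
  A neighbourhood is a union of open boxes around the points of \<open>A\<close>, and by the Lindelof property of the countable
  product of real lines countably many of them suffice.
\<close>

lemma sets_nbhd:
  assumes "finite I" "I \<noteq> {}"
  shows "nbhd (strong_product I Y) A \<in> sets (prodM I)"
proof -
  define U where "U = (\<lambda>a. {w. \<forall>i\<in>I. mm_dist (Y i) (w i) (a i) < 1})"
  have "open (U a)" for a
  proof -
    have "U a = (\<Inter>i\<in>I. {w. mm_dist (Y i) (w i) (a i) < 1})" by (auto simp: U_def)
    moreover have "open {w::nat \<Rightarrow> real. mm_dist (Y i) (w i) (a i) < 1}" for i
    proof (rule open_Collect_less)
      have "continuous_on UNIV ((\<lambda>y. mm_dist (Y i) y (a i)) \<circ> (\<lambda>w::nat \<Rightarrow> real. w i))"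
        by (rule continuous_on_compose[OF continuous_on_product_coordinates])
          (rule continuous_on_subset[OF unit_factor.dist_cont[OF factor] subset_UNIV])
      then show "continuous_on UNIV (\<lambda>w::nat \<Rightarrow> real. mm_dist (Y i) (w i) (a i))" by (simp add: o_def)
    qed (rule continuous_on_const)
    ultimately show ?thesis using assms(1) by (auto intro: open_INT)
  qed
  then have "\<And>S. S \<in> U ` A \<Longrightarrow> open S" by auto
  then obtain F where F: "F \<subseteq> U ` A" "countable F" "\<Union>F = \<Union>(U ` A)" by (rule Lindelof)
  have "space (prodM I) \<inter> S \<in> sets (prodM I)" if SF: "S \<in> F" for S
  proof -
    obtain a where "S = U a" using SF F(1) by blast
    then have "space (prodM I) \<inter> S =
        (\<Pi>\<^sub>E i\<in>I. {y \<in> ground (Y i). mm_dist (Y i) y (a i) < 1})"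
      by (auto simp: U_def space_PiM PiE_def Pi_def)
    moreover have "\<dots> \<in> sets (prodM I)"
      using assms by (intro sets_PiM_I_finite unit_factor.near_meas[OF factor]) auto
    ultimately show ?thesis by simp
  qed
  then have "(\<Union>S\<in>F. space (prodM I) \<inter> S) \<in> sets (prodM I)"
    using F(2) by (intro sets.countable_UN') auto
  also have "(\<Union>S\<in>F. space (prodM I) \<inter> S) = space (prodM I) \<inter> \<Union>(U ` A)" using F(3) by blast
  also have "\<dots> = nbhd (strong_product I Y) A"
    unfolding nbhd_strong_product[OF assms] by (auto simp: U_def)
  finally show ?thesis .
qed

text \<open>
  A set that is measurable for the completed measure contains a measurable set of the product
  sigma-algebra with the same measure and a neighbourhood that is no larger.
\<close>

lemma profile_le_measure_nbhd:
  assumes I: "finite I" "I \<noteq> {}" and A: "A \<in> sets (completion (prodM I))"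
  shows "profile I (measure (completion (prodM I)) A) \<le> measure (completion (prodM I)) (nbhd (strong_product I Y) A)"
proof -
  let ?A = "main_part (prodM I) A"
  have "?A \<subseteq> A" using main_part_null_part_Un[OF A] by blast
  then have "profile I (measure (prodM I) ?A) \<le> measure (prodM I) (nbhd (strong_product I Y) A)"
    using A sets_nbhd[OF I] by (intro profile_le_measure_expansion I) (auto simp: nbhd_strong_product[OF I])
  moreover have "measure (completion (prodM I)) A = measure (prodM I) ?A"
    using A by (simp add: measure_def)
  ultimately show ?thesis using sets_nbhd[OF I] by simp
qed

lemma measure_PiE:
  assumes "finite I" "\<And>i. i \<in> I \<Longrightarrow> E i \<in> sets (mm_measure (Y i))"
  shows "(\<Pi>\<^sub>E i\<in>I. E i) \<in> sets (prodM I)"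
    and "measure (prodM I) (\<Pi>\<^sub>E i\<in>I. E i) = (\<Prod>i\<in>I. measure (mm_measure (Y i)) (E i))"
proof -
  interpret product_prob_space "\<lambda>i. mm_measure (Y i)" UNIV by (rule product_prob_spaceI[OF factor_prob])
  interpret PI: finite_product_prob_space "\<lambda>i. mm_measure (Y i)" I by standard fact
  show "(\<Pi>\<^sub>E i\<in>I. E i) \<in> sets (prodM I)" using assms by (intro sets_PiM_I_finite) auto
  show "measure (prodM I) (\<Pi>\<^sub>E i\<in>I. E i) = (\<Prod>i\<in>I. measure (mm_measure (Y i)) (E i))"
    using assms by (intro PI.prob_times) auto
qed

lemma segment_nbhd:
  assumes "0 \<le> x"
  obtains E where "E \<in> sets (mm_measure (Y i))" "measure (mm_measure (Y i)) E \<le> min 1 (x + \<delta> i)"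
    "\<And>y z. y \<in> ground (Y i) \<Longrightarrow> z \<in> ground (Y i) \<Longrightarrow> z \<le> x \<Longrightarrow> mm_dist (Y i) y z < 1 \<Longrightarrow> y \<in> E"
proof -
  interpret prob_space "mm_measure (Y i)" by (rule factor_prob)
  obtain E where "E \<in> events" "prob E \<le> x + \<delta> i"
    "\<forall>y\<in>ground (Y i). \<forall>z\<in>ground (Y i). z \<le> x \<longrightarrow> mm_dist (Y i) y z < 1 \<longrightarrow> y \<in> E"
    using unit_factor.segment_expand[OF factor assms, of i] by auto
  then show ?thesis using that prob_le_1[of E] by auto
qed

lemma ground_subset: "ground (Y i) \<subseteq> {0..1}"
  using unit_factor.ground_cases[OF factor, of i] by auto

lemma cuboid_bounds:
  fixes n :: nat
  defines "I \<equiv> {1..n}"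
  assumes n: "1 \<le> n" and x: "\<And>i. i \<in> I \<Longrightarrow> x i \<in> {0..1}"
  defines "C \<equiv> cuboid n x \<inter> space (prodM I)"
  shows "C \<in> sets (prodM I)" and "measure (prodM I) C = (\<Prod>i\<in>I. x i)"
    and "measure (prodM I) (nbhd (strong_product I Y) C) \<le> (\<Prod>i\<in>I. min 1 (x i + \<delta> i))"
proof -
  have I: "finite I" "I \<noteq> {}" using n by (auto simp: I_def)
  have C: "C = (\<Pi>\<^sub>E i\<in>I. {0..x i} \<inter> ground (Y i))"
    unfolding C_def cuboid_def I_def[symmetric] by (simp add: space_PiM PiE_Int)
  note seg = unit_factor.segment[OF factor x]
  show "C \<in> sets (prodM I)" "measure (prodM I) C = (\<Prod>i\<in>I. x i)"
    unfolding C using measure_PiE[OF I(1), of "\<lambda>i. {0..x i} \<inter> ground (Y i)"] seg by auto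
  have "\<exists>E. E \<in> sets (mm_measure (Y i)) \<and> measure (mm_measure (Y i)) E \<le> min 1 (x i + \<delta> i) \<and>
    (\<forall>y z. y \<in> ground (Y i) \<longrightarrow> z \<in> ground (Y i) \<longrightarrow> z \<le> x i \<longrightarrow> mm_dist (Y i) y z < 1 \<longrightarrow> y \<in> E)"
    if "i \<in> I" for i
    using x[OF that] segment_nbhd[of "x i" i] by (metis atLeastAtMost_iff)
  then obtain E where E: "\<And>i. i \<in> I \<Longrightarrow> E i \<in> sets (mm_measure (Y i))"
    "\<And>i. i \<in> I \<Longrightarrow> measure (mm_measure (Y i)) (E i) \<le> min 1 (x i + \<delta> i)"
    "\<And>i y z. i \<in> I \<Longrightarrow> y \<in> ground (Y i) \<Longrightarrow> z \<in> ground (Y i) \<Longrightarrow> z \<le> x i \<Longrightarrow> mm_dist (Y i) y z < 1 \<Longrightarrow> y \<in> E i"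
    by metis
  interpret prob_space "prodM I"
  proof -
    interpret product_prob_space "\<lambda>i. mm_measure (Y i)" UNIV by (rule product_prob_spaceI[OF factor_prob])
    interpret PI: finite_product_prob_space "\<lambda>i. mm_measure (Y i)" I by standard (rule I)
    show "prob_space (prodM I)" by (rule PI.prob_space_axioms)
  qed
  have "nbhd (strong_product I Y) C \<subseteq> (\<Pi>\<^sub>E i\<in>I. E i)"
    unfolding nbhd_strong_product[OF I]
  proof
    fix w assume "w \<in> {w \<in> space (prodM I). \<exists>a\<in>C. \<forall>i\<in>I. mm_dist (Y i) (w i) (a i) < 1}"
    then obtain a where w: "w \<in> space (prodM I)" and a: "a \<in> C"
      and wa: "\<forall>i\<in>I. mm_dist (Y i) (w i) (a i) < 1" by blast
    have "w i \<in> E i" if i: "i \<in> I" for i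
      using E(3)[OF i, of "w i" "a i"] w a wa i by (auto simp: C space_PiM PiE_def Pi_def)
    then show "w \<in> (\<Pi>\<^sub>E i\<in>I. E i)" using w by (auto simp: space_PiM PiE_def Pi_def)
  qed
  then have "prob (nbhd (strong_product I Y) C) \<le> prob (\<Pi>\<^sub>E i\<in>I. E i)"
    using measure_PiE(1)[OF I(1) E(1)] by (intro finite_measure_mono) auto
  also have "\<dots> = (\<Prod>i\<in>I. measure (mm_measure (Y i)) (E i))" by (rule measure_PiE(2)[OF I(1) E(1)])
  also have "\<dots> \<le> (\<Prod>i\<in>I. min 1 (x i + \<delta> i))" using E(2) by (intro prod_mono) auto
  finally show "prob (nbhd (strong_product I Y) C) \<le> (\<Prod>i\<in>I. min 1 (x i + \<delta> i))" .
qed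

text \<open>
  The complement of an anti-cuboid is a box with sides \<open>1 - x i\<close>, and a smaller box stays outside the
  neighbourhood. A coordinate with \<open>x i = 0\<close> contributes no points to the anti-cuboid and hence does
  not shrink the box.
\<close>

lemma anti_cuboid_bounds:
  fixes n :: nat
  defines "I \<equiv> {1..n}"
  assumes n: "1 \<le> n" and x: "\<And>i. i \<in> I \<Longrightarrow> x i \<in> {0..1}"
  defines "C \<equiv> anti_cuboid n x \<inter> space (prodM I)"
  shows "C \<in> sets (prodM I)" and "measure (prodM I) C = 1 - (\<Prod>i\<in>I. 1 - x i)"
    and "measure (prodM I) (nbhd (strong_product I Y) C) \<le>
      1 - (\<Prod>i\<in>I. if x i = 0 then 1 else max 0 (1 - x i - \<delta> i))"
proof -
  have I: "finite I" "I \<noteq> {}" using n by (auto simp: I_def)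
  interpret prob_space "prodM I"
  proof -
    interpret product_prob_space "\<lambda>i. mm_measure (Y i)" UNIV by (rule product_prob_spaceI[OF factor_prob])
    interpret PI: finite_product_prob_space "\<lambda>i. mm_measure (Y i)" I by standard (rule I)
    show "prob_space (prodM I)" by (rule PI.prob_space_axioms)
  qed
  have mcompl: "ground (Y i) - F \<in> sets (mm_measure (Y i))"
    "measure (mm_measure (Y i)) (ground (Y i) - F) = 1 - measure (mm_measure (Y i)) F"
    if "F \<in> sets (mm_measure (Y i))" for F i
    using that prob_space.prob_compl[OF factor_prob that] by auto
  define G where "G = (\<lambda>i. ground (Y i) - ({0..<x i} \<inter> ground (Y i)))"
  have gr: "a i \<in> {0..1}" if "a \<in> space (prodM I)" "i \<in> I" for a i
    using that ground_subset[of i] by (auto simp: space_PiM PiE_def Pi_def)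
  have C: "C = space (prodM I) - (\<Pi>\<^sub>E i\<in>I. G i)"
  proof (intro equalityI subsetI)
    fix a assume "a \<in> C"
    then obtain i where "i \<in> I" "a i < x i" "a \<in> space (prodM I)" "0 \<le> a i"
      using gr by (fastforce simp: C_def anti_cuboid_def I_def)
    then show "a \<in> space (prodM I) - (\<Pi>\<^sub>E i\<in>I. G i)" by (fastforce simp: G_def space_PiM PiE_def Pi_def)
  next
    fix a assume a: "a \<in> space (prodM I) - (\<Pi>\<^sub>E i\<in>I. G i)"
    then obtain i where i: "i \<in> I" "a i \<notin> G i" by (auto simp: space_PiM PiE_def Pi_def)
    then have "a i < x i" using a by (auto simp: G_def space_PiM PiE_def Pi_def)
    moreover have "a \<in> (\<Pi>\<^sub>E j\<in>I. {0..1})" using a gr by (auto simp: space_PiM PiE_def Pi_def)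
    ultimately show "a \<in> C" using a i unfolding C_def anti_cuboid_def I_def[symmetric] by blast
  qed
  note seg = unit_factor.segment[OF factor x]
  have G: "G i \<in> sets (mm_measure (Y i))" "measure (mm_measure (Y i)) (G i) = 1 - x i" if "i \<in> I" for i
    unfolding G_def using mcompl[of "{0..<x i} \<inter> ground (Y i)" i] seg[OF that] by auto
  show "C \<in> sets (prodM I)" unfolding C using measure_PiE(1)[OF I(1) G(1)] by auto
  show "prob C = 1 - (\<Prod>i\<in>I. 1 - x i)"
    unfolding C using prob_compl[OF measure_PiE(1)[OF I(1) G(1)]] measure_PiE(2)[OF I(1) G(1)] G(2) by simp
  have "\<exists>E. E \<in> sets (mm_measure (Y i)) \<and>
    (if x i = 0 then 1 else max 0 (1 - x i - \<delta> i)) \<le> 1 - measure (mm_measure (Y i)) E \<and>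
    (\<forall>y z. y \<in> ground (Y i) \<longrightarrow> z \<in> ground (Y i) \<longrightarrow> z < x i \<longrightarrow> mm_dist (Y i) y z < 1 \<longrightarrow> y \<in> E)"
    if i: "i \<in> I" for i
  proof (cases "x i = 0")
    case True
    then show ?thesis using ground_subset[of i] by (intro exI[of _ "{}"]) fastforce
  next
    case False
    have "0 \<le> x i" using x[OF i] by simp
    then obtain E where "E \<in> sets (mm_measure (Y i))" "measure (mm_measure (Y i)) E \<le> min 1 (x i + \<delta> i)"
      "\<And>y z. y \<in> ground (Y i) \<Longrightarrow> z \<in> ground (Y i) \<Longrightarrow> z \<le> x i \<Longrightarrow> mm_dist (Y i) y z < 1 \<Longrightarrow> y \<in> E"
      using segment_nbhd by blast
    then show ?thesis using False by (intro exI[of _ E]) auto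
  qed
  then obtain E where E: "\<And>i. i \<in> I \<Longrightarrow> E i \<in> sets (mm_measure (Y i))"
    "\<And>i. i \<in> I \<Longrightarrow> (if x i = 0 then 1 else max 0 (1 - x i - \<delta> i)) \<le> 1 - measure (mm_measure (Y i)) (E i)"
    "\<And>i y z. i \<in> I \<Longrightarrow> y \<in> ground (Y i) \<Longrightarrow> z \<in> ground (Y i) \<Longrightarrow> z < x i \<Longrightarrow> mm_dist (Y i) y z < 1 \<Longrightarrow> y \<in> E i"
    by metis
  define H where "H = (\<lambda>i. ground (Y i) - E i)"
  have H: "H i \<in> sets (mm_measure (Y i))" "measure (mm_measure (Y i)) (H i) = 1 - measure (mm_measure (Y i)) (E i)"
    if "i \<in> I" for i unfolding H_def using mcompl[OF E(1)[OF that]] by auto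
  note HH = measure_PiE[OF I(1) H(1)]
  have "nbhd (strong_product I Y) C \<subseteq> space (prodM I) - (\<Pi>\<^sub>E i\<in>I. H i)"
    unfolding nbhd_strong_product[OF I]
  proof safe
    fix w a assume w: "w \<in> space (prodM I)" and a: "a \<in> C" and wa: "\<forall>i\<in>I. mm_dist (Y i) (w i) (a i) < 1"
      and wH: "w \<in> (\<Pi>\<^sub>E i\<in>I. H i)"
    obtain i where i: "i \<in> I" "a i < x i" "a \<in> space (prodM I)"
      using a by (auto simp: C_def anti_cuboid_def I_def)
    then have "w i \<in> E i" using E(3)[OF i(1), of "w i" "a i"] w wa by (auto simp: space_PiM PiE_def Pi_def)
    then show False using wH i by (auto simp: H_def PiE_def Pi_def)
  qed
  then have "prob (nbhd (strong_product I Y) C) \<le> prob (space (prodM I) - (\<Pi>\<^sub>E i\<in>I. H i))"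
    using HH(1) by (intro finite_measure_mono) auto
  also have "\<dots> = 1 - (\<Prod>i\<in>I. 1 - measure (mm_measure (Y i)) (E i))"
    using prob_compl[OF HH(1)] HH(2) H(2) by simp
  also have "\<dots> \<le> 1 - (\<Prod>i\<in>I. if x i = 0 then 1 else max 0 (1 - x i - \<delta> i))"
    using E(2) by (intro diff_left_mono prod_mono) auto
  finally show "prob (nbhd (strong_product I Y) C) \<le>
      1 - (\<Prod>i\<in>I. if x i = 0 then 1 else max 0 (1 - x i - \<delta> i))" .
qed

lemma iso_min_eqI:
  assumes I: "finite I" "I \<noteq> {}" and C: "C \<in> sets (prodM I)" "\<alpha> \<le> measure (prodM I) C" 
    and nb: "measure (prodM I) (nbhd (strong_product I Y) C) \<le> profile I \<alpha>"
  shows "iso_min (strong_product I Y) \<alpha> = profile I \<alpha>" and "C \<in> Iso_sets (strong_product I Y) \<alpha>"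
proof -
  have lower: "profile I \<alpha> \<le> measure (completion (prodM I)) (nbhd (strong_product I Y) A)"
    if "A \<in> sets (completion (prodM I))" "\<alpha> \<le> measure (completion (prodM I)) A" for A
    using profile_le_measure_nbhd[OF I that(1)] profile_mono[OF I(1) that(2)] by linarith
  have CC: "C \<in> sets (completion (prodM I))" "\<alpha> \<le> measure (completion (prodM I)) C" using C by auto
  have eq: "measure (completion (prodM I)) (nbhd (strong_product I Y) C) = profile I \<alpha>"
    using lower[OF CC] nb sets_nbhd[OF I, of C] by simp
  show "iso_min (strong_product I Y) \<alpha> = profile I \<alpha>"
    unfolding iso_min_def
  proof (rule cInf_eq_minimum)
    show "profile I \<alpha> \<in> {measure (mm_measure (strong_product I Y)) (nbhd (strong_product I Y) A) |A.
        A \<in> sets (mm_measure (strong_product I Y)) \<and> \<alpha> \<le> measure (mm_measure (strong_product I Y)) A}"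
      using CC eq by force
  qed (use lower in auto)
  then show "C \<in> Iso_sets (strong_product I Y) \<alpha>" using CC eq by (simp add: Iso_sets_def)
qed

text \<open>
  A minimiser of the profile that fits into the unit cube gives the sides: \<open>s * \<delta> i\<close> for a cuboid and
  \<open>1 - s * \<delta> i\<close> for an anti-cuboid, and the trivial sides \<open>1\<close> and \<open>0\<close> for the coordinates that do not take part. For
  \<open>\<alpha> = 0\<close> the empty anti-cuboid is optimal.
\<close>

theorem iso_attained:
  fixes n :: nat
  assumes n: "1 \<le> n" and \<alpha>: "0 \<le> \<alpha>" "\<alpha> \<le> 1"
  shows "iso_min (strong_product {1..n} Y) \<alpha> = profile {1..n} \<alpha> \<and>
    (\<exists>x. (\<forall>i\<in>{1..n}. x i \<in> {0..1}) \<and>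
      (cuboid n x \<inter> ground (strong_product {1..n} Y) \<in> Iso_sets (strong_product {1..n} Y) \<alpha> \<or>
       anti_cuboid n x \<inter> ground (strong_product {1..n} Y) \<in> Iso_sets (strong_product {1..n} Y) \<alpha>))"
proof -
  let ?I = "{1..n}"
  have I: "finite ?I" "?I \<noteq> {}" using n by auto
  have cub: ?thesis if x: "\<And>i. i \<in> ?I \<Longrightarrow> x i \<in> {0..1}" and "\<alpha> \<le> (\<Prod>i\<in>?I. x i)"
      "(\<Prod>i\<in>?I. min 1 (x i + \<delta> i)) \<le> profile ?I \<alpha>" for x
  proof -
    let ?C = "cuboid n x \<inter> space (prodM ?I)"
    have "?C \<in> sets (prodM ?I)" by (rule cuboid_bounds(1)[OF n]) (use x in blast)
    moreover have "\<alpha> \<le> measure (prodM ?I) ?C"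
      using cuboid_bounds(2)[OF n, of x] x that(2) by simp
    moreover have "measure (prodM ?I) (nbhd (strong_product ?I Y) ?C) \<le> profile ?I \<alpha>"
      using cuboid_bounds(3)[OF n, of x] x that(3) by simp
    ultimately have "iso_min (strong_product ?I Y) \<alpha> = profile ?I \<alpha>"
      "cuboid n x \<inter> ground (strong_product ?I Y) \<in> Iso_sets (strong_product ?I Y) \<alpha>"
      using iso_min_eqI[OF I, of ?C \<alpha>] by simp_all
    then show ?thesis using x by blast
  qed
  have anti: ?thesis if x: "\<And>i. i \<in> ?I \<Longrightarrow> x i \<in> {0..1}" and "\<alpha> \<le> 1 - (\<Prod>i\<in>?I. 1 - x i)"
      "1 - (\<Prod>i\<in>?I. if x i = 0 then 1 else max 0 (1 - x i - \<delta> i)) \<le> profile ?I \<alpha>" for x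
  proof -
    let ?C = "anti_cuboid n x \<inter> space (prodM ?I)"
    have "?C \<in> sets (prodM ?I)" by (rule anti_cuboid_bounds(1)[OF n]) (use x in blast)
    moreover have "\<alpha> \<le> measure (prodM ?I) ?C"
      using anti_cuboid_bounds(2)[OF n, of x] x that(2) by simp
    moreover have "measure (prodM ?I) (nbhd (strong_product ?I Y) ?C) \<le> profile ?I \<alpha>"
      using anti_cuboid_bounds(3)[OF n, of x] x that(3) by simp
    ultimately have "iso_min (strong_product ?I Y) \<alpha> = profile ?I \<alpha>"
      "anti_cuboid n x \<inter> ground (strong_product ?I Y) \<in> Iso_sets (strong_product ?I Y) \<alpha>"
      using iso_min_eqI[OF I, of ?C \<alpha>] by simp_all
    then show ?thesis using x by blast
  qed
  show ?thesis
  proof (cases "\<alpha> = 0")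
    case True
    show ?thesis by (rule anti[of "\<lambda>_. 0"]) (use True in auto)
  next
    case False
    then have \<alpha>0: "0 < \<alpha>" using \<alpha> by simp
    with I(1) show ?thesis
    proof (cases rule: profile_attained[of ?I \<alpha>])
      case (cuboid_val T)
      have "finite T" using cuboid_val(1) finite_subset by blast
      then obtain T' where T': "T' \<subseteq> T" "cuboid_val (card T') (prod \<delta> T') \<alpha> \<le> profile ?I \<alpha>"
        "T' = {} \<or> (\<exists>s\<ge>0. \<alpha> = s ^ card T' * prod \<delta> T' \<and> (\<forall>j\<in>T'. s * \<delta> j < 1))"
        using cuboid_val_reduce[OF _ \<alpha>0 \<alpha>(2)] cuboid_val(2) by metis
      have sub: "T' \<subseteq> ?I" using T' cuboid_val by blast
      show ?thesis
      proof (cases "T' = {}")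
        case True
        then show ?thesis using T'(2) \<alpha>
          by (intro cub[of "\<lambda>_. 1"]) (auto simp: less_imp_le[OF side_pos] min_absorb1)
      next
        case False
        then obtain s where s: "0 \<le> s" "\<alpha> = s ^ card T' * prod \<delta> T'" "\<forall>j\<in>T'. s * \<delta> j < 1"
          using T'(3) by blast
        define x where "x = (\<lambda>i. if i \<in> T' then s * \<delta> i else 1)"
        show ?thesis
        proof (rule cub[of x])
          show "x i \<in> {0..1}" if "i \<in> ?I" for i
            using s less_imp_le[OF side_pos[of i]] by (auto simp: x_def intro: less_imp_le)
          have "(\<Prod>i\<in>?I. x i) = (\<Prod>i\<in>T'. s * \<delta> i)"
            using sub by (intro prod.mono_neutral_cong_right) (auto simp: x_def)
          also have "\<dots> = \<alpha>" unfolding s(2) by (simp add: prod.distrib)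
          finally show "\<alpha> \<le> (\<Prod>i\<in>?I. x i)" by simp
          have "(\<Prod>i\<in>?I. min 1 (x i + \<delta> i)) = (\<Prod>i\<in>T'. min 1 (s * \<delta> i + \<delta> i))"
            using sub less_imp_le[OF side_pos]
            by (intro prod.mono_neutral_cong_right) (auto simp: x_def min_absorb1)
          also have "\<dots> \<le> (\<Prod>i\<in>T'. (1 + s) * \<delta> i)"
            using s less_imp_le[OF side_pos] by (intro prod_mono) (auto simp: algebra_simps)
          also have "\<dots> = (1 + s) ^ card T' * prod \<delta> T'" by (simp add: prod.distrib)
          also have "\<dots> = cuboid_val (card T') (prod \<delta> T') \<alpha>"
            unfolding s(2) using card_pos[OF I(1) sub False] s less_imp_le[OF prod_pos]
            by (intro cuboid_val_scale[symmetric]) auto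
          finally show "(\<Prod>i\<in>?I. min 1 (x i + \<delta> i)) \<le> profile ?I \<alpha>" using T'(2) by simp
        qed
      qed
    next
      case (anti_val T)
      have "finite T" using anti_val(1) finite_subset by blast
      then obtain T' s where T': "T' \<subseteq> T" "T' \<noteq> {}" "anti_val (card T') (prod \<delta> T') \<alpha> \<le> profile ?I \<alpha>"
        and s: "0 \<le> s" "1 - \<alpha> = s ^ card T' * prod \<delta> T'" "\<forall>j\<in>T'. s * \<delta> j < 1"
        using anti_val_reduce[OF _ anti_val(2) \<alpha>0 \<alpha>(2)] anti_val(3) by metis
      have sub: "T' \<subseteq> ?I" using T' anti_val by blast
      have \<alpha>_eq: "\<alpha> = 1 - s ^ card T' * prod \<delta> T'" using s(2) by linarith
      define x where "x = (\<lambda>i. if i \<in> T' then 1 - s * \<delta> i else 0)"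
      show ?thesis
      proof (rule anti[of x])
        show "x i \<in> {0..1}" if "i \<in> ?I" for i
          using s less_imp_le[OF side_pos[of i]] by (auto simp: x_def intro: less_imp_le)
        have "(\<Prod>i\<in>?I. 1 - x i) = (\<Prod>i\<in>T'. s * \<delta> i)"
          using sub by (intro prod.mono_neutral_cong_right) (auto simp: x_def)
        also have "\<dots> = 1 - \<alpha>" unfolding s(2) by (simp add: prod.distrib)
        finally show "\<alpha> \<le> 1 - (\<Prod>i\<in>?I. 1 - x i)" by simp
        have "(\<Prod>i\<in>?I. if x i = 0 then 1 else max 0 (1 - x i - \<delta> i)) = (\<Prod>i\<in>T'. max 0 (s - 1) * \<delta> i)"
        proof (intro prod.mono_neutral_cong_right)
          fix i assume i: "i \<in> T'"
          then have "x i \<noteq> 0" using s(3) by (auto simp: x_def)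
          moreover have "max 0 (s * \<delta> i - \<delta> i) = max 0 (s - 1) * \<delta> i"
            using side_pos[of i] by (simp add: max_mult_distrib_right left_diff_distrib)
          ultimately show "(if x i = 0 then 1 else max 0 (1 - x i - \<delta> i)) = max 0 (s - 1) * \<delta> i"
            using i by (simp add: x_def)
        qed (use sub in \<open>auto simp: x_def\<close>)
        also have "\<dots> = max 0 (s - 1) ^ card T' * prod \<delta> T'" by (simp add: prod.distrib)
        finally have "1 - (\<Prod>i\<in>?I. if x i = 0 then 1 else max 0 (1 - x i - \<delta> i)) =
            anti_val (card T') (prod \<delta> T') \<alpha>"
          unfolding \<alpha>_eq using card_pos[OF I(1) sub T'(2)] s(1) less_imp_le[OF prod_pos]
          by (subst anti_val_scale) auto
        then show "1 - (\<Prod>i\<in>?I. if x i = 0 then 1 else max 0 (1 - x i - \<delta> i)) \<le> profile ?I \<alpha>"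
          using T'(3) by simp
      qed
    qed
  qed
qed

end

text \<open>
  The coordinates outside \<open>1, \<dots>, n\<close> are filled with unit intervals, because the general development
  indexes its factors by all natural numbers.
\<close>

theorem theorem8p1:
  fixes n :: nat and \<delta> :: "nat \<Rightarrow> real" and X :: "nat \<Rightarrow> real mm_space"
  assumes "n \<ge> 1"
    and "\<And>i. i \<in> {1..n} \<Longrightarrow> 0 < \<delta> i \<and> \<delta> i \<le> 1"
    and "\<And>i. i \<in> {1..n} \<Longrightarrow> X i \<in> {interval_space (\<delta> i), circle_space (\<delta> i / 2)}"
  shows "(\<forall>\<alpha>\<in>{0..1}. \<exists>x. (\<forall>i\<in>{1..n}. x i \<in> {0..1}) \<and>
            (cuboid n x \<inter> ground (strong_product {1..n} X) \<in> Iso_sets (strong_product {1..n} X) \<alpha> \<or>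
             anti_cuboid n x \<inter> ground (strong_product {1..n} X) \<in> Iso_sets (strong_product {1..n} X) \<alpha>)) \<and>
         (mono_on {1..n} \<delta> \<longrightarrow>
            (\<forall>\<alpha>\<in>{0<..1}. ereal (iso_min (strong_product {1..n} X) \<alpha>) =
               (MIN t\<in>{0..n}. min (c_hat \<delta> t \<alpha>) (a_hat \<delta> t \<alpha>))))"
proof -
  define d where "d = (\<lambda>i. if i \<in> {1..n} then \<delta> i else 1)"
  define Y where "Y = (\<lambda>i. if i \<in> {1..n} then X i else interval_space 1)"
  interpret unit_factor_product d Y
  proof (intro unit_factor_product.intro side_lengths.intro unit_factor_product_axioms.intro)
    show "0 < d i" "d i \<le> 1" for i using assms(2) by (auto simp: d_def)
    show "unit_factor (Y i) (d i)" for i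
    proof (cases "i \<in> {1..n}")
      case True
      then show ?thesis
        using assms(2)[OF True] assms(3)[OF True] unit_factor_interval unit_factor_circle
        unfolding d_def Y_def if_P[OF True] by auto
    next
      case False
      then show ?thesis
        unfolding d_def Y_def if_not_P[OF False] by (intro unit_factor_interval) auto
    qed
  qed
  have XY: "strong_product {1..n} X = strong_product {1..n} Y"
  proof -
    have "PiM {1..n} (\<lambda>i. mm_measure (X i)) = PiM {1..n} (\<lambda>i. mm_measure (Y i))"
      by (intro PiM_cong) (auto simp: Y_def)
    moreover have "(MAX i\<in>{1..n}. mm_dist (X i) (x i) (y i)) = (MAX i\<in>{1..n}. mm_dist (Y i) (x i) (y i))" for x y
      by (intro arg_cong[where f = Max] image_cong) (auto simp: Y_def)
    ultimately show ?thesis unfolding strong_product_def by simp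
  qed
  have hats: "c_hat \<delta> t \<alpha> = c_hat d t \<alpha>" "a_hat \<delta> t \<alpha> = a_hat d t \<alpha>" if "t \<in> {0..n}" for t \<alpha>
  proof -
    have "(\<Prod>i=1..t. \<delta> i) = (\<Prod>i=1..t. d i)" "(\<Prod>i=1..t. \<delta> i / \<delta> t) = (\<Prod>i=1..t. d i / d t)"
      using that by (auto simp: d_def intro!: prod.cong)
    then show "c_hat \<delta> t \<alpha> = c_hat d t \<alpha>" "a_hat \<delta> t \<alpha> = a_hat d t \<alpha>"
      unfolding c_hat_def a_hat_def by simp_all
  qed
  have "ereal (iso_min (strong_product {1..n} X) \<alpha>) = (MIN t\<in>{0..n}. min (c_hat \<delta> t \<alpha>) (a_hat \<delta> t \<alpha>))"
    if mono: "mono_on {1..n} \<delta>" and \<alpha>: "\<alpha> \<in> {0<..1}" for \<alpha>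
  proof -
    have mono': "mono_on {1..n} d" using mono by (auto simp: mono_on_def d_def)
    have "ereal (iso_min (strong_product {1..n} X) \<alpha>) = ereal (profile {1..n} \<alpha>)"
      using iso_attained[OF assms(1), of \<alpha>] \<alpha> unfolding XY by simp
    also have "\<dots> = (MIN t\<in>{0..n}. min (c_hat d t \<alpha>) (a_hat d t \<alpha>))"
      using \<alpha> by (intro profile_eq_Min_hats mono') auto
    also have "\<dots> = (MIN t\<in>{0..n}. min (c_hat \<delta> t \<alpha>) (a_hat \<delta> t \<alpha>))"
      by (intro arg_cong[where f = Min] image_cong) (simp_all add: hats)
    finally show ?thesis .
  qed
  moreover have "\<exists>x. (\<forall>i\<in>{1..n}. x i \<in> {0..1}) \<and>
      (cuboid n x \<inter> ground (strong_product {1..n} X) \<in> Iso_sets (strong_product {1..n} X) \<alpha> \<or>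
       anti_cuboid n x \<inter> ground (strong_product {1..n} X) \<in> Iso_sets (strong_product {1..n} X) \<alpha>)"
    if "\<alpha> \<in> {0..1}" for \<alpha>
    using iso_attained[OF assms(1), of \<alpha>] that unfolding XY by simp
  ultimately show ?thesis by blast
qed

end
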